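(* Let $E$ be a complex Banach lattice and let $(e^{tA})_{t\ge 0}$ be a real, individually eventually positive, and persistently irreducible $C_0$-semigroup on $E$. (a) Assume that the spectral bound $s(A)$ is not $-\infty$ and is an eigenvalue of $A$. If the operator family $\big((\lambda-s(A))\,\mathcal R(\lambda,A)\big)_{\lambda>s(A)}$ is bounded in some right neighbourhood of $s(A)$, then $s(A)$ is an algebraically simple eigenvalue of $A$, the eigenspace $\ker(s(A)-A)$ is spanned by a quasi-interior point of $E_+$, and the dual eigenspace $\ker(s(A)-A')$ contains a strictly positive functional. (b) If the semigroup is mean ergodic and the mean ergodic projection $P$ is non-zero, then $P=u\otimes\varphi$ for a quasi-interior point $u$ of $E_+$ and a strictly positive functional $\varphi\in E'$. (c) If $s(A)$ is not $-\infty$ and is a pole of the resolvent of $A$, then the pole is simple and the corresponding spectral projection $P$ is given by $P=u\otimes\varphi$ for a quasi-interior point $u$ of $E_+$ and a strictly positive functional $\varphi\in E'$.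
   Context: $E_+$ is the positive cone, $E_{\mathbb R}$ the real part of $E$. A semigroup is real if $e^{tA}(E_{\mathbb R})\subseteq E_{\mathbb R}$ for all $t\ge 0$. It is individually eventually positive if for each $0\le f\in E$ there exists $t_0\ge 0$ such that $e^{tA}f\ge 0$ for all $t\ge t_0$. It is persistently irreducible if the only closed ideals $I$ of $E$ for which there exists $t_0\ge 0$ with $e^{tA}I\subseteq I$ for all $t\ge t_0$ are $\{0\}$ and $E$. The spectral bound is $s(A)=\sup\{\operatorname{Re}\lambda:\lambda\in\sigma(A)\}\in[-\infty,\infty)$; $\mathcal R(\lambda,A)=(\lambda-A)^{-1}$. The semigroup is mean ergodic if the Cesàro means $\frac1t\int_0^t e^{sA}\,\mathrm ds$ converge strongly as $t\to\infty$; the limit $P$ is the mean ergodic projection. For $u\in E$, $\varphi\in E'$, $u\otimes\varphi$ denotes the operator $f\mapsto\langle\varphi,f\rangle u$ on $E$. A vector $u\in E_+$ is a quasi-interior point of $E_+$ if the principal ideal $E_u=\{f\in E:\ |f|\le cu\text{ for some }c>0\}$ is dense in $E$. A positive functional on $E$ is strictly positive if its kernel contains no positive non-zero element. An eigenvalue $\lambda$ of $A$ is algebraically simple if $\bigcup_{n\in\mathbb N}\ker\big((\lambda-A)^n\big)$ is one-dimensional. *)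

theory Defs
  imports "HOL-Complex_Analysis.Complex_Analysis" "HOL-Library.Lattice_Algebras"
begin

class banach_lattice = banach + ordered_real_vector + lattice_ab_group_add_abs +
  assumes norm_mono_abs: "\<bar>x\<bar> \<le> \<bar>y\<bar> \<Longrightarrow> norm x \<le> norm y"

instance real :: banach_lattice
  by standard (auto simp: sup_real_def)

lemma norm_mono_nonneg:
  fixes x y :: "'a::banach_lattice"
  assumes "0 \<le> x" "x \<le> y"
  shows "norm x \<le> norm y"
  using assms by (intro norm_mono_abs) (auto dest: order_trans)

lemma nonneg_limit:
  fixes X :: "nat \<Rightarrow> 'a::banach_lattice"
  assumes lim: "X \<longlonglongrightarrow> x" and pos: "\<And>n. 0 \<le> X n"
  shows "0 \<le> x"
proof -
  have "norm (sup (- x) 0) \<le> norm (X n - x)" for n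
  proof (rule norm_mono_abs)
    have "- x \<le> X n - x" using pos[of n] by simp
    also have "\<dots> \<le> \<bar>X n - x\<bar>" by (rule abs_ge_self)
    finally have "sup (- x) 0 \<le> \<bar>X n - x\<bar>" by simp
    moreover have "\<bar>sup (- x) 0\<bar> = sup (- x) 0"
      by (rule abs_of_nonneg) simp
    ultimately show "\<bar>sup (- x) 0\<bar> \<le> \<bar>X n - x\<bar>" by simp
  qed
  moreover have "(\<lambda>n. norm (X n - x)) \<longlonglongrightarrow> 0"
    using lim by (simp add: LIM_zero tendsto_norm_zero)
  ultimately have "norm (sup (- x) 0) \<le> 0"
    by (meson LIMSEQ_le_const)
  then have "sup (- x) 0 = 0" by simp
  then have "- x \<le> 0" by (metis sup_ge1)
  then show ?thesis by simp
qed

lemma le_limit: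
  fixes X :: "nat \<Rightarrow> 'a::banach_lattice"
  assumes "X \<longlonglongrightarrow> x" "Y \<longlonglongrightarrow> y" "\<And>n. X n \<le> Y n"
  shows "x \<le> y"
proof -
  have "0 \<le> y - x"
    by (rule nonneg_limit[of "\<lambda>n. Y n - X n"]) (use assms in \<open>auto intro: tendsto_diff\<close>)
  then show ?thesis by simp
qed

text \<open>A complex Banach lattice is the complexification \<open>E = F + iF\<close> of a real Banach lattice
  \<open>F\<close> (so that \<open>F\<close> is the real part of \<open>E\<close>), with modulus
  \<open>|z| = sup {Re (e\<^sup>i\<^sup>t z) | t \<in> \<real>}\<close> and norm \<open>\<parallel>z\<parallel> = \<parallel> |z| \<parallel>\<close>.
  The modulus takes its values in \<open>F\<close>.\<close>

datatype 'a complexification = Cplx (cre: 'a) (cim: 'a)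

lemma complexification_eq_iff: "z = w \<longleftrightarrow> cre z = cre w \<and> cim z = cim w"
  by (cases z; cases w) auto

definition modulus :: "'a::banach_lattice complexification \<Rightarrow> 'a" where
  "modulus z = (LEAST m. \<forall>t. cos t *\<^sub>R cre z - sin t *\<^sub>R cim z \<le> m)"

lemma scaleR_le_abs:
  fixes x :: "'a::banach_lattice"
  shows "a *\<^sub>R x \<le> \<bar>a\<bar> *\<^sub>R \<bar>x\<bar>"
proof (cases "0 \<le> a")
  case True
  then show ?thesis by (simp add: scaleR_left_mono abs_ge_self)
next
  case False
  have "(- a) *\<^sub>R (- x) \<le> (- a) *\<^sub>R \<bar>x\<bar>"
    using False by (intro scaleR_left_mono) (auto simp: abs_ge_minus_self)
  then show ?thesis using False by simp
qed

lemma modulus_exists: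
  fixes x y :: "'a::banach_lattice"
  shows "\<exists>m. (\<forall>t. cos t *\<^sub>R x - sin t *\<^sub>R y \<le> m) \<and>
             (\<forall>w. (\<forall>t. cos t *\<^sub>R x - sin t *\<^sub>R y \<le> w) \<longrightarrow> m \<le> w)"
proof -
  define u where "u c = Re c *\<^sub>R x - Im c *\<^sub>R y" for c
  define e where "e = \<bar>x\<bar> + \<bar>y\<bar>"
  have e0: "0 \<le> e" by (simp add: e_def)
  have u_diff: "u c \<le> u d + norm (c - d) *\<^sub>R e" for c d
  proof -
    have "u c - u d = (Re c - Re d) *\<^sub>R x + (Im d - Im c) *\<^sub>R y"
      by (simp add: u_def algebra_simps)
    also have "\<dots> \<le> \<bar>Re c - Re d\<bar> *\<^sub>R \<bar>x\<bar> + \<bar>Im d - Im c\<bar> *\<^sub>R \<bar>y\<bar>"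
      by (intro add_mono scaleR_le_abs)
    also have "\<dots> \<le> norm (c - d) *\<^sub>R \<bar>x\<bar> + norm (c - d) *\<^sub>R \<bar>y\<bar>"
      by (intro add_mono scaleR_right_mono)
        (use abs_Re_le_cmod[of "c - d"] abs_Im_le_cmod[of "c - d"] in auto)
    finally show ?thesis by (simp add: e_def algebra_simps)
  qed
  have "\<exists>F. finite F \<and> F \<noteq> {} \<and> F \<subseteq> sphere (0::complex) 1 \<and>
          (\<forall>c\<in>sphere 0 1. \<exists>d\<in>F. norm (c - d) < inverse (real (Suc n)))" for n
  proof -
    obtain F where F: "finite F" "F \<subseteq> sphere (0::complex) 1"
      "sphere 0 1 \<subseteq> (\<Union>d\<in>F. ball d (inverse (real (Suc n))))"
    proof -
      have "\<exists>F. finite F \<and> F \<subseteq> sphere (0::complex) 1 \<and>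
          sphere 0 1 \<subseteq> (\<Union>d\<in>F. ball d (inverse (real (Suc n))))"
        using seq_compact_imp_totally_bounded[of "sphere (0::complex) 1"]
          compact_sphere[of "0::complex" 1]
        unfolding compact_eq_seq_compact_metric by simp
      then show thesis using that by blast
    qed
    have "(1::complex) \<in> sphere 0 1" by simp
    then have "F \<noteq> {}" using F(3) by blast
    moreover have "\<forall>c\<in>sphere 0 1. \<exists>d\<in>F. norm (c - d) < inverse (real (Suc n))"
      using F(3) by (fastforce simp: dist_norm norm_minus_commute)
    ultimately show ?thesis using F by blast
  qed
  then have "\<exists>F. \<forall>n. finite (F n) \<and> F n \<noteq> {} \<and> F n \<subseteq> sphere (0::complex) 1 \<and>
          (\<forall>c\<in>sphere 0 1. \<exists>d\<in>F n. norm (c - d) < inverse (real (Suc n)))"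
    by (intro choice allI)
  then obtain F where F: "\<And>n. finite (F n)" "\<And>n. F n \<noteq> {}" "\<And>n. F n \<subseteq> sphere (0::complex) 1"
    "\<And>n c. c \<in> sphere 0 1 \<Longrightarrow> \<exists>d\<in>F n. norm (c - d) < inverse (real (Suc n))"
    by blast
  define S where "S n = Sup_fin (u ` F n)" for n
  have u_le: "u c \<le> S n + inverse (real (Suc n)) *\<^sub>R e" if c: "c \<in> sphere 0 1" for c n
  proof -
    obtain d where d: "d \<in> F n" "norm (c - d) < inverse (real (Suc n))" using F(4)[OF c] by blast
    have "u c \<le> u d + norm (c - d) *\<^sub>R e" by (rule u_diff)
    also have "\<dots> \<le> S n + inverse (real (Suc n)) *\<^sub>R e"
      unfolding S_def using d F(1) e0
      by (intro add_mono Sup_fin.coboundedI scaleR_right_mono) auto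
    finally show ?thesis .
  qed
  have S_le: "S n \<le> w" if "\<And>c. c \<in> sphere 0 1 \<Longrightarrow> u c \<le> w" for n w
    unfolding S_def using F(1)[of n] F(2)[of n] F(3)[of n] that
    by (intro Sup_fin.boundedI) auto
  have S_S: "S m - S n \<le> inverse (real (Suc n)) *\<^sub>R e" for m n
    using S_le[OF u_le, of m n] by (simp add: algebra_simps)
  have S_norm: "norm (S m - S n) \<le> (inverse (real (Suc N)) ) * norm e" if "m \<ge> N" "n \<ge> N" for m n N
  proof -
    have *: "inverse (real (Suc k)) *\<^sub>R e \<le> inverse (real (Suc N)) *\<^sub>R e" if "k \<ge> N" for k
      using that e0 by (intro scaleR_right_mono) auto
    have "S m - S n \<le> inverse (real (Suc N)) *\<^sub>R e" "- (S m - S n) \<le> inverse (real (Suc N)) *\<^sub>R e"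
      using order_trans[OF S_S *] that by (simp, metis minus_diff_eq)
    then have "\<bar>S m - S n\<bar> \<le> inverse (real (Suc N)) *\<^sub>R e"
      by (rule abs_leI)
    also have "\<dots> \<le> \<bar>inverse (real (Suc N)) *\<^sub>R e\<bar>" by (rule abs_ge_self)
    finally have "norm (S m - S n) \<le> norm (inverse (real (Suc N)) *\<^sub>R e)" by (rule norm_mono_abs)
    then show ?thesis by simp
  qed
  have "Cauchy S"
  proof (rule metric_CauchyI)
    fix r :: real assume r: "r > 0"
    have "(\<lambda>N. inverse (real (Suc N)) * norm e) \<longlonglongrightarrow> 0 * norm e"
      by (intro tendsto_mult tendsto_const LIMSEQ_inverse_real_of_nat)
    then have "eventually (\<lambda>N. inverse (real (Suc N)) * norm e < r) sequentially"
      using r by (intro order_tendstoD) auto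
    then obtain N where "inverse (real (Suc N)) * norm e < r" by (auto dest: eventually_happens)
    then show "\<exists>M. \<forall>m\<ge>M. \<forall>n\<ge>M. dist (S m) (S n) < r"
      using S_norm[of N] by (metis dist_norm le_less_trans)
  qed
  then obtain m where m: "S \<longlonglongrightarrow> m" by (metis Cauchy_convergent_iff convergent_def)
  have lim: "(\<lambda>n. S n + inverse (real (Suc n)) *\<^sub>R e) \<longlonglongrightarrow> m + 0 *\<^sub>R e"
    by (intro tendsto_intros m LIMSEQ_inverse_real_of_nat)
  have ub: "u c \<le> m" if "c \<in> sphere 0 1" for c
    using le_limit[OF tendsto_const lim u_le[OF that]] by simp
  have least: "m \<le> w" if "\<And>c. c \<in> sphere 0 1 \<Longrightarrow> u c \<le> w" for w
    by (rule le_limit[OF m tendsto_const S_le[OF that]])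
  show ?thesis
  proof (intro exI[of _ m] conjI allI impI)
    fix t show "cos t *\<^sub>R x - sin t *\<^sub>R y \<le> m"
      using ub[of "cis t"] by (simp add: u_def)
  next
    fix w assume w: "\<forall>t. cos t *\<^sub>R x - sin t *\<^sub>R y \<le> w"
    show "m \<le> w"
    proof (rule least)
      fix c :: complex assume "c \<in> sphere 0 1"
      then have "norm c = 1" "c \<noteq> 0" by auto
      then have "c = cis (Arg c)" using cis_Arg[of c] by (simp add: sgn_eq)
      then show "u c \<le> w" using w by (metis u_def cis.simps)
    qed
  qed
qed

lemma modulus_ge: "cos t *\<^sub>R cre z - sin t *\<^sub>R cim z \<le> modulus z"
  and modulus_least: "(\<And>t. cos t *\<^sub>R cre z - sin t *\<^sub>R cim z \<le> w) \<Longrightarrow> modulus z \<le> w"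
proof -
  obtain m where m: "\<forall>t. cos t *\<^sub>R cre z - sin t *\<^sub>R cim z \<le> m"
    "\<forall>w. (\<forall>t. cos t *\<^sub>R cre z - sin t *\<^sub>R cim z \<le> w) \<longrightarrow> m \<le> w"
    using modulus_exists by blast
  have "modulus z = m"
    unfolding modulus_def by (rule Least_equality) (use m in auto)
  then show "cos t *\<^sub>R cre z - sin t *\<^sub>R cim z \<le> modulus z"
    "(\<And>t. cos t *\<^sub>R cre z - sin t *\<^sub>R cim z \<le> w) \<Longrightarrow> modulus z \<le> w"
    using m by auto
qed

lemma abs_cre_le: "\<bar>cre z\<bar> \<le> modulus z"
  using modulus_ge[of 0 z] modulus_ge[of pi z] by (intro abs_leI) auto

lemma abs_cim_le: "\<bar>cim z\<bar> \<le> modulus z"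
  using modulus_ge[of "pi/2" z] modulus_ge[of "- (pi/2)" z] by (intro abs_leI) auto

lemma modulus_nonneg [simp]: "0 \<le> modulus z"
  using abs_cre_le[of z] by (meson abs_ge_zero order_trans)

lemma modulus_le_add: "modulus z \<le> \<bar>cre z\<bar> + \<bar>cim z\<bar>"
proof (rule modulus_least)
  fix t
  have "cos t *\<^sub>R cre z + (- sin t) *\<^sub>R cim z \<le> \<bar>cos t\<bar> *\<^sub>R \<bar>cre z\<bar> + \<bar>- sin t\<bar> *\<^sub>R \<bar>cim z\<bar>"
    by (intro add_mono scaleR_le_abs)
  also have "\<dots> \<le> 1 *\<^sub>R \<bar>cre z\<bar> + 1 *\<^sub>R \<bar>cim z\<bar>"
    by (intro add_mono scaleR_right_mono) auto
  finally show "cos t *\<^sub>R cre z - sin t *\<^sub>R cim z \<le> \<bar>cre z\<bar> + \<bar>cim z\<bar>" by simp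
qed

definition scaleC :: "complex \<Rightarrow> 'a::real_vector complexification \<Rightarrow> 'a complexification"
    (infixr "*\<^sub>C" 75) where
  "c *\<^sub>C z = Cplx (Re c *\<^sub>R cre z - Im c *\<^sub>R cim z) (Re c *\<^sub>R cim z + Im c *\<^sub>R cre z)"

instantiation complexification :: (real_vector) real_vector
begin

definition zero_complexification :: "'a complexification" where "0 = Cplx 0 0"

definition plus_complexification ::
    "'a complexification \<Rightarrow> 'a complexification \<Rightarrow> 'a complexification" where
  "z + w = Cplx (cre z + cre w) (cim z + cim w)"

definition minus_complexification ::
    "'a complexification \<Rightarrow> 'a complexification \<Rightarrow> 'a complexification" where
  "z - w = Cplx (cre z - cre w) (cim z - cim w)"

definition uminus_complexification :: "'a complexification \<Rightarrow> 'a complexification" where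
  "- z = Cplx (- cre z) (- cim z)"

definition scaleR_complexification :: "real \<Rightarrow> 'a complexification \<Rightarrow> 'a complexification" where
  "r *\<^sub>R z = Cplx (r *\<^sub>R cre z) (r *\<^sub>R cim z)"

lemmas cplx_defs = zero_complexification_def plus_complexification_def
  minus_complexification_def uminus_complexification_def scaleR_complexification_def

lemma cplx_sel [simp]:
  "cre (0 :: 'a complexification) = 0" "cim (0 :: 'a complexification) = 0"
  "cre (z + w) = cre z + cre w" "cim (z + w) = cim z + cim w"
  "cre (z - w) = cre z - cre w" "cim (z - w) = cim z - cim w"
  "cre (- z) = - cre z" "cim (- z) = - cim z"
  "cre (r *\<^sub>R z) = r *\<^sub>R cre z" "cim (r *\<^sub>R z) = r *\<^sub>R cim z"
  for z w :: "'a complexification"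
  by (simp_all add: cplx_defs)

instance
  by standard (simp_all add: complexification_eq_iff algebra_simps)

end

lemma modulus_triangle: "modulus (z + w) \<le> modulus z + modulus w" for z w :: "'a::banach_lattice complexification"
proof (rule modulus_least)
  fix t
  have "cos t *\<^sub>R cre (z + w) - sin t *\<^sub>R cim (z + w) =
    (cos t *\<^sub>R cre z - sin t *\<^sub>R cim z) + (cos t *\<^sub>R cre w - sin t *\<^sub>R cim w)"
    by (simp add: algebra_simps)
  also have "\<dots> \<le> modulus z + modulus w"
    by (intro add_mono modulus_ge)
  finally show "cos t *\<^sub>R cre (z + w) - sin t *\<^sub>R cim (z + w) \<le> modulus z + modulus w" .
qed

lemma modulus_scaleR_le: "modulus (r *\<^sub>R z) \<le> \<bar>r\<bar> *\<^sub>R modulus z" for z :: "'a::banach_lattice complexification"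
proof (rule modulus_least)
  fix t
  define t' where "t' = (if 0 \<le> r then t else t + pi)"
  have "cos t *\<^sub>R cre (r *\<^sub>R z) - sin t *\<^sub>R cim (r *\<^sub>R z) =
    \<bar>r\<bar> *\<^sub>R (cos t' *\<^sub>R cre z - sin t' *\<^sub>R cim z)"
    by (simp add: t'_def algebra_simps)
  also have "\<dots> \<le> \<bar>r\<bar> *\<^sub>R modulus z"
    by (intro scaleR_left_mono modulus_ge) simp
  finally show "cos t *\<^sub>R cre (r *\<^sub>R z) - sin t *\<^sub>R cim (r *\<^sub>R z) \<le> \<bar>r\<bar> *\<^sub>R modulus z" .
qed

lemma modulus_eq_0_iff [simp]: "modulus z = 0 \<longleftrightarrow> z = 0" for z :: "'a::banach_lattice complexification"
proof
  assume "modulus z = 0"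
  then have "\<bar>cre z\<bar> = 0" "\<bar>cim z\<bar> = 0"
    using abs_cre_le[of z] abs_cim_le[of z] by (simp_all add: abs_le_iff order_antisym)
  then show "z = 0" by (simp add: complexification_eq_iff)
next
  assume "z = 0"
  then have "modulus z \<le> 0" using modulus_le_add[of z] by simp
  then show "modulus z = 0" by (simp add: order_antisym)
qed

instantiation complexification :: (banach_lattice) real_normed_vector
begin

definition norm_complexification :: "'a complexification \<Rightarrow> real" where
  "norm_complexification z = norm (modulus z)"

definition sgn_complexification :: "'a complexification \<Rightarrow> 'a complexification" where
  "sgn_complexification z = inverse (norm z) *\<^sub>R z"

definition dist_complexification :: "'a complexification \<Rightarrow> 'a complexification \<Rightarrow> real" where
  "dist_complexification z w = norm (z - w)"

definition uniformity_complexification :: "('a complexification \<times> 'a complexification) filter" where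
  "uniformity_complexification = (INF e\<in>{0<..}. principal {(x, y). dist x y < e})"

definition open_complexification :: "'a complexification set \<Rightarrow> bool" where
  "open_complexification U = (\<forall>x\<in>U. eventually (\<lambda>(x', y). x' = x \<longrightarrow> y \<in> U) uniformity)"

lemma norm_scaleR_le: "norm (r *\<^sub>R z) \<le> \<bar>r\<bar> * norm z" for z :: "'a complexification"
  using norm_mono_nonneg[OF modulus_nonneg modulus_scaleR_le, of r z]
  by (simp add: norm_complexification_def)

lemma norm_cre_le: "norm (cre z) \<le> norm z" and norm_cim_le: "norm (cim z) \<le> norm z"
  for z :: "'a complexification"
  unfolding norm_complexification_def
  using abs_cre_le[of z] abs_cim_le[of z] by (auto intro!: norm_mono_abs)

lemma norm_le_add: "norm z \<le> norm (cre z) + norm (cim z)" for z :: "'a complexification"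
proof -
  have "norm z \<le> norm (\<bar>cre z\<bar> + \<bar>cim z\<bar>)"
    unfolding norm_complexification_def by (intro norm_mono_nonneg modulus_le_add modulus_nonneg)
  also have "\<dots> \<le> norm \<bar>cre z\<bar> + norm \<bar>cim z\<bar>" by (rule norm_triangle_ineq)
  also have "\<dots> \<le> norm (cre z) + norm (cim z)"
    by (intro add_mono norm_mono_abs) auto
  finally show ?thesis .
qed

instance
proof
  fix z w :: "'a complexification" and r :: real
  show "(norm z = 0) = (z = 0)" by (simp add: norm_complexification_def)
  have "norm (z + w) \<le> norm (modulus z + modulus w)"
    unfolding norm_complexification_def by (intro norm_mono_nonneg modulus_triangle modulus_nonneg)
  also have "\<dots> \<le> norm z + norm w"
    unfolding norm_complexification_def by (rule norm_triangle_ineq)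
  finally show "norm (z + w) \<le> norm z + norm w" .
  show "norm (r *\<^sub>R z) = \<bar>r\<bar> * norm z"
  proof (cases "r = 0")
    case True
    then have "r *\<^sub>R z = 0" by (simp add: complexification_eq_iff)
    then show ?thesis using True by (simp add: norm_complexification_def)
  next
    case False
    have "z = inverse r *\<^sub>R r *\<^sub>R z" using False by (simp add: complexification_eq_iff)
    then have "norm z \<le> \<bar>inverse r\<bar> * norm (r *\<^sub>R z)" by (metis norm_scaleR_le)
    then have "\<bar>r\<bar> * norm z \<le> norm (r *\<^sub>R z)" using False by (simp add: field_simps)
    then show ?thesis using norm_scaleR_le[of r z] by simp
  qed
qed (simp_all add: sgn_complexification_def dist_complexification_def
      uniformity_complexification_def open_complexification_def)

end

instance complexification :: (banach_lattice) banach
proof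
  fix X :: "nat \<Rightarrow> 'a complexification"
  assume X: "Cauchy X"
  have d: "dist z w = norm (z - w)" for z w :: "'a complexification"
    by (rule dist_norm)
  have dist_le: "dist (cre z) (cre w) \<le> dist z w" "dist (cim z) (cim w) \<le> dist z w"
    for z w :: "'a complexification"
    using norm_cre_le[of "z - w"] norm_cim_le[of "z - w"] by (simp_all add: dist_norm d)
  have Cauchy_part: "Cauchy (\<lambda>n. p (X n))"
    if p: "\<And>z w. dist (p z) (p w) \<le> dist z w" for p :: "'a complexification \<Rightarrow> 'a"
  proof (rule metric_CauchyI)
    fix e :: real assume "e > 0"
    then obtain M where "\<forall>m\<ge>M. \<forall>n\<ge>M. dist (X m) (X n) < e" using metric_CauchyD[OF X] by blast
    then show "\<exists>M. \<forall>m\<ge>M. \<forall>n\<ge>M. dist (p (X m)) (p (X n)) < e"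
      by (intro exI[of _ M]) (auto intro: le_less_trans[OF p])
  qed
  have "Cauchy (\<lambda>n. cre (X n))" "Cauchy (\<lambda>n. cim (X n))"
    by (rule Cauchy_part[OF dist_le(1)], rule Cauchy_part[OF dist_le(2)])
  then obtain a b where a: "(\<lambda>n. cre (X n)) \<longlonglongrightarrow> a" and b: "(\<lambda>n. cim (X n)) \<longlonglongrightarrow> b"
    by (meson Cauchy_convergent_iff convergent_def)
  have "(\<lambda>n. norm (cre (X n) - a) + norm (cim (X n) - b)) \<longlonglongrightarrow> 0 + 0"
    using a b by (intro tendsto_add tendsto_norm_zero LIM_zero)
  then have "(\<lambda>n. dist (X n) (Cplx a b)) \<longlonglongrightarrow> 0"
    by (intro Lim_null_comparison[of "\<lambda>n. dist (X n) (Cplx a b)"])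
      (use norm_le_add[of "X n - Cplx a b" for n] in \<open>auto simp: d\<close>)
  then show "convergent X" unfolding convergent_def by (metis tendsto_dist_iff)
qed

global_interpretation cplx: vector_space "scaleC :: complex \<Rightarrow> 'a::banach_lattice complexification \<Rightarrow> _"
  by standard (simp_all add: scaleC_def complexification_eq_iff algebra_simps)

lemma scaleC_of_real: "complex_of_real r *\<^sub>C z = r *\<^sub>R z" for z :: "'a::banach_lattice complexification"
  by (simp add: scaleC_def complexification_eq_iff)

definition real_part :: "'a::banach_lattice complexification set" where
  "real_part = {f. cim f = 0}"

definition pos_cone :: "'a::banach_lattice complexification set" where
  "pos_cone = {f \<in> real_part. 0 \<le> cre f}"

definition closed_ideal :: "'a::banach_lattice complexification set \<Rightarrow> bool" where
  "closed_ideal I \<longleftrightarrow> closed I \<and> cplx.subspace I \<and>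
     (\<forall>f g. g \<in> I \<longrightarrow> modulus f \<le> modulus g \<longrightarrow> f \<in> I)"

definition principal_ideal :: "'a::banach_lattice complexification \<Rightarrow> 'a complexification set" where
  "principal_ideal u = {f. \<exists>c>0. modulus f \<le> c *\<^sub>R cre u}"

definition quasi_interior :: "'a::banach_lattice complexification \<Rightarrow> bool" where
  "quasi_interior u \<longleftrightarrow> u \<in> pos_cone \<and> closure (principal_ideal u) = UNIV"

definition bounded_clinear ::
    "('a::banach_lattice complexification \<Rightarrow> 'a complexification) \<Rightarrow> bool" where
  "bounded_clinear S \<longleftrightarrow> bounded_linear S \<and> (\<forall>c f. S (c *\<^sub>C f) = c *\<^sub>C S f)"

definition dual_space :: "('a::banach_lattice complexification \<Rightarrow> complex) set" where
  "dual_space = {\<phi>. bounded_linear \<phi> \<and> (\<forall>c f. \<phi> (c *\<^sub>C f) = c * \<phi> f)}"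

definition strictly_positive :: "('a::banach_lattice complexification \<Rightarrow> complex) \<Rightarrow> bool" where
  "strictly_positive \<phi> \<longleftrightarrow> \<phi> \<in> dual_space \<and>
     (\<forall>f\<in>pos_cone. \<phi> f \<in> \<real> \<and> 0 \<le> Re (\<phi> f)) \<and> (\<forall>f\<in>pos_cone. \<phi> f = 0 \<longrightarrow> f = 0)"

definition rank_one :: "'a::banach_lattice complexification \<Rightarrow>
    ('a complexification \<Rightarrow> complex) \<Rightarrow> 'a complexification \<Rightarrow> 'a complexification"
    (infix "\<otimes>\<^sub>R" 70) where
  "u \<otimes>\<^sub>R \<phi> = (\<lambda>f. \<phi> f *\<^sub>C u)"

text \<open>Unbounded operators are identified with their graphs.\<close>

type_synonym 'a operator = "('a complexification \<times> 'a complexification) set"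

definition shifted :: "complex \<Rightarrow> 'a::banach_lattice operator \<Rightarrow> 'a operator" where
  "shifted l A = {(f, l *\<^sub>C f - g) | f g. (f, g) \<in> A}"

definition kernel :: "'a::banach_lattice operator \<Rightarrow> 'a complexification set" where
  "kernel B = {f. (f, 0) \<in> B}"

definition is_resolvent_at :: "'a::banach_lattice operator \<Rightarrow> complex \<Rightarrow>
    ('a complexification \<Rightarrow> 'a complexification) \<Rightarrow> bool" where
  "is_resolvent_at A l R \<longleftrightarrow> bounded_clinear R \<and> (shifted l A)\<inverse> = {(f, R f) | f. True}"

definition resolvent_set :: "'a::banach_lattice operator \<Rightarrow> complex set" where
  "resolvent_set A = {l. \<exists>R. is_resolvent_at A l R}"

definition spectrum :: "'a::banach_lattice operator \<Rightarrow> complex set" where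
  "spectrum A = - resolvent_set A"

definition resolvent ::
    "complex \<Rightarrow> 'a::banach_lattice operator \<Rightarrow> 'a complexification \<Rightarrow> 'a complexification" where
  "resolvent l A = (THE R. is_resolvent_at A l R)"

definition spectral_bound :: "'a::banach_lattice operator \<Rightarrow> ereal" where
  "spectral_bound A = (SUP l\<in>spectrum A. ereal (Re l))"

definition eigenvalue :: "'a::banach_lattice operator \<Rightarrow> complex \<Rightarrow> bool" where
  "eigenvalue A l \<longleftrightarrow> (\<exists>f\<in>kernel (shifted l A). f \<noteq> 0)"

definition algebraically_simple_eigenvalue :: "'a::banach_lattice operator \<Rightarrow> complex \<Rightarrow> bool" where
  "algebraically_simple_eigenvalue A l \<longleftrightarrow>
     eigenvalue A l \<and> cplx.dim (\<Union>n. kernel (shifted l A ^^ n)) = 1"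

definition dual_operator :: "'a::banach_lattice operator \<Rightarrow>
    (('a complexification \<Rightarrow> complex) \<times> ('a complexification \<Rightarrow> complex)) set" where
  "dual_operator A =
     {(\<phi>, \<psi>). \<phi> \<in> dual_space \<and> \<psi> \<in> dual_space \<and> (\<forall>(f, g)\<in>A. \<phi> g = \<psi> f)}"

definition dual_eigenspace ::
    "'a::banach_lattice operator \<Rightarrow> complex \<Rightarrow> ('a complexification \<Rightarrow> complex) set" where
  "dual_eigenspace A l = {\<phi>. (\<phi>, \<lambda>f. l * \<phi> f) \<in> dual_operator A}"

text \<open>\<open>R(l, A)\<close> has a Laurent expansion with lowest-order term \<open>(l - \<mu>)\<^sup>-\<^sup>m U\<^sub>0\<close>, \<open>U\<^sub>0 \<noteq> 0\<close>, that
  converges in operator norm on a punctured disc about \<open>\<mu>\<close>. (For operator-valued functions the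
  condition \<^const>\<open>is_pole\<close>, i.e. divergence of the norm, would not exclude essential
  singularities.)\<close>

definition resolvent_pole_of_order :: "'a::banach_lattice operator \<Rightarrow> complex \<Rightarrow> nat \<Rightarrow> bool" where
  "resolvent_pole_of_order A \<mu> m \<longleftrightarrow> m \<ge> 1 \<and>
     (\<exists>(U :: nat \<Rightarrow> 'a complexification \<Rightarrow> 'a complexification) r. r > 0 \<and>
        (\<forall>n. bounded_clinear (U n)) \<and> U 0 \<noteq> (\<lambda>f. 0) \<and>
        (\<forall>l \<in> ball \<mu> r - {\<mu>}. l \<in> resolvent_set A \<and>
           (\<lambda>N. onorm (\<lambda>f. resolvent l A f
              - (\<Sum>n<N. ((l - \<mu>) powi (int n - int m)) *\<^sub>C U n f))) \<longlonglongrightarrow> 0))"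

definition resolvent_pole :: "'a::banach_lattice operator \<Rightarrow> complex \<Rightarrow> bool" where
  "resolvent_pole A \<mu> \<longleftrightarrow> (\<exists>m. resolvent_pole_of_order A \<mu> m)"

text \<open>The vector-valued counterpart of \<^const>\<open>contour_integral\<close>.\<close>

definition vec_contour_integral :: "(real \<Rightarrow> complex) \<Rightarrow>
    (complex \<Rightarrow> 'a::banach_lattice complexification) \<Rightarrow> 'a complexification" where
  "vec_contour_integral \<gamma> h =
     integral {0..1} (\<lambda>t. vector_derivative \<gamma> (at t within {0..1}) *\<^sub>C h (\<gamma> t))"

text \<open>For an isolated point \<open>\<mu>\<close> of the spectrum the integral is the same for all sufficiently
  small radii \<open>r\<close>.\<close>

definition spectral_projection ::
    "'a::banach_lattice operator \<Rightarrow> complex \<Rightarrow> 'a complexification \<Rightarrow> 'a complexification" where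
  "spectral_projection A \<mu> = (THE P. \<forall>\<^sub>F r in at_right 0.
     P = (\<lambda>f. (1 / (2 * of_real pi * \<i>)) *\<^sub>C
                vec_contour_integral (circlepath \<mu> r) (\<lambda>l. resolvent l A f)))"

definition C0_semigroup ::
    "(real \<Rightarrow> 'a::banach_lattice complexification \<Rightarrow> 'a complexification) \<Rightarrow> bool" where
  "C0_semigroup T \<longleftrightarrow> (\<forall>t\<ge>0. bounded_clinear (T t)) \<and> T 0 = id \<and>
     (\<forall>s\<ge>0. \<forall>t\<ge>0. T (s + t) = T s \<circ> T t) \<and> (\<forall>f. ((\<lambda>t. T t f) \<longlongrightarrow> f) (at_right 0))"

definition generator ::
    "(real \<Rightarrow> 'a::banach_lattice complexification \<Rightarrow> 'a complexification) \<Rightarrow> 'a operator" where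
  "generator T = {(f, g). ((\<lambda>t. (T t f - f) /\<^sub>R t) \<longlongrightarrow> g) (at_right 0)}"

definition real_semigroup ::
    "(real \<Rightarrow> 'a::banach_lattice complexification \<Rightarrow> 'a complexification) \<Rightarrow> bool" where
  "real_semigroup T \<longleftrightarrow> (\<forall>t\<ge>0. T t ` real_part \<subseteq> real_part)"

definition individually_eventually_positive ::
    "(real \<Rightarrow> 'a::banach_lattice complexification \<Rightarrow> 'a complexification) \<Rightarrow> bool" where
  "individually_eventually_positive T \<longleftrightarrow>
     (\<forall>f\<in>pos_cone. \<exists>t\<^sub>0\<ge>0. \<forall>t\<ge>t\<^sub>0. T t f \<in> pos_cone)"

definition persistently_irreducible ::
    "(real \<Rightarrow> 'a::banach_lattice complexification \<Rightarrow> 'a complexification) \<Rightarrow> bool" where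
  "persistently_irreducible T \<longleftrightarrow>
     (\<forall>I. closed_ideal I \<and> (\<exists>t\<^sub>0\<ge>0. \<forall>t\<ge>t\<^sub>0. T t ` I \<subseteq> I) \<longrightarrow> I = {0} \<or> I = UNIV)"

definition cesaro_mean :: "(real \<Rightarrow> 'a::banach_lattice complexification \<Rightarrow> 'a complexification) \<Rightarrow>
    real \<Rightarrow> 'a complexification \<Rightarrow> 'a complexification" where
  "cesaro_mean T t f = (1 / t) *\<^sub>R integral {0..t} (\<lambda>s. T s f)"

definition mean_ergodic ::
    "(real \<Rightarrow> 'a::banach_lattice complexification \<Rightarrow> 'a complexification) \<Rightarrow> bool" where
  "mean_ergodic T \<longleftrightarrow> (\<forall>f. \<exists>g. ((\<lambda>t. cesaro_mean T t f) \<longlongrightarrow> g) at_top)"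

definition mean_ergodic_projection ::
    "(real \<Rightarrow> 'a::banach_lattice complexification \<Rightarrow> 'a complexification) \<Rightarrow>
     'a complexification \<Rightarrow> 'a complexification" where
  "mean_ergodic_projection T f = Lim at_top (\<lambda>t. cesaro_mean T t f)"

end

theory Submission
  imports Defs
begin

text \<open>Everything is restricted to the real part of the Banach lattice. Two Baire arguments make the
  individual waiting times in eventual positivity uniform: one shows that a positive eigenvector
  \<open>u\<close> is quasi-interior (apply it to the order interval from \<open>0\<close> to \<open>u\<close>), the other that a
  positive dual eigenvector \<open>\<phi> \<noteq> 0\<close> is strictly positive (apply it to the ideal
  \<open>{x. \<phi> |x| = 0}\<close>). Once both exist, \<open>T t |v| \<ge> e\<^sup>s\<^sup>t |v|\<close> for late \<open>t\<close>
  forces \<open>|v|\<close> to be an eigenvector together with \<open>v\<close>, so the eigenspace is totally ordered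
  and one-dimensional.

  The dual eigenvector is obtained in (a) by applying Hahn--Banach to the sublinear functional
  \<open>limsup \<parallel>((l - s) R(l) x)\<^sup>+\<parallel>\<close> for \<open>l\<close> decreasing to \<open>s\<close>, and in (b), (c) by composing a
  positive functional with the mean ergodic projection, respectively with the leading Laurent
  coefficient \<open>U\<^sub>0\<close>. In (c) a pole of order at least two would give \<open>U\<^sub>0 u = 0\<close>, contradicting
  strict positivity. That \<open>R(l)\<close> is asymptotically positive for all \<open>l > s\<close>, and not only beyond
  the growth bound, follows by descending with Neumann series, which preserve the cone of vectors
  with positive orbit.\<close>

section \<open>Banach lattices\<close>

text \<open>Persistent irreducibility speaks of ideals invariant from one common time on, while
  eventual positivity gives each vector a time of its own. Baire's theorem closes this gap without
  making positivity uniform: only the invariance of an ideal becomes uniform, because membership in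
  a subspace, unlike positivity, survives solving \<open>x0 + d *\<^sub>R (x - x0)\<close> for
  \<open>x\<close>. A second obstacle is that \<open>s\<close> may lie below the growth bound, where
  the resolvent need not be a Laplace integral. The substitute is the finite-time identity R(l) x =
  integral over [0, t] of exp(-l r) T(r) x plus exp(-l t) R(l) T(t) x, valid at every real resolvent
  point. Its integral stays bounded as l decreases to s, so it disappears after scaling by a
  positive power of l - s. Parts (b) and (c) share one statement about a positive operator U with U
  T(t) = T(t) U = exp(s t) U that acts on the eigenvectors as a scalar \<open>a\<close>; that
  \<open>a\<close> is nonzero belongs to its conclusion.\<close>

lemma norm_abs_lattice [simp]: "norm \<bar>x\<bar> = norm x" for x :: "'a::banach_lattice"
  by (intro antisym norm_mono_abs) simp_all

text \<open>Through this formula continuity of the positive part, and then of \<open>inf\<close> and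
  \<open>sup\<close>, comes down to continuity of the modulus.\<close>

lemma pprt_eq_abs: "pprt x = (1 / 2) *\<^sub>R (\<bar>x\<bar> + x)" for x :: "'a::banach_lattice"
proof -
  have "\<bar>x\<bar> + x = pprt x + pprt x"
    using prts[of x] abs_prts[of x] by (metis add.commute add_diff_cancel_left' add_diff_eq diff_add_cancel)
  then show ?thesis by (simp add: scaleR_2[symmetric])
qed

lemma nprt_eq_abs: "- nprt x = (1 / 2) *\<^sub>R (\<bar>x\<bar> - x)" for x :: "'a::banach_lattice"
  using pprt_eq_abs[of "- x"] by (simp add: pprt_neg)

lemma abs_scaleR_lattice: "\<bar>a *\<^sub>R x\<bar> = \<bar>a\<bar> *\<^sub>R \<bar>x\<bar>" for x :: "'a::banach_lattice"
proof (rule antisym)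
  have le: "\<bar>b *\<^sub>R y\<bar> \<le> \<bar>b\<bar> *\<^sub>R \<bar>y\<bar>" for b and y :: 'a
    using scaleR_le_abs[of b y] scaleR_le_abs[of "- b" y] by (intro abs_leI) auto
  show "\<bar>a *\<^sub>R x\<bar> \<le> \<bar>a\<bar> *\<^sub>R \<bar>x\<bar>" by (rule le)
  show "\<bar>a\<bar> *\<^sub>R \<bar>x\<bar> \<le> \<bar>a *\<^sub>R x\<bar>"
  proof (cases "a = 0")
    case False
    have "\<bar>a\<bar> *\<^sub>R \<bar>inverse a *\<^sub>R a *\<^sub>R x\<bar> \<le> \<bar>a\<bar> *\<^sub>R (\<bar>inverse a\<bar> *\<^sub>R \<bar>a *\<^sub>R x\<bar>)"
      by (intro scaleR_left_mono le) simp
    then show ?thesis using False by simp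
  qed simp
qed

lemma norm_abs_diff_le: "norm (\<bar>x\<bar> - \<bar>y\<bar>) \<le> norm (x - y)" for x y :: "'a::banach_lattice"
proof (intro norm_mono_abs abs_leI)
  show "\<bar>x\<bar> - \<bar>y\<bar> \<le> \<bar>x - y\<bar>" by (rule abs_triangle_ineq2)
  show "- (\<bar>x\<bar> - \<bar>y\<bar>) \<le> \<bar>x - y\<bar>"
    using abs_triangle_ineq2[of y x] by (simp add: abs_minus_commute)
qed

lemma tendsto_abs_lattice:
  fixes f :: "'b \<Rightarrow> 'a::banach_lattice"
  assumes "(f \<longlongrightarrow> x) F"
  shows "((\<lambda>t. \<bar>f t\<bar>) \<longlongrightarrow> \<bar>x\<bar>) F"
proof (rule LIM_zero_cancel, rule Lim_null_comparison)
  show "\<forall>\<^sub>F t in F. norm (\<bar>f t\<bar> - \<bar>x\<bar>) \<le> norm (f t - x)"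
    by (simp add: norm_abs_diff_le)
  show "((\<lambda>t. norm (f t - x)) \<longlongrightarrow> 0) F"
    using assms by (simp add: LIM_zero tendsto_norm_zero)
qed

lemma tendsto_pprt:
  fixes f :: "'b \<Rightarrow> 'a::banach_lattice"
  assumes "(f \<longlongrightarrow> x) F"
  shows "((\<lambda>t. pprt (f t)) \<longlongrightarrow> pprt x) F"
  unfolding pprt_eq_abs by (intro tendsto_intros tendsto_abs_lattice assms)

lemma inf_eq_pprt: "inf x y = x - pprt (x - y)" for x y :: "'a::lattice_ab_group_add"
proof -
  have "pprt (x - y) + y = sup x y" by (simp add: pprt_def add_sup_distrib_right)
  then have "inf x y + pprt (x - y) + y = x + y" using add_eq_inf_sup[of x y] by (simp add: ac_simps)
  then show ?thesis by (simp add: eq_diff_eq)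
qed

lemma tendsto_inf_lattice:
  fixes f g :: "'b \<Rightarrow> 'a::banach_lattice"
  assumes "(f \<longlongrightarrow> x) F" "(g \<longlongrightarrow> y) F"
  shows "((\<lambda>t. inf (f t) (g t)) \<longlongrightarrow> inf x y) F"
  unfolding inf_eq_pprt by (intro tendsto_intros tendsto_pprt assms)

lemma tendsto_sup_lattice:
  fixes f g :: "'b \<Rightarrow> 'a::banach_lattice"
  assumes "(f \<longlongrightarrow> x) F" "(g \<longlongrightarrow> y) F"
  shows "((\<lambda>t. sup (f t) (g t)) \<longlongrightarrow> sup x y) F"
  unfolding sup_eq_neg_inf by (intro tendsto_minus tendsto_inf_lattice assms)

lemma closed_nonneg: "closed {x::'a::banach_lattice. 0 \<le> x}"
  unfolding closed_sequential_limits using nonneg_limit by auto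

lemma tendsto_nonneg:
  fixes f :: "'b \<Rightarrow> 'a::banach_lattice"
  assumes "(f \<longlongrightarrow> x) F" "\<forall>\<^sub>F t in F. 0 \<le> f t" "F \<noteq> bot"
  shows "0 \<le> x"
  using Lim_in_closed_set[OF closed_nonneg, of f F x] assms by simp

lemma norm_pprt_le: "norm (pprt x) \<le> norm x" for x :: "'a::banach_lattice"
proof (rule norm_mono_abs)
  have "pprt x \<le> \<bar>x\<bar>" by (simp add: abs_prts)
  then show "\<bar>pprt x\<bar> \<le> \<bar>x\<bar>" by simp
qed

lemma pprt_add_le: "pprt (x + y) \<le> pprt x + pprt y" for x y :: "'a::lattice_ab_group_add"
  unfolding pprt_def by (intro le_supI add_mono) (auto intro: add_nonneg_nonneg)

lemma pprt_scaleR: "0 \<le> a \<Longrightarrow> pprt (a *\<^sub>R x) = a *\<^sub>R pprt x" for x :: "'a::banach_lattice"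
  by (simp add: pprt_eq_abs abs_scaleR_lattice algebra_simps)

lemma inf_pprt_nprt: "inf (pprt x) (- nprt x) = 0" for x :: "'a::lattice_ab_group_add"
proof -
  have "pprt x - (- nprt x) = x" using prts[of x] by simp
  then show ?thesis by (simp add: inf_eq_pprt)
qed

lemma inf_scaleR_eq_0:
  fixes x y :: "'a::banach_lattice"
  assumes "inf x y = 0" "c > 0"
  shows "inf (c *\<^sub>R x) y = 0"
proof -
  have nn: "0 \<le> x" "0 \<le> y" using assms(1) by (metis inf.cobounded1, metis inf.cobounded2)
  \<comment> \<open>The factor \<open>d\<close> dominates both coefficients, \<open>c\<close> of
    \<open>x\<close> and 1 of \<open>y\<close>; dividing \<open>inf (c *\<^sub>R x) y\<close> by it
    gives a lower bound of \<open>x\<close> and \<open>y\<close>.\<close>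
  define d where "d = max 1 c"
  have d: "d \<ge> 1" "d \<ge> c" by (auto simp: d_def)
  have "inf (c *\<^sub>R x) y \<le> d *\<^sub>R inf x y"
  proof -
    define z where "z = inf (c *\<^sub>R x) y"
    have "z \<le> d *\<^sub>R x" "z \<le> d *\<^sub>R y"
      using scaleR_right_mono[OF d(2) nn(1)] scaleR_right_mono[OF d(1) nn(2)]
      by (auto simp: z_def intro: le_infI1 le_infI2)
    then have "inverse d *\<^sub>R z \<le> inverse d *\<^sub>R d *\<^sub>R x" "inverse d *\<^sub>R z \<le> inverse d *\<^sub>R d *\<^sub>R y"
      using d by (auto intro!: scaleR_left_mono simp del: scaleR_scaleR)
    then have "inverse d *\<^sub>R z \<le> inf x y" using d by simp
    then have "d *\<^sub>R inverse d *\<^sub>R z \<le> d *\<^sub>R inf x y"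
      using d by (intro scaleR_left_mono) auto
    then show ?thesis using d by (simp add: z_def)
  qed
  moreover have "0 \<le> inf (c *\<^sub>R x) y" using nn assms(2) by (simp add: scaleR_nonneg_nonneg)
  ultimately show ?thesis using assms(1) by (simp add: antisym)
qed

section \<open>The Hahn--Banach theorem\<close>

definition sublinear :: "('a::real_vector \<Rightarrow> real) \<Rightarrow> bool" where
  "sublinear p \<longleftrightarrow> (\<forall>x y. p (x + y) \<le> p x + p y) \<and> (\<forall>a\<ge>0. \<forall>x. p (a *\<^sub>R x) = a * p x)"

lemma sublinear_add: "sublinear p \<Longrightarrow> p (x + y) \<le> p x + p y"
  and sublinear_scaleR: "sublinear p \<Longrightarrow> 0 \<le> a \<Longrightarrow> p (a *\<^sub>R x) = a * p x"
  by (simp_all add: sublinear_def)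

lemma sublinear_0: "sublinear p \<Longrightarrow> p 0 = 0"
  using sublinear_scaleR[of p 0 0] by simp

lemma sublinear_minus: "sublinear p \<Longrightarrow> - p (- x) \<le> p x"
  using sublinear_add[of p x "- x"] sublinear_0[of p] by simp

text \<open>The infimum is finite because
  \<open>p (t *\<^sub>R y) \<le> p (x + t *\<^sub>R y) + p (- x)\<close>. The new functional is
  pushed down so far that its value at \<open>- y\<close> is at most \<open>- p y\<close>. This
  serves twice: it shows that minimal sublinear functionals are odd, and it fixes the value of a
  dominated functional at a chosen vector.\<close>

lemma sublinear_infimum_along:
  fixes p :: "'a::real_vector \<Rightarrow> real" and y :: 'a
  assumes p: "sublinear p"
  defines "q \<equiv> \<lambda>x. INF t\<in>{0..}. p (x + t *\<^sub>R y) - t * p y"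
  shows "sublinear q" "q x \<le> p x" "q (- y) \<le> - p y"
proof -
  have lower: "- p (- x) \<le> p (x + t *\<^sub>R y) - t * p y" if "t \<ge> 0" for x t
  proof -
    have "p (t *\<^sub>R y) \<le> p (x + t *\<^sub>R y) + p (- x)"
      using sublinear_add[OF p, of "x + t *\<^sub>R y" "- x"] by simp
    then show ?thesis using that sublinear_scaleR[OF p] by simp
  qed
  have bdd: "bdd_below ((\<lambda>t. p (x + t *\<^sub>R y) - t * p y) ` {0..})" for x
    using lower[of _ x] by (intro bdd_belowI2[where m = "- p (- x)"]) auto
  have le: "q x \<le> p (x + t *\<^sub>R y) - t * p y" if "t \<ge> 0" for x t
    unfolding q_def using that by (intro cINF_lower bdd) auto
  have ge: "c \<le> q x" if "\<And>t. t \<ge> 0 \<Longrightarrow> c \<le> p (x + t *\<^sub>R y) - t * p y" for c x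
    unfolding q_def using that by (intro cINF_greatest) auto
  show "q x \<le> p x" using le[of 0 x] by simp
  show "q (- y) \<le> - p y" using le[of 1 "- y"] sublinear_0[OF p] by simp
  show "sublinear q" unfolding sublinear_def
  proof (intro conjI allI impI)
    fix x z
    \<comment> \<open>The parameters \<open>t\<close> and \<open>r\<close> of the two summands merge
      into \<open>t + r\<close>; taking the infimum over \<open>r\<close>, then over
      \<open>t\<close>, gives subadditivity.\<close>
    have "q (x + z) - (p (x + t *\<^sub>R y) - t * p y) \<le> q z" if "t \<ge> 0" for t
    proof (rule ge)
      fix r :: real assume "r \<ge> 0"
      have "q (x + z) \<le> p (x + z + (t + r) *\<^sub>R y) - (t + r) * p y"
        using that \<open>r \<ge> 0\<close> by (intro le) simp
      also have "x + z + (t + r) *\<^sub>R y = (x + t *\<^sub>R y) + (z + r *\<^sub>R y)" by (simp add: algebra_simps)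
      also have "p \<dots> \<le> p (x + t *\<^sub>R y) + p (z + r *\<^sub>R y)" by (rule sublinear_add[OF p])
      finally show "q (x + z) - (p (x + t *\<^sub>R y) - t * p y) \<le> p (z + r *\<^sub>R y) - r * p y"
        by (simp add: algebra_simps)
    qed
    then have "q (x + z) - q z \<le> q x" by (intro ge) (simp add: algebra_simps)
    then show "q (x + z) \<le> q x + q z" by simp
  next
    fix a :: real and x assume a: "a \<ge> 0"
    have *: "b * q x \<le> q (b *\<^sub>R x)" if "b > 0" for b x
    proof (rule ge)
      fix t :: real assume "t \<ge> 0"
      have "b * q x \<le> b * (p (x + (t / b) *\<^sub>R y) - (t / b) * p y)"
        using that \<open>t \<ge> 0\<close> by (intro mult_left_mono le) auto
      also have "\<dots> = p (b *\<^sub>R x + t *\<^sub>R y) - t * p y"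
        using that sublinear_scaleR[OF p, of b "x + (t / b) *\<^sub>R y"] by (simp add: algebra_simps)
      finally show "b * q x \<le> p (b *\<^sub>R x + t *\<^sub>R y) - t * p y" .
    qed
    show "q (a *\<^sub>R x) = a * q x"
    proof (cases "a = 0")
      case True
      have "q 0 = 0"
      proof (rule antisym)
        show "q 0 \<le> 0" using le[of 0 0] sublinear_0[OF p] by simp
        show "0 \<le> q 0" using sublinear_scaleR[OF p] by (intro ge) simp
      qed
      then show ?thesis using True by simp
    next
      case False
      then have "a > 0" using a by simp
      have "inverse a * q (a *\<^sub>R x) \<le> q (inverse a *\<^sub>R a *\<^sub>R x)"
        using \<open>a > 0\<close> by (intro *) simp
      then have "q (a *\<^sub>R x) \<le> a * q x" using \<open>a > 0\<close> by (simp add: field_simps)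
      then show ?thesis using *[OF \<open>a > 0\<close>, of x] by simp
    qed
  qed
qed

text \<open>Pushing \<open>q\<close> down along \<open>y\<close> cannot change it, so
  \<open>q (- y) \<le> - q y\<close> and \<open>q\<close> is odd. Subadditivity at the negatives
  then reverses the inequality.\<close>

lemma minimal_sublinear_linear:
  fixes q :: "'a::real_vector \<Rightarrow> real"
  assumes q: "sublinear q" and min: "\<And>r. sublinear r \<Longrightarrow> (\<And>x. r x \<le> q x) \<Longrightarrow> r = q"
  shows "linear q"
proof -
  have neg: "q (- y) = - q y" for y
  proof -
    have "(\<lambda>x. INF t\<in>{0..}. q (x + t *\<^sub>R y) - t * q y) = q"
      by (rule min) (rule sublinear_infimum_along[OF q])+
    from sublinear_infimum_along(3)[OF q, of y, unfolded fun_cong[OF this]]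
    have "q (- y) \<le> - q y" .
    then show ?thesis using sublinear_minus[OF q, of "- y"] by simp
  qed
  show ?thesis
  proof (rule linearI)
    fix x y
    have "q (- x + - y) \<le> q (- x) + q (- y)" by (rule sublinear_add[OF q])
    then have "q (- (x + y)) \<le> q (- x) + q (- y)" by simp
    then have "q x + q y \<le> q (x + y)" by (simp only: neg)
    then show "q (x + y) = q x + q y" using sublinear_add[OF q, of x y] by simp
  next
    fix a x
    show "q (a *\<^sub>R x) = a *\<^sub>R q x"
    proof (cases "a \<ge> 0")
      case True
      then show ?thesis using sublinear_scaleR[OF q] by simp
    next
      case False
      have "q ((- a) *\<^sub>R x) = (- a) * q x"
        using False by (intro sublinear_scaleR[OF q]) simp
      then show ?thesis using neg[of "a *\<^sub>R x"] by simp
    qed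
  qed
qed

text \<open>Zorn's lemma for the reversed pointwise order. The infimum of a chain is finite since
  all members lie above \<open>- p (- x)\<close>, and it is subadditive since of two members of a
  chain the smaller one can be used at both points.\<close>

lemma minimal_sublinear_exists:
  fixes p :: "'a::real_vector \<Rightarrow> real"
  assumes p: "sublinear p"
  obtains q where "sublinear q" "\<And>x. q x \<le> p x"
    "\<And>r. sublinear r \<Longrightarrow> (\<And>x. r x \<le> q x) \<Longrightarrow> r = q"
proof -
  define A where "A = {q. sublinear q \<and> (\<forall>x. q x \<le> p x)}"
  define P where "P q r \<longleftrightarrow> (\<forall>x. r x \<le> q x)" for q r :: "'a \<Rightarrow> real"
  have "\<exists>m\<in>A. \<forall>a\<in>A. P m a \<longrightarrow> a = m"
  proof (rule predicate_Zorn)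
    show "partial_order_on A (relation_of P A)"
      by (rule partial_order_on_relation_ofI) (auto simp: P_def intro: order_trans intro!: ext antisym)
  next
    fix C assume C: "C \<in> Chains (relation_of P A)"
    then have CA: "C \<subseteq> A" and ch: "\<And>q r. q \<in> C \<Longrightarrow> r \<in> C \<Longrightarrow> P q r \<or> P r q"
      by (auto simp: Chains_def relation_of_def)
    show "\<exists>u\<in>A. \<forall>a\<in>C. P a u"
    proof (cases "C = {}")
      case True
      then show ?thesis using p by (auto simp: A_def)
    next
      case False
      define u where "u x = (INF q\<in>C. q x)" for x
      have sub: "sublinear q" and qp: "q x \<le> p x" if "q \<in> C" for q x using that CA by (auto simp: A_def)
      have bdd: "bdd_below ((\<lambda>q. q x) ` C)" for x
      proof (rule bdd_belowI2)
        fix q assume "q \<in> C"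
        then show "- p (- x) \<le> q x"
          using sublinear_minus[OF sub, of q x] qp[of q "- x"] by simp
      qed
      have le: "u x \<le> q x" if "q \<in> C" for q x
        unfolding u_def using that by (intro cINF_lower bdd)
      have ge: "c \<le> u x" if "\<And>q. q \<in> C \<Longrightarrow> c \<le> q x" for c x
        unfolding u_def using that False by (intro cINF_greatest) auto
      have "sublinear u" unfolding sublinear_def
      proof (intro conjI allI impI)
        fix x y
        have *: "u (x + y) \<le> q x + r y" if qr: "q \<in> C" "r \<in> C" for q r
        proof -
          obtain s where s: "s \<in> C" "s x \<le> q x" "s y \<le> r y"
            using ch[OF qr] qr unfolding P_def by (metis order_refl)
          have "u (x + y) \<le> s (x + y)" by (rule le[OF s(1)])
          also have "\<dots> \<le> s x + s y" by (rule sublinear_add[OF sub[OF s(1)]])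
          finally show ?thesis using s by simp
        qed
        have "u (x + y) - q x \<le> u y" if "q \<in> C" for q
          by (rule ge) (use *[OF that] in \<open>simp add: algebra_simps\<close>)
        then have "u (x + y) - u y \<le> u x" by (intro ge) (simp add: algebra_simps)
        then show "u (x + y) \<le> u x + u y" by simp
      next
        fix a :: real and x assume a: "a \<ge> 0"
        show "u (a *\<^sub>R x) = a * u x"
        proof (cases "a = 0")
          case True
          have "u 0 = 0"
          proof (rule antisym)
            obtain q where "q \<in> C" using \<open>C \<noteq> {}\<close> by blast
            then show "u 0 \<le> 0" using le[of q 0] sublinear_0[OF sub[of q]] by simp
            show "0 \<le> u 0" by (rule ge) (metis sub sublinear_0 order_refl)
          qed
          then show ?thesis using True by simp
        next
          case False
          then have a: "a > 0" using a by simp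
          show ?thesis
          proof (rule antisym)
            have "u (a *\<^sub>R x) / a \<le> u x"
            proof (rule ge)
              fix q assume "q \<in> C"
              then have "u (a *\<^sub>R x) \<le> a * q x"
                using le[of q "a *\<^sub>R x"] sublinear_scaleR[OF sub, of q a x] a by simp
              then show "u (a *\<^sub>R x) / a \<le> q x" using a by (simp add: field_simps)
            qed
            then show "u (a *\<^sub>R x) \<le> a * u x" using a by (simp add: field_simps)
            show "a * u x \<le> u (a *\<^sub>R x)"
              using a le by (intro ge) (simp add: sublinear_scaleR[OF sub])
          qed
        qed
      qed
      moreover have "u x \<le> p x" for x
        using False le qp by (meson all_not_in_conv order_trans)
      ultimately have "u \<in> A" by (simp add: A_def)
      then show ?thesis using le by (auto simp: P_def)
    qed
  qed
  then obtain q where q: "q \<in> A" "\<And>r. r \<in> A \<Longrightarrow> P q r \<Longrightarrow> r = q" by blast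
  show thesis
  proof (rule that)
    fix r assume "sublinear r" and r: "\<And>x. r x \<le> q x"
    then have "r \<in> A" using q(1) order_trans[OF r] by (auto simp: A_def)
    then show "r = q" using q(2) r by (auto simp: P_def)
  qed (use q(1) in \<open>auto simp: A_def\<close>)
qed

text \<open>A minimal functional below the pushed-down \<open>p'\<close> is linear and at most
  \<open>- p y\<close> at \<open>- y\<close>, which by linearity is the missing inequality
  \<open>q y \<ge> p y\<close>.\<close>

theorem Hahn_Banach_sublinear:
  fixes p :: "'a::real_vector \<Rightarrow> real"
  assumes p: "sublinear p"
  obtains \<phi> where "linear \<phi>" "\<And>x. \<phi> x \<le> p x" "\<phi> y = p y"
proof -
  define p' where "p' = (\<lambda>x. INF t\<in>{0..}. p (x + t *\<^sub>R y) - t * p y)"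
  have p': "sublinear p'" "\<And>x. p' x \<le> p x" "p' (- y) \<le> - p y"
    unfolding p'_def by (rule sublinear_infimum_along[OF p])+
  obtain q where q: "sublinear q" "\<And>x. q x \<le> p' x"
    "\<And>r. sublinear r \<Longrightarrow> (\<And>x. r x \<le> q x) \<Longrightarrow> r = q"
    using minimal_sublinear_exists[OF p'(1)] by blast
  have lin: "linear q" using q by (intro minimal_sublinear_linear) auto
  have le: "q x \<le> p x" for x using q(2) p'(2) by (rule order_trans)
  have "- q y = q (- y)" using linear_neg[OF lin] by simp
  also have "\<dots> \<le> - p y" using q(2) p'(3) by (rule order_trans)
  finally show thesis using that[OF lin le] le[of y] by simp
qed

text \<open>Domination by the norm of the positive part yields everything at once: positivity, since
  \<open>- x\<close> has positive part zero for \<open>0 \<le> x\<close>; boundedness, since the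
  positive part does not increase the norm; and strict negativity at \<open>y\<close>, by attaining
  the dominating value at \<open>- y\<close>.\<close>

lemma nonneg_functional_separation:
  fixes y :: "'a::banach_lattice"
  assumes "\<not> 0 \<le> y"
  obtains \<psi> :: "'a \<Rightarrow> real" where "bounded_linear \<psi>" "\<And>x. 0 \<le> x \<Longrightarrow> 0 \<le> \<psi> x" "\<psi> y < 0"
proof -
  have "sublinear (\<lambda>x::'a. norm (pprt x))"
    unfolding sublinear_def
  proof (intro conjI allI impI)
    fix x y :: 'a
    have "norm (pprt (x + y)) \<le> norm (pprt x + pprt y)"
      by (intro norm_mono_nonneg pprt_add_le) simp
    then show "norm (pprt (x + y)) \<le> norm (pprt x) + norm (pprt y)"
      by (meson norm_triangle_ineq order_trans)
  qed (simp add: pprt_scaleR)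
  then obtain \<psi> where \<psi>: "linear \<psi>" "\<And>x::'a. \<psi> x \<le> norm (pprt x)" "\<psi> (- y) = norm (pprt (- y))"
    using Hahn_Banach_sublinear by blast
  have b: "\<psi> x \<le> norm x" for x using \<psi>(2) norm_pprt_le by (rule order_trans)
  have "\<bar>\<psi> x\<bar> \<le> norm x" for x
    using b[of x] b[of "- x"] linear_neg[OF \<psi>(1)] by simp
  then have "bounded_linear \<psi>"
    using \<psi>(1) by (intro bounded_linear.intro bounded_linear_axioms.intro exI[of _ 1]) auto
  moreover have "0 \<le> \<psi> x" if "0 \<le> x" for x
    using \<psi>(2)[of "- x"] that linear_neg[OF \<psi>(1)] by simp
  moreover have "pprt (- y) \<noteq> 0" using assms le_zero_iff_zero_pprt[of "- y"] by simp
  then have "0 < norm (pprt (- y))" by simp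
  then have "\<psi> y < 0" using \<psi>(3) linear_neg[OF \<psi>(1), of y] by linarith
  ultimately show thesis using that by blast
qed

lemma positive_functional_exists:
  fixes u :: "'a::banach_lattice"
  assumes "0 \<le> u" "u \<noteq> 0"
  obtains \<psi> :: "'a \<Rightarrow> real" where "bounded_linear \<psi>" "\<And>x. 0 \<le> x \<Longrightarrow> 0 \<le> \<psi> x" "0 < \<psi> u"
proof -
  have "\<not> 0 \<le> - u" using assms by auto
  then obtain \<psi> :: "'a \<Rightarrow> real" where "bounded_linear \<psi>" "\<And>x. 0 \<le> x \<Longrightarrow> 0 \<le> \<psi> x" "\<psi> (- u) < 0"
    using nonneg_functional_separation by blast
  then show thesis
    using that linear_neg[OF bounded_linear.linear, of \<psi> u] by auto
qed

text \<open>A vector that is not positive is detected by a positive functional, and bounded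
  functionals commute with the integral, so the real-valued case decides.\<close>

lemma integral_nonneg_lattice:
  fixes f :: "real \<Rightarrow> 'a::banach_lattice"
  assumes "f integrable_on S" "\<And>t. t \<in> S \<Longrightarrow> 0 \<le> f t"
  shows "0 \<le> integral S f"
proof (rule ccontr)
  assume "\<not> 0 \<le> integral S f"
  then obtain \<psi> :: "'a \<Rightarrow> real"
    where \<psi>: "bounded_linear \<psi>" "\<And>x. 0 \<le> x \<Longrightarrow> 0 \<le> \<psi> x" "\<psi> (integral S f) < 0"
    using nonneg_functional_separation by blast
  have "\<psi> (integral S f) = integral S (\<psi> \<circ> f)"
    using integral_linear[OF assms(1) \<psi>(1)] by simp
  also have "\<dots> \<ge> 0"
    using assms \<psi>(2) by (intro integral_nonneg integrable_linear \<psi>(1)) auto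
  finally show False using \<psi>(3) by simp
qed

section \<open>Consequences of the Baire category theorem\<close>

text \<open>The interior is taken relative to \<open>S\<close>: the sets to which this is applied
  include an order interval and a closed ideal, which may have empty interior in the whole
  space.\<close>

lemma Baire_cover:
  fixes S :: "'a::banach set"
  assumes "closed S" "S \<noteq> {}" and F: "\<And>n. closed (F n)" "S \<subseteq> (\<Union>n::nat. F n)"
  obtains n x0 e where "x0 \<in> S" "e > 0" "ball x0 e \<inter> S \<subseteq> F n"
proof -
  have S: "completely_metrizable_space (top_of_set S)"
    using \<open>closed S\<close> completely_metrizable_space_euclidean
    by (intro completely_metrizable_space_closedin) simp_all
  have "\<exists>n. top_of_set S interior_of (S \<inter> F n) \<noteq> {}"
  proof (rule ccontr)
    assume no: "\<not> ?thesis"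
    have "top_of_set S interior_of \<Union>(range (\<lambda>n. S \<inter> F n)) = {}"
      using S F(1) no by (intro Baire_category_alt) (auto simp: closedin_closed_Int)
    moreover have "\<Union>(range (\<lambda>n. S \<inter> F n)) = S" using F(2) by auto
    ultimately show False using \<open>S \<noteq> {}\<close> interior_of_topspace[of "top_of_set S"] by simp
  qed
  then obtain n x0 where x0: "x0 \<in> top_of_set S interior_of (S \<inter> F n)" by auto
  have U: "top_of_set S interior_of (S \<inter> F n) \<subseteq> S \<inter> F n"
    by (rule interior_of_subset)
  obtain e where e: "e > 0" "ball x0 e \<inter> S \<subseteq> top_of_set S interior_of (S \<inter> F n)"
    using openin_interior_of[of "top_of_set S" "S \<inter> F n"] x0 unfolding openin_contains_ball by blast
  have "x0 \<in> S" "ball x0 e \<inter> S \<subseteq> F n" using x0 e(2) U by blast+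
  then show thesis using that e(1) by blast
qed

text \<open>Convexity turns the relative ball into a statement about segments: from
  \<open>x0\<close> towards any point of \<open>S\<close>, the segment meets the same
  \<open>F n\<close> again. A linear map is then controlled at \<open>x\<close> by its values at two
  points of \<open>F n\<close>.\<close>

lemma Baire_convex_cover:
  fixes S :: "'a::banach set"
  assumes "closed S" "S \<noteq> {}" "convex S" and F: "\<And>n. closed (F n)" "S \<subseteq> (\<Union>n::nat. F n)"
  obtains n x0 where "x0 \<in> S" "x0 \<in> F n"
    "\<And>x. x \<in> S \<Longrightarrow> \<exists>d. 0 < d \<and> d \<le> 1 \<and> x0 + d *\<^sub>R (x - x0) \<in> F n"
proof -
  obtain n x0 e where e: "x0 \<in> S" "e > 0" "ball x0 e \<inter> S \<subseteq> F n"
    by (rule Baire_cover[OF assms(1,2) F])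
  show thesis
  proof (rule that[OF e(1)])
    show "x0 \<in> F n" using e by auto
    fix x assume x: "x \<in> S"
    \<comment> \<open>The minimum with 1 keeps the point on the segment inside \<open>S\<close>; the
      other bound moves it by at most \<open>e / 2\<close>, with 1 added to the norm so that
      \<open>x = x0\<close> causes no division by zero.\<close>
    define d where "d = min 1 (e / (2 * (norm (x - x0) + 1)))"
    have k: "norm (x - x0) + 1 > 0" by (simp add: add_nonneg_pos)
    have d: "0 < d" "d \<le> 1" using e(2) k by (auto simp: d_def)
    have "d * norm (x - x0) \<le> d * (norm (x - x0) + 1)" using d by simp
    also have "\<dots> \<le> e / (2 * (norm (x - x0) + 1)) * (norm (x - x0) + 1)"
      using k by (intro mult_right_mono) (auto simp: d_def)
    also have "\<dots> = e / 2" using k by (simp add: divide_simps)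
    also have "\<dots> < e" using e(2) by simp
    finally have "x0 + d *\<^sub>R (x - x0) \<in> ball x0 e" using d by (simp add: dist_norm)
    moreover have "(1 - d) *\<^sub>R x0 + d *\<^sub>R x \<in> S"
      using d by (intro convexD[OF \<open>convex S\<close> e(1) x]) auto
    then have "x0 + d *\<^sub>R (x - x0) \<in> S" by (simp add: algebra_simps)
    ultimately show "\<exists>d. 0 < d \<and> d \<le> 1 \<and> x0 + d *\<^sub>R (x - x0) \<in> F n" using e(3) d by blast
  qed
qed

text \<open>The operators are only required to be bounded eventually along a sequence of
  index sets, which is what strong continuity at \<open>0\<close> yields for a semigroup.\<close>

theorem Banach_Steinhaus_eventually:
  fixes B :: "'i \<Rightarrow> 'a::banach \<Rightarrow> 'b::real_normed_vector" and J :: "nat \<Rightarrow> 'i set"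
  assumes lin: "\<And>n i. i \<in> J n \<Longrightarrow> bounded_linear (B i)"
    and bdd: "\<And>x. \<exists>n. \<forall>i\<in>J n. norm (B i x) \<le> real n"
  obtains n K where "\<And>i x. i \<in> J n \<Longrightarrow> norm (B i x) \<le> K * norm x" "K \<ge> 0"
proof -
  define F where "F n = (\<Inter>i\<in>J n. {x. norm (B i x) \<le> real n})" for n
  have cl: "closed (F n)" for n
    unfolding F_def
  proof (intro closed_INT ballI closed_Collect_le)
    fix i assume "i \<in> J n"
    then show "continuous_on UNIV (\<lambda>x. norm (B i x))"
      by (intro continuous_on_norm linear_continuous_on lin)
  qed (rule continuous_on_const)
  have "UNIV \<subseteq> (\<Union>n. F n)" using bdd by (fastforce simp: F_def)
  then obtain n x0 e where e: "e > 0" "ball x0 e \<inter> UNIV \<subseteq> F n"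
    by (rule Baire_cover[OF closed_UNIV UNIV_not_empty cl])
  have "norm (B i x) \<le> (4 * real n / e) * norm x" if i: "i \<in> J n" for i x
  proof (cases "x = 0")
    case True
    then show ?thesis using linear_0[OF bounded_linear.linear[OF lin[OF i]]] by simp
  next
    case False
    define c where "c = e / (2 * norm x)"
    have c: "c > 0" "c * norm x < e" using False e(1) by (auto simp: c_def)
    have "x0 + c *\<^sub>R x \<in> F n" "x0 \<in> F n" using e c by (auto simp: dist_norm)
    then have le: "norm (B i (x0 + c *\<^sub>R x)) \<le> real n" "norm (B i x0) \<le> real n"
      using i by (auto simp: F_def)
    interpret bounded_linear "B i" by (rule lin[OF i])
    have "c *\<^sub>R B i x = B i (x0 + c *\<^sub>R x) - B i x0" by (simp add: add scaleR)
    then have "norm (c *\<^sub>R B i x) \<le> real n + real n"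
      by (metis add_mono le norm_triangle_ineq4 order_trans)
    then have "c * norm (B i x) \<le> 2 * real n" using c by simp
    then have "norm (B i x) \<le> 2 * real n / c" using c by (simp add: field_simps)
    also have "\<dots> = (4 * real n / e) * norm x" using False e by (simp add: c_def)
    finally show ?thesis .
  qed
  moreover have "4 * real n / e \<ge> 0" using e by simp
  ultimately show thesis using that by blast
qed

section \<open>Strongly continuous semigroups\<close>

text \<open>Links the derivatives of integral calculus to the one-sided quotients by which
  generators are defined.\<close>

lemma has_vector_derivative_right_quotient:
  fixes f :: "real \<Rightarrow> 'a::real_normed_vector"
  assumes "(f has_vector_derivative f') (at x within {x..b})" "x < b"
  shows "((\<lambda>h. (f (x + h) - f x) /\<^sub>R h) \<longlongrightarrow> f') (at_right 0)"
proof -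
  have "((\<lambda>y. (1 / norm (y - x)) *\<^sub>R (f y - (f x + (y - x) *\<^sub>R f'))) \<longlongrightarrow> 0) (at x within {x..b})"
    using assms(1) unfolding has_vector_derivative_def has_derivative_within by blast
  then have "((\<lambda>y. (1 / norm (y - x)) *\<^sub>R (f y - (f x + (y - x) *\<^sub>R f'))) \<longlongrightarrow> 0) (at_right x)"
    using assms(2) by (simp add: at_within_Icc_at_right)
  then have "((\<lambda>h. (1 / norm h) *\<^sub>R (f (h + x) - (f x + h *\<^sub>R f'))) \<longlongrightarrow> 0) (at_right 0)"
    by (subst (asm) filterlim_at_right_to_0) simp
  moreover have "\<forall>\<^sub>F h in at_right (0::real). (1 / norm h) *\<^sub>R (f (h + x) - (f x + h *\<^sub>R f')) =
      (f (x + h) - f x) /\<^sub>R h - f'"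
    by (auto simp: eventually_at_right_less algebra_simps divide_inverse
        intro!: eventually_mono[OF eventually_at_right_less[of 0]])
  ultimately have "((\<lambda>h. (f (x + h) - f x) /\<^sub>R h - f') \<longlongrightarrow> 0) (at_right 0)"
    by (rule Lim_transform_eventually)
  then show ?thesis by (rule LIM_zero_cancel)
qed

lemma integral_shift_banach:
  fixes f :: "real \<Rightarrow> 'a::banach"
  assumes "f integrable_on {a + c..b + c}"
  shows "integral {a..b} (\<lambda>x. f (x + c)) = integral {a + c..b + c} f"
proof -
  have "((\<lambda>x. f (1 *\<^sub>R x + c)) has_integral (1 / \<bar>1\<bar> ^ DIM(real)) *\<^sub>R integral {a + c..b + c} f)
      ((\<lambda>x. (1 / 1) *\<^sub>R x + - ((1 / 1) *\<^sub>R c)) ` cbox (a + c) (b + c))"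
    using assms by (intro has_integral_affinity) (auto simp: has_integral_integral)
  moreover have "(\<lambda>x. x - c) ` {a + c..b + c} = {a..b}"
    using image_add_atLeastAtMost[of "- c" "a + c" "b + c"] by (simp add: image_def)
  ultimately show ?thesis by (auto simp: integral_unique)
qed

locale real_c0_semigroup =
  fixes T :: "real \<Rightarrow> 'a::banach \<Rightarrow> 'a"
  assumes bounded_linear_T: "0 \<le> t \<Longrightarrow> bounded_linear (T t)"
    and T_0 [simp]: "T 0 x = x"
    and T_add: "0 \<le> s \<Longrightarrow> 0 \<le> t \<Longrightarrow> T (s + t) x = T s (T t x)"
    and T_cont_0: "((\<lambda>t. T t x) \<longlongrightarrow> x) (at_right 0)"
begin

lemma T_linear:
  assumes "0 \<le> t"
  shows T_plus: "T t (x + y) = T t x + T t y" and T_diff: "T t (x - y) = T t x - T t y"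
    and T_scaleR: "T t (c *\<^sub>R x) = c *\<^sub>R T t x" and T_minus: "T t (- x) = - T t x"
    and T_zero: "T t 0 = 0"
proof -
  interpret bounded_linear "T t" by (rule bounded_linear_T[OF assms])
  show "T t (x + y) = T t x + T t y" "T t (x - y) = T t x - T t y"
    "T t (c *\<^sub>R x) = c *\<^sub>R T t x" "T t (- x) = - T t x" "T t 0 = 0"
    by (simp_all add: add diff scaleR neg zero)
qed

lemma T_commute: "0 \<le> s \<Longrightarrow> 0 \<le> t \<Longrightarrow> T s (T t x) = T t (T s x)"
  using T_add[of s t x] T_add[of t s x] by (simp add: add.commute)

lemma T_tendsto: "0 \<le> t \<Longrightarrow> (f \<longlongrightarrow> x) F \<Longrightarrow> ((\<lambda>i. T t (f i)) \<longlongrightarrow> T t x) F"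
  by (rule bounded_linear.tendsto[OF bounded_linear_T])

text \<open>Strong continuity at 0 bounds each orbit on a short interval whose length depends on the
  vector. The uniform boundedness principle gives one interval of length \<open>h\<close> and one
  constant \<open>M\<close>; powers of \<open>M\<close> then cover all times.\<close>

lemma exponentially_bounded:
  obtains M \<omega> where "0 < M" "0 \<le> \<omega>" "\<And>t x. 0 \<le> t \<Longrightarrow> norm (T t x) \<le> M * exp (\<omega> * t) * norm x"
proof -
  \<comment> \<open>A single index \<open>n\<close> both shortens the time window and raises the
    allowed bound, so a large \<open>n\<close> serves any given vector.\<close>
  define J where "J n = {0..1 / real (Suc n)}" for n
  have bdd: "\<exists>n. \<forall>t\<in>J n. norm (T t x) \<le> real n" for x
  proof -
    have "\<forall>\<^sub>F t in at_right 0. norm (T t x) < norm x + 1"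
      using tendsto_norm[OF T_cont_0[of x]] by (rule order_tendstoD) simp
    then obtain d where d: "d > 0" "\<And>t. 0 < t \<Longrightarrow> t < d \<Longrightarrow> norm (T t x) < norm x + 1"
      by (auto simp: eventually_at_right_field)
    obtain n where n: "max (norm x + 1) (1 / d) < real n" using reals_Archimedean2 by blast
    have "norm (T t x) \<le> real n" if "t \<in> J n" for t
    proof (cases "t = 0")
      case False
      have "1 / d < real (Suc n)" using n by simp
      then have "1 / real (Suc n) < d" using d(1) by (simp add: field_simps)
      then show ?thesis using that False d(2)[of t] n by (auto simp: J_def)
    qed (use n in simp)
    then show ?thesis by blast
  qed
  obtain n K where K: "\<And>t x. t \<in> J n \<Longrightarrow> norm (T t x) \<le> K * norm x" "K \<ge> 0"
  proof (rule Banach_Steinhaus_eventually[of J T])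
    show "bounded_linear (T t)" if "t \<in> J n" for n t
      using that by (auto simp: J_def intro: bounded_linear_T)
  qed (use bdd in blast)+
  define h where "h = 1 / real (Suc n)"
  define M where "M = max K 1"
  have h: "h > 0" and M: "M \<ge> 1" by (auto simp: h_def M_def)
  have KM: "norm (T t x) \<le> M * norm x" if "0 \<le> t" "t \<le> h" for t x
  proof -
    have "norm (T t x) \<le> K * norm x" using that by (intro K) (auto simp: J_def h_def)
    also have "\<dots> \<le> M * norm x" by (intro mult_right_mono) (auto simp: M_def)
    finally show ?thesis .
  qed
  have pow: "norm (T t x) \<le> M ^ k * norm x" if "0 \<le> t" "t \<le> real k * h" for k t x
    using that
  proof (induction k arbitrary: t x)
    case (Suc k)
    show ?case
    proof (cases "t \<le> h")
      case True
      have "M * norm x \<le> M * M ^ k * norm x"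
        using M one_le_power[OF M, of k] by (intro mult_right_mono) auto
      then show ?thesis using KM[of t x] True Suc.prems by simp
    next
      case False
      have "T t x = T h (T (t - h) x)"
        using T_add[of h "t - h" x] False h by simp
      also have "norm \<dots> \<le> M * norm (T (t - h) x)" using h by (intro KM) auto
      also have "\<dots> \<le> M * (M ^ k * norm x)"
        using False Suc.prems M by (intro mult_left_mono Suc.IH) (auto simp: algebra_simps)
      finally show ?thesis by simp
    qed
  qed (simp add: antisym[of t 0 for t])
  have "norm (T t x) \<le> M * exp (ln M / h * t) * norm x" if "0 \<le> t" for t x
  proof -
    \<comment> \<open>Rounding \<open>t / h\<close> up costs at most one further factor
      \<open>M\<close>, which becomes the constant in front of the exponential.\<close>
    define k where "k = nat \<lceil>t / h\<rceil>"
    have k: "t / h \<le> real k" "real k \<le> t / h + 1"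
      using that h by (auto simp: k_def)
    have "norm (T t x) \<le> M ^ k * norm x"
      using k(1) h that by (intro pow) (simp_all add: field_simps)
    also have "M ^ k = exp (real k * ln M)"
      using M by (simp add: exp_of_nat_mult)
    also have "\<dots> \<le> exp ((t / h + 1) * ln M)"
      using k(2) M by (simp add: mult_right_mono)
    also have "\<dots> = M * exp (ln M / h * t)"
      using M by (simp add: algebra_simps exp_add)
    finally show ?thesis by (simp add: mult_right_mono)
  qed
  moreover have "0 \<le> ln M / h" "0 < M" using M h by auto
  ultimately show thesis using that by blast
qed

text \<open>Right continuity at 0 suffices on both sides: two orbit values differ by
  \<open>T a (T r x - x)\<close> with \<open>a\<close> the smaller time, and the operators at times
  up to \<open>t + 1\<close> share the bound \<open>B\<close>.\<close>

lemma continuous_on_T: "continuous_on {0..} (\<lambda>t. T t x)"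
  unfolding continuous_on_iff
proof (intro ballI allI impI)
  fix t e :: real assume "t \<in> {0..}" and e: "e > 0"
  then have t: "0 \<le> t" by simp
  obtain M \<omega> where M: "0 < M" "0 \<le> \<omega>"
    "\<And>t x. 0 \<le> t \<Longrightarrow> norm (T t x) \<le> M * exp (\<omega> * t) * norm x"
    by (rule exponentially_bounded) blast
  define B where "B = M * exp (\<omega> * (t + 1))"
  have B: "B > 0" using M by (simp add: B_def)
  have T_le: "norm (T r y) \<le> B * norm y" if "0 \<le> r" "r \<le> t + 1" for r y
  proof -
    have "norm (T r y) \<le> M * exp (\<omega> * r) * norm y" by (rule M(3)[OF that(1)])
    also have "\<dots> \<le> B * norm y"
      using M that unfolding B_def by (intro mult_right_mono mult_left_mono) (auto intro: mult_left_mono)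
    finally show ?thesis .
  qed
  have "\<forall>\<^sub>F r in at_right 0. dist (T r x) x < e / B"
    using T_cont_0[of x] e B by (intro tendstoD) auto
  then obtain d where d: "d > 0" "\<And>r. 0 < r \<Longrightarrow> r < d \<Longrightarrow> dist (T r x) x < e / B"
    by (auto simp: eventually_at_right_field)
  have *: "dist (T (r + a) x) (T a x) < e" if "0 \<le> a" "a \<le> t + 1" "0 \<le> r" "r < d" for a r
  proof (cases "r = 0")
    case False
    have "T (r + a) x - T a x = T a (T r x - x)"
      using that T_add[of a r x] by (simp add: T_diff add.commute)
    then have "dist (T (r + a) x) (T a x) \<le> B * norm (T r x - x)"
      using T_le[of a] that by (simp add: dist_norm)
    also have "\<dots> < B * (e / B)"
      using d(2)[of r] False that B by (intro mult_strict_left_mono) (auto simp: dist_norm)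
    finally show ?thesis using B by simp
  qed (use e in simp)
  show "\<exists>d>0. \<forall>s\<in>{0..}. dist s t < d \<longrightarrow> dist (T s x) (T t x) < e"
  proof (intro exI[of _ "min d 1"] conjI ballI impI)
    fix s :: real assume "s \<in> {0..}" and st: "dist s t < min d 1"
    show "dist (T s x) (T t x) < e"
    proof (cases "t \<le> s")
      case True
      then show ?thesis using *[of t "s - t"] st t by (auto simp: dist_real_def)
    next
      case False
      then show ?thesis using *[of s "t - s"] st \<open>s \<in> {0..}\<close>
        by (auto simp: dist_real_def dist_commute)
    qed
  qed (use d in auto)
qed

lemma continuous_on_exp_T: "continuous_on {0..} (\<lambda>t. exp (c * t) *\<^sub>R T t x)"
  by (intro continuous_intros continuous_on_T)

lemma integrable_exp_T: "0 \<le> a \<Longrightarrow> (\<lambda>t. exp (c * t) *\<^sub>R T t x) integrable_on {a..b}"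
  by (intro integrable_continuous_real continuous_on_subset[OF continuous_on_exp_T]) auto

lemma exp_T_bounded:
  obtains K where "0 \<le> K" "\<And>l r. \<bar>l\<bar> \<le> c \<Longrightarrow> 0 \<le> r \<Longrightarrow> r \<le> t \<Longrightarrow> norm (exp (l * r) *\<^sub>R T r x) \<le> K"
proof -
  obtain M \<omega> where M: "0 < M" "0 \<le> \<omega>"
    "\<And>t x. 0 \<le> t \<Longrightarrow> norm (T t x) \<le> M * exp (\<omega> * t) * norm x"
    by (rule exponentially_bounded) blast
  have "norm (exp (l * r) *\<^sub>R T r x) \<le> exp (c * t) * (M * exp (\<omega> * t) * norm x)"
    if "\<bar>l\<bar> \<le> c" "0 \<le> r" "r \<le> t" for l r
  proof -
    have "l * r \<le> c * t" using that by (intro mult_mono) auto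
    moreover have "norm (T r x) \<le> M * exp (\<omega> * t) * norm x"
      using M(3)[OF that(2), of x] M(1,2) that(3)
      by (elim order_trans) (intro mult_right_mono mult_left_mono, auto intro: mult_left_mono)
    ultimately have "exp (l * r) * norm (T r x) \<le> exp (c * t) * (M * exp (\<omega> * t) * norm x)"
      by (intro mult_mono) auto
    then show ?thesis by simp
  qed
  moreover have "0 \<le> exp (c * t) * (M * exp (\<omega> * t) * norm x)" using M by simp
  ultimately show thesis using that by blast
qed

definition gen :: "('a \<times> 'a) set" where
  "gen = {(x, y). ((\<lambda>t. (T t x - x) /\<^sub>R t) \<longlongrightarrow> y) (at_right 0)}"

lemma gen_T:
  assumes "(x, y) \<in> gen" "0 \<le> t"
  shows "(T t x, T t y) \<in> gen"
proof -
  have "((\<lambda>h. T t ((T h x - x) /\<^sub>R h)) \<longlongrightarrow> T t y) (at_right 0)"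
    using assms by (intro T_tendsto) (auto simp: gen_def)
  moreover have "\<forall>\<^sub>F h in at_right (0::real). T t ((T h x - x) /\<^sub>R h) = (T h (T t x) - T t x) /\<^sub>R h"
    using eventually_at_right_less[of 0]
    by eventually_elim (use assms(2) in \<open>simp add: T_scaleR T_diff T_commute[of t]\<close>)
  ultimately have "((\<lambda>h. (T h (T t x) - T t x) /\<^sub>R h) \<longlongrightarrow> T t y) (at_right 0)"
    by (rule Lim_transform_eventually)
  then show ?thesis by (simp add: gen_def)
qed

text \<open>For the truncated Laplace integral, the rescaled operator
  \<open>exp (- l * h) *\<^sub>R T h\<close> merely shifts the integrand by \<open>h\<close>. Its
  difference quotient therefore consists of contributions from the two end points.\<close>

lemma integral_in_gen:
  fixes l t :: real and x :: 'a
  assumes t: "0 \<le> t"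
  defines "I \<equiv> integral {0..t} (\<lambda>r. exp (- l * r) *\<^sub>R T r x)"
  shows "(I, exp (- l * t) *\<^sub>R T t x - x + l *\<^sub>R I) \<in> gen"
proof -
  define S where "S r = exp (- l * r) *\<^sub>R T r x" for r
  define u where "u a = integral {0..a} S" for a
  have cont: "continuous_on {0..b} S" for b
    unfolding S_def by (intro continuous_on_subset[OF continuous_on_exp_T]) auto
  have int: "S integrable_on {a..b}" if "0 \<le> a" for a b
    unfolding S_def using integrable_exp_T[OF that] .
  have quot: "((\<lambda>h. (u (a + h) - u a) /\<^sub>R h) \<longlongrightarrow> S a) (at_right 0)" if "0 \<le> a" for a
  proof (rule has_vector_derivative_right_quotient)
    have "(u has_vector_derivative S a) (at a within {0..a + 1})"
      unfolding u_def using that by (intro integral_has_vector_derivative cont) auto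
    then show "(u has_vector_derivative S a) (at a within {a..a + 1})"
      by (rule has_vector_derivative_within_subset) (use that in auto)
  qed simp
  have eq: "exp (- l * h) *\<^sub>R T h I - I = (u (t + h) - u t) - (u h - u 0)" if "h > 0" for h
  proof -
    have "exp (- l * h) *\<^sub>R T h I = exp (- l * h) *\<^sub>R integral {0..t} (T h \<circ> S)"
      unfolding I_def S_def[symmetric]
      using that by (subst integral_linear[OF int bounded_linear_T]) auto
    also have "\<dots> = integral {0..t} (\<lambda>r. exp (- l * h) *\<^sub>R T h (S r))" by (simp add: comp_def)
    also have "\<dots> = integral {0..t} (\<lambda>r. S (r + h))"
    proof (rule integral_cong)
      fix r assume "r \<in> {0..t}"
      then have "exp (- l * h) *\<^sub>R T h (S r) = (exp (- l * h) * exp (- l * r)) *\<^sub>R T (h + r) x"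
        using that by (simp add: S_def T_scaleR T_add)
      also have "\<dots> = S (r + h)" by (simp add: S_def exp_add[symmetric] algebra_simps)
      finally show "exp (- l * h) *\<^sub>R T h (S r) = S (r + h)" .
    qed
    also have "\<dots> = integral {h..t + h} S"
      using integral_shift_banach[of S 0 h t] int that by simp
    also have "\<dots> = u (t + h) - u h"
      using Henstock_Kurzweil_Integration.integral_combine[of 0 h "t + h" S] int that t
      by (simp add: u_def algebra_simps)
    finally show ?thesis by (simp add: u_def I_def S_def[abs_def])
  qed
  \<comment> \<open>The factor \<open>exp (l * h)\<close> undoes the rescaling; its own derivative
    at 0 contributes the summand \<open>l *\<^sub>R I\<close>.\<close>
  have "((\<lambda>h. exp (l * h) *\<^sub>R ((u (t + h) - u t) /\<^sub>R h - (u (0 + h) - u 0) /\<^sub>R h)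
      + ((exp (l * h) - 1) / h) *\<^sub>R I) \<longlongrightarrow> exp (l * 0) *\<^sub>R (S t - S 0) + l *\<^sub>R I) (at_right 0)"
  proof (intro tendsto_add tendsto_scaleR tendsto_diff quot tendsto_const t order_refl)
    show "((\<lambda>h. exp (l * h)) \<longlongrightarrow> exp (l * 0)) (at_right 0)"
      by (intro tendsto_intros)
    have "((\<lambda>h. exp (l * h)) has_real_derivative l) (at 0)"
      by (auto intro!: derivative_eq_intros)
    then have "((\<lambda>h. (exp (l * h) - 1) / h) \<longlongrightarrow> l) (at 0)"
      by (simp add: has_field_derivative_iff)
    then show "((\<lambda>h. (exp (l * h) - 1) / h) \<longlongrightarrow> l) (at_right 0)"
      by (rule tendsto_mono[rotated]) (rule at_le, simp)
  qed
  moreover have "\<forall>\<^sub>F h in at_right (0::real). exp (l * h) *\<^sub>R ((u (t + h) - u t) /\<^sub>R h - (u (0 + h) - u 0) /\<^sub>R h)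
      + ((exp (l * h) - 1) / h) *\<^sub>R I = (T h I - I) /\<^sub>R h"
    using eventually_at_right_less[of 0]
  proof eventually_elim
    case (elim h)
    have "exp (l * h) *\<^sub>R ((u (t + h) - u t) /\<^sub>R h - (u (0 + h) - u 0) /\<^sub>R h)
      = exp (l * h) *\<^sub>R (exp (- l * h) *\<^sub>R T h I - I) /\<^sub>R h"
      by (simp only: eq[OF elim] scaleR_diff_right) (simp add: algebra_simps)
    also have "\<dots> = (T h I - exp (l * h) *\<^sub>R I) /\<^sub>R h"
      by (simp add: scaleR_diff_right exp_add[symmetric])
    finally show ?case by (simp add: algebra_simps divide_inverse)
  qed
  ultimately have "((\<lambda>h. (T h I - I) /\<^sub>R h) \<longlongrightarrow> exp (l * 0) *\<^sub>R (S t - S 0) + l *\<^sub>R I) (at_right 0)"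
    by (rule Lim_transform_eventually)
  then show ?thesis by (simp add: gen_def S_def)
qed

text \<open>A bounded two-sided inverse of \<open>l - gen\<close>, written for graphs: the second
  conjunct is the right inverse property, including that the range lies in the domain, and the third
  is the left inverse property.\<close>

definition res :: "real \<Rightarrow> ('a \<Rightarrow> 'a) \<Rightarrow> bool" where
  "res l R \<longleftrightarrow> bounded_linear R \<and> (\<forall>x. (R x, l *\<^sub>R R x - x) \<in> gen) \<and>
     (\<forall>(x, y)\<in>gen. R (l *\<^sub>R x - y) = x)"

lemma res_bounded_linear: "res l R \<Longrightarrow> bounded_linear R"
  and res_in_gen: "res l R \<Longrightarrow> (R x, l *\<^sub>R R x - x) \<in> gen"
  and res_left_inverse: "res l R \<Longrightarrow> (x, y) \<in> gen \<Longrightarrow> R (l *\<^sub>R x - y) = x"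
  by (auto simp: res_def)

lemma res_T:
  assumes "res l R" "0 \<le> t"
  shows "R (T t x) = T t (R x)"
proof -
  have "(T t (R x), T t (l *\<^sub>R R x - x)) \<in> gen"
    using assms by (intro gen_T res_in_gen)
  from res_left_inverse[OF assms(1) this] show ?thesis
    using assms(2) by (simp add: T_scaleR T_diff)
qed

text \<open>Obtained by applying \<open>R\<close> to the truncated Laplace integral instead of
  letting the time tend to infinity, so it holds at every real resolvent point, even where the
  Laplace integral diverges.\<close>

lemma res_integral:
  assumes "res l R" "0 \<le> t"
  shows "R x = integral {0..t} (\<lambda>r. exp (- l * r) *\<^sub>R T r x) + exp (- l * t) *\<^sub>R R (T t x)"
proof -
  define I where "I = integral {0..t} (\<lambda>r. exp (- l * r) *\<^sub>R T r x)"
  interpret bounded_linear R using assms(1) by (rule res_bounded_linear)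
  have "(I, exp (- l * t) *\<^sub>R T t x - x + l *\<^sub>R I) \<in> gen"
    unfolding I_def by (rule integral_in_gen[OF assms(2)])
  from res_left_inverse[OF assms(1) this]
  have "R (x - exp (- l * t) *\<^sub>R T t x) = I" by (simp add: algebra_simps)
  then show ?thesis unfolding I_def[symmetric] by (simp add: diff scaleR diff_eq_eq)
qed

lemma res_identity:
  assumes "res l R" "res m Q"
  shows "Q x = R x + (l - m) *\<^sub>R R (Q x)"
proof -
  interpret bounded_linear R using assms(1) by (rule res_bounded_linear)
  have "R (l *\<^sub>R Q x - (m *\<^sub>R Q x - x)) = Q x"
    by (rule res_left_inverse[OF assms(1) res_in_gen[OF assms(2)]])
  then show ?thesis by (simp add: diff add scaleR algebra_simps)
qed

lemma res_eigenvector: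
  assumes "res l R" "(x, s *\<^sub>R x) \<in> gen"
  shows "(l - s) *\<^sub>R R x = x"
proof -
  interpret bounded_linear R using assms(1) by (rule res_bounded_linear)
  show ?thesis using res_left_inverse[OF assms] by (simp add: scaleR diff algebra_simps)
qed

text \<open>From the generator to the semigroup, the finite-time identity yields an integral
  equation for the rescaled orbit, whose solution is an exponential. The converse is differentiation
  at 0.\<close>

lemma eigenvector_iff:
  assumes "res l R" "l \<noteq> s"
  shows "(x, s *\<^sub>R x) \<in> gen \<longleftrightarrow> (\<forall>t\<ge>0. T t x = exp (s * t) *\<^sub>R x)"
proof
  assume *: "\<forall>t\<ge>0. T t x = exp (s * t) *\<^sub>R x"
  have "((\<lambda>h. exp (s * h)) has_real_derivative s) (at 0)"
    by (auto intro!: derivative_eq_intros)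
  then have "((\<lambda>h. (exp (s * h) - 1) / h) \<longlongrightarrow> s) (at 0)"
    by (simp add: has_field_derivative_iff)
  then have "((\<lambda>h. (exp (s * h) - 1) / h) \<longlongrightarrow> s) (at_right 0)"
    by (rule tendsto_mono[rotated]) (rule at_le, simp)
  then have "((\<lambda>h. ((exp (s * h) - 1) / h) *\<^sub>R x) \<longlongrightarrow> s *\<^sub>R x) (at_right 0)"
    by (intro tendsto_intros)
  moreover have "\<forall>\<^sub>F h in at_right (0::real). ((exp (s * h) - 1) / h) *\<^sub>R x = (T h x - x) /\<^sub>R h"
    using eventually_at_right_less[of 0]
    by eventually_elim (use * in \<open>simp add: algebra_simps divide_inverse\<close>)
  ultimately show "(x, s *\<^sub>R x) \<in> gen"
    unfolding gen_def by (auto intro: Lim_transform_eventually)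
next
  assume x: "(x, s *\<^sub>R x) \<in> gen"
  show "\<forall>t\<ge>0. T t x = exp (s * t) *\<^sub>R x"
  proof (intro allI impI)
    fix t :: real assume t: "0 \<le> t"
    define u where "u r = exp (- l * r) *\<^sub>R T r x" for r
    define c where "c = l - s"
    have Rx: "c *\<^sub>R R x = x" and RTx: "c *\<^sub>R R (T r x) = T r x" if "0 \<le> r" for r
      using res_eigenvector[OF assms(1) x] res_T[OF assms(1) that, of x] that
      by (simp_all add: c_def T_scaleR[symmetric])
    \<comment> \<open>Both \<open>x\<close> and \<open>T r x\<close> are eigenvectors on which
      \<open>R\<close> acts as division by \<open>c = l - s\<close>, so multiplying the finite-time
      identity by \<open>c\<close> removes the resolvent.\<close>
    have u_eq: "u r = x - c *\<^sub>R integral {0..r} u" if "0 \<le> r" for r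
    proof -
      have "c *\<^sub>R R x = c *\<^sub>R integral {0..r} u + exp (- l * r) *\<^sub>R c *\<^sub>R R (T r x)"
        by (subst res_integral[OF assms(1) that, of x])
          (simp add: u_def[abs_def] algebra_simps)
      then show ?thesis using Rx[OF that] RTx[OF that] by (simp add: u_def algebra_simps)
    qed
    have cont: "continuous_on {0..t} u"
      unfolding u_def by (intro continuous_on_subset[OF continuous_on_exp_T]) auto
    have du: "(u has_vector_derivative - c *\<^sub>R u r) (at r within {0..t})" if "r \<in> {0..t}" for r
    proof (rule has_vector_derivative_transform[OF that])
      show "((\<lambda>r. x - c *\<^sub>R integral {0..r} u) has_vector_derivative - c *\<^sub>R u r) (at r within {0..t})"
        by (rule derivative_eq_intros refl integral_has_vector_derivative[OF cont that])+ simp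
    qed (use u_eq in auto)
    have "((\<lambda>r. exp (c * r) *\<^sub>R u r) has_vector_derivative 0) (at r within {0..t})" if "r \<in> {0..t}" for r
      by (rule derivative_eq_intros refl du[OF that])+ (simp add: algebra_simps)
    from has_vector_derivative_zero_constant[OF convex_real_interval(5) this]
    obtain k where k: "\<And>r. r \<in> {0..t} \<Longrightarrow> exp (c * r) *\<^sub>R u r = k" by blast
    from k[of 0] k[of t] t have "exp (c * t) *\<^sub>R u t = x" by (simp add: u_def)
    then have "(exp (c * t) * exp (- l * t)) *\<^sub>R T t x = x" by (simp add: u_def)
    also have "exp (c * t) * exp (- l * t) = exp (- s * t)"
      by (simp add: exp_add[symmetric] c_def algebra_simps)
    finally have "exp (s * t) *\<^sub>R x = exp (s * t) *\<^sub>R exp (- s * t) *\<^sub>R T t x" by simp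
    then show "T t x = exp (s * t) *\<^sub>R x" by (simp add: exp_add[symmetric])
  qed
qed

text \<open>The difference is an integral over a fixed finite time interval, hence bounded uniformly
  in \<open>l\<close> even when \<open>R\<close> blows up.\<close>

lemma res_bounded_error:
  assumes t: "0 \<le> t"
  obtains K where "0 \<le> K"
    "\<And>l R. \<bar>l\<bar> \<le> c \<Longrightarrow> res l R \<Longrightarrow> norm (R x - exp (- l * t) *\<^sub>R R (T t x)) \<le> K"
proof -
  obtain K where K: "0 \<le> K"
    "\<And>l r. \<bar>l\<bar> \<le> c \<Longrightarrow> 0 \<le> r \<Longrightarrow> r \<le> t \<Longrightarrow> norm (exp (l * r) *\<^sub>R T r x) \<le> K"
    by (rule exp_T_bounded) blast
  have "norm (R x - exp (- l * t) *\<^sub>R R (T t x)) \<le> K * t" if "\<bar>l\<bar> \<le> c" "res l R" for l R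
  proof -
    have "norm (integral {0..t} (\<lambda>r. exp (- l * r) *\<^sub>R T r x)) \<le> K * (t - 0)"
    proof (rule integral_bound[OF t])
      show "continuous_on {0..t} (\<lambda>r. exp (- l * r) *\<^sub>R T r x)"
        by (intro continuous_on_subset[OF continuous_on_exp_T]) auto
      show "norm (exp (- l * r) *\<^sub>R T r x) \<le> K" if "r \<in> {0..t}" for r
        using K(2)[of "- l" r] that \<open>\<bar>l\<bar> \<le> c\<close> by simp
    qed
    moreover have "R x - exp (- l * t) *\<^sub>R R (T t x) = integral {0..t} (\<lambda>r. exp (- l * r) *\<^sub>R T r x)"
      using res_integral[OF that(2) t, of x] by (simp add: algebra_simps)
    ultimately show ?thesis by simp
  qed
  moreover have "0 \<le> K * t" using K(1) t by simp
  ultimately show thesis using that by blast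
qed

end

section \<open>Eventually positive and persistently irreducible semigroups\<close>

definition solid :: "'a::banach_lattice set \<Rightarrow> bool" where
  "solid J \<longleftrightarrow> (\<forall>x y. y \<in> J \<longrightarrow> \<bar>x\<bar> \<le> \<bar>y\<bar> \<longrightarrow> x \<in> J)"

locale real_ev_pos_semigroup = real_c0_semigroup T
  for T :: "real \<Rightarrow> 'a::banach_lattice \<Rightarrow> 'a" +
  assumes eventually_pos: "0 \<le> x \<Longrightarrow> \<exists>t\<^sub>0\<ge>0. \<forall>t\<ge>t\<^sub>0. 0 \<le> T t x"
    and irreducible: "closed J \<Longrightarrow> subspace J \<Longrightarrow> solid J \<Longrightarrow> 0 \<le> t\<^sub>0 \<Longrightarrow>
      (\<And>t x. t\<^sub>0 \<le> t \<Longrightarrow> x \<in> J \<Longrightarrow> T t x \<in> J) \<Longrightarrow> J = {0} \<or> J = UNIV"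
begin

lemma eventually_T_mono:
  assumes "x \<le> y"
  obtains t\<^sub>0 where "0 \<le> t\<^sub>0" "\<And>t. t\<^sub>0 \<le> t \<Longrightarrow> T t x \<le> T t y"
proof -
  obtain t\<^sub>0 where "0 \<le> t\<^sub>0" "\<forall>t\<ge>t\<^sub>0. 0 \<le> T t (y - x)"
    using eventually_pos[of "y - x"] assms by auto
  then show thesis by (intro that[of t\<^sub>0]) (auto simp: T_diff)
qed

lemma eventually_abs_le:
  obtains t\<^sub>0 where "0 \<le> t\<^sub>0" "\<And>t. t\<^sub>0 \<le> t \<Longrightarrow> \<bar>T t x\<bar> \<le> T t \<bar>x\<bar>"
proof -
  obtain a where a: "0 \<le> a" "\<And>t. a \<le> t \<Longrightarrow> T t x \<le> T t \<bar>x\<bar>"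
    using eventually_T_mono[OF abs_ge_self[of x]] by blast
  obtain b where b: "0 \<le> b" "\<And>t. b \<le> t \<Longrightarrow> T t (- x) \<le> T t \<bar>x\<bar>"
    using eventually_T_mono[OF abs_ge_minus_self[of x]] by blast
  show thesis
  proof (rule that[of "max a b"])
    fix t assume t: "max a b \<le> t"
    then have "0 \<le> t" using a(1) by simp
    then have "- T t x \<le> T t \<bar>x\<bar>" using b(2)[of t] t by (simp add: T_minus)
    then show "\<bar>T t x\<bar> \<le> T t \<bar>x\<bar>" using a(2)[of t] t by (intro abs_leI) auto
  qed (use a in simp)
qed

text \<open>The time after which \<open>T t x\<close> stays in the ideal depends on \<open>x\<close>; Baire's theorem makes it
  uniform.\<close>

lemma irreducible_individual:
  assumes "closed J" "subspace J" "solid J"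
    and ev: "\<And>x. x \<in> J \<Longrightarrow> \<exists>t\<^sub>0\<ge>0. \<forall>t\<ge>t\<^sub>0. T t x \<in> J"
  shows "J = {0} \<or> J = UNIV"
proof -
  define F where "F n = (\<Inter>t\<in>{real n..}. {x. T t x \<in> J})" for n
  have "closed {x. T t x \<in> J}" if "0 \<le> t" for t
    using continuous_closed_vimage[OF \<open>closed J\<close>, of "T t"] bounded_linear_T[OF that]
    by (auto simp: vimage_def intro: linear_continuous_at)
  then have cl: "closed (F n)" for n
    unfolding F_def by (intro closed_INT) auto
  have cover: "J \<subseteq> (\<Union>n. F n)"
  proof
    fix x assume "x \<in> J"
    then obtain t\<^sub>0 where t: "\<forall>t\<ge>t\<^sub>0. T t x \<in> J" using ev by blast
    obtain n where "t\<^sub>0 \<le> real n" using real_arch_simple by blast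
    then have "x \<in> F n" using t by (auto simp: F_def)
    then show "x \<in> (\<Union>n. F n)" by blast
  qed
  have ne: "J \<noteq> {}" using \<open>subspace J\<close> subspace_0 by blast
  obtain n x0 where x0: "x0 \<in> J" "x0 \<in> F n"
    "\<And>x. x \<in> J \<Longrightarrow> \<exists>d. 0 < d \<and> d \<le> 1 \<and> x0 + d *\<^sub>R (x - x0) \<in> F n"
    using Baire_convex_cover[OF \<open>closed J\<close> ne subspace_imp_convex[OF \<open>subspace J\<close>] cl cover] by blast
  have "T t x \<in> J" if t: "real n \<le> t" and x: "x \<in> J" for t x
  proof -
    have t0: "0 \<le> t" using t by simp
    obtain d where d: "0 < d" "x0 + d *\<^sub>R (x - x0) \<in> F n" using x0(3)[OF x] by blast
    have "T t (x0 + d *\<^sub>R (x - x0)) \<in> J" "T t x0 \<in> J" using d(2) x0(2) t by (auto simp: F_def)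
    \<comment> \<open>Solving \<open>x0 + d *\<^sub>R (x - x0)\<close> for \<open>x\<close> writes
      \<open>T t x\<close> as a combination of two vectors of \<open>J\<close>; \<open>d\<close>
      depends on \<open>x\<close>, but the waiting time \<open>n\<close> does not.\<close>
    then have "T t x0 + inverse d *\<^sub>R (T t (x0 + d *\<^sub>R (x - x0)) - T t x0) \<in> J"
      by (intro subspace_add subspace_scale subspace_diff \<open>subspace J\<close>)
    then show ?thesis using d(1) t0 by (simp add: T_plus T_diff T_scaleR)
  qed
  then show ?thesis using irreducible[OF assms(1-3), of "real n"] by simp
qed

text \<open>The null ideal of \<open>\<phi>\<close> is kept by late orbits: \<open>\<phi>\<close> of
  |T t a| is eventually at most \<open>\<phi>\<close> of T t |a|, which is a multiple of
  \<open>\<phi>\<close> of |a|. It is not the whole space because \<open>\<phi>\<close> is not zero,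
  so irreducibility leaves only the zero ideal.\<close>

lemma eigenfunctional_strictly_positive:
  assumes \<phi>: "bounded_linear \<phi>" "\<And>x. 0 \<le> x \<Longrightarrow> 0 \<le> \<phi> x" "\<phi> y \<noteq> (0::real)"
    and eig: "\<And>t x. 0 \<le> t \<Longrightarrow> \<phi> (T t x) = exp (s * t) * \<phi> x"
    and x: "0 \<le> x" "\<phi> x = 0"
  shows "x = 0"
proof -
  interpret \<phi>: bounded_linear \<phi> by (rule \<phi>(1))
  have mono: "\<phi> a \<le> \<phi> b" if "a \<le> b" for a b
    using \<phi>(2)[of "b - a"] that by (simp add: \<phi>.diff)
  have abs: "\<phi> a = 0" if "\<phi> \<bar>a\<bar> = 0" for a
    using mono[OF abs_ge_self[of a]] mono[OF abs_ge_minus_self[of a]] that by (simp add: \<phi>.neg)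
  define J where "J = {x. \<phi> \<bar>x\<bar> = 0}"
  have JI: "a \<in> J" if "\<bar>a\<bar> \<le> b" "\<phi> b \<le> 0" for a b
    using mono[OF that(1)] \<phi>(2)[of "\<bar>a\<bar>"] that(2) by (simp add: J_def)
  have "J = {0} \<or> J = UNIV"
  proof (rule irreducible_individual)
    show "closed J" unfolding closed_sequential_limits
    proof (intro allI impI, elim conjE)
      fix X l assume X: "\<forall>n::nat. X n \<in> J" "X \<longlonglongrightarrow> l"
      have "(\<lambda>n. \<phi> \<bar>X n\<bar>) \<longlonglongrightarrow> \<phi> \<bar>l\<bar>"
        by (intro \<phi>.tendsto tendsto_abs_lattice X)
      then show "l \<in> J" using X(1) by (simp add: J_def LIMSEQ_const_iff)
    qed
    show "subspace J" unfolding subspace_def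
    proof (intro conjI allI ballI)
      show "a + b \<in> J" if "a \<in> J" "b \<in> J" for a b
        using that by (intro JI[OF abs_triangle_ineq]) (simp add: J_def \<phi>.add)
      show "c *\<^sub>R a \<in> J" if "a \<in> J" for a c
        using that by (simp add: J_def abs_scaleR_lattice \<phi>.scaleR)
    qed (simp add: J_def \<phi>.zero)
    show "solid J" unfolding solid_def
      by (auto simp: J_def intro: JI[unfolded J_def mem_Collect_eq])
    fix a assume a: "a \<in> J"
    obtain t\<^sub>0 where t: "0 \<le> t\<^sub>0" "\<And>t. t\<^sub>0 \<le> t \<Longrightarrow> \<bar>T t a\<bar> \<le> T t \<bar>a\<bar>" by (rule eventually_abs_le) blast
    have "T t a \<in> J" if "t\<^sub>0 \<le> t" for t
      using t(1) that a by (intro JI[OF t(2)[OF that]]) (simp add: eig J_def)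
    then show "\<exists>t\<^sub>0\<ge>0. \<forall>t\<ge>t\<^sub>0. T t a \<in> J" using t(1) by blast
  qed
  moreover have "y \<notin> J" using \<phi>(3) abs by (auto simp: J_def)
  moreover have "x \<in> J" using x by (simp add: J_def)
  ultimately show ?thesis by auto
qed

text \<open>For \<open>0 \<le> x \<le> u\<close>, late orbit values lie between 0 and
  \<open>exp (s * t) *\<^sub>R u\<close>, hence in the principal ideal. Once the waiting time is
  uniform, the closure of this ideal is an invariant closed ideal containing
  \<open>u\<close>.\<close>

lemma eigenvector_quasi_interior:
  assumes u: "0 \<le> u" "u \<noteq> 0" and eig: "\<And>t. 0 \<le> t \<Longrightarrow> T t u = exp (s * t) *\<^sub>R u"
  shows "closure {x. \<exists>c>0. \<bar>x\<bar> \<le> c *\<^sub>R u} = UNIV"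
proof -
  define E where "E = {x. \<exists>c>0. \<bar>x\<bar> \<le> c *\<^sub>R u}"
  have EI: "x \<in> E" if "\<bar>x\<bar> \<le> c *\<^sub>R u" for x c
  proof -
    have "c *\<^sub>R u \<le> max c 1 *\<^sub>R u" using u(1) by (intro scaleR_right_mono) auto
    then have "\<bar>x\<bar> \<le> max c 1 *\<^sub>R u" "max c 1 > 0" using that by auto
    then show ?thesis unfolding E_def by blast
  qed
  have subE: "subspace E" unfolding subspace_def
  proof (intro conjI ballI allI)
    show "0 \<in> E" using EI[of 0 0] by simp
    fix x y assume "x \<in> E" "y \<in> E"
    then obtain c d where "\<bar>x\<bar> \<le> c *\<^sub>R u" "\<bar>y\<bar> \<le> d *\<^sub>R u" by (auto simp: E_def)
    then have "\<bar>x + y\<bar> \<le> (c + d) *\<^sub>R u"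
      using order_trans[OF abs_triangle_ineq add_mono] by (simp add: scaleR_add_left)
    then show "x + y \<in> E" by (rule EI)
  next
    fix a x assume "x \<in> E"
    then obtain c where "\<bar>x\<bar> \<le> c *\<^sub>R u" by (auto simp: E_def)
    then have "\<bar>a *\<^sub>R x\<bar> \<le> \<bar>a\<bar> *\<^sub>R c *\<^sub>R u"
      unfolding abs_scaleR_lattice by (intro scaleR_left_mono) auto
    then show "a *\<^sub>R x \<in> E" by (intro EI) simp
  qed
  have solE: "solid E" unfolding solid_def
    by (auto simp: E_def intro: order_trans)
  \<comment> \<open>The principal ideal need not be closed, so Baire's theorem is applied to the
    closed order interval from 0 to \<open>u\<close>, whose multiples generate the ideal.\<close>
  define S where "S = {x. 0 \<le> x \<and> x \<le> u}"
  define F where "F n = (\<Inter>t\<in>{real n..}. {x. 0 \<le> T t x \<and> T t x \<le> exp (s * t) *\<^sub>R u})" for n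
  have clS: "closed {x. a \<le> x \<and> x \<le> b}" for a b :: 'a
  proof -
    have "closed ((\<lambda>x. x - a) -` {x. 0 \<le> x} \<inter> (\<lambda>x. b - x) -` {x. 0 \<le> x})"
      by (intro closed_Int continuous_closed_vimage[OF closed_nonneg] continuous_intros)
    then show ?thesis by (simp add: vimage_def Collect_conj_eq)
  qed
  have cl: "closed (F n)" for n
  proof -
    have "closed (T t -` {x. 0 \<le> x \<and> x \<le> exp (s * t) *\<^sub>R u})" if "0 \<le> t" for t
      by (intro continuous_closed_vimage[OF clS] linear_continuous_at bounded_linear_T that)
    then show ?thesis unfolding F_def by (intro closed_INT) (auto simp: vimage_def)
  qed
  have cover: "S \<subseteq> (\<Union>n. F n)"
  proof
    fix x assume "x \<in> S"
    then have x: "0 \<le> x" "x \<le> u" by (auto simp: S_def)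
    obtain a where a: "0 \<le> a" "\<forall>t\<ge>a. 0 \<le> T t x" using eventually_pos[OF x(1)] by blast
    obtain b where b: "0 \<le> b" "\<And>t. b \<le> t \<Longrightarrow> T t x \<le> T t u" using eventually_T_mono[OF x(2)] by blast
    obtain n where "max a b \<le> real n" using real_arch_simple by blast
    then have "x \<in> F n" using a b eig by (auto simp: F_def)
    then show "x \<in> (\<Union>n. F n)" by blast
  qed
  have conv: "convex S" unfolding convex_def
  proof (intro ballI allI impI)
    fix x y and a b :: real assume *: "x \<in> S" "y \<in> S" "0 \<le> a" "0 \<le> b" "a + b = 1"
    have "a *\<^sub>R x + b *\<^sub>R y \<le> a *\<^sub>R u + b *\<^sub>R u"
      using * by (intro add_mono scaleR_left_mono) (auto simp: S_def)
    also have "\<dots> = u" using * by (simp add: scaleR_add_left[symmetric])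
    finally show "a *\<^sub>R x + b *\<^sub>R y \<in> S"
      using * by (auto simp: S_def intro!: add_nonneg_nonneg scaleR_nonneg_nonneg)
  qed
  have ne: "S \<noteq> {}" using u by (auto simp: S_def)
  obtain n x0 where x0: "x0 \<in> S" "x0 \<in> F n"
    "\<And>x. x \<in> S \<Longrightarrow> \<exists>d. 0 < d \<and> d \<le> 1 \<and> x0 + d *\<^sub>R (x - x0) \<in> F n"
    using Baire_convex_cover[OF clS[of 0 u, folded S_def] ne conv cl cover] by blast
  have FE: "T t x \<in> E" if "x \<in> F n" "real n \<le> t" for x t
    using that by (intro EI[of _ "exp (s * t)"]) (auto simp: F_def)
  have invS: "T t x \<in> E" if t: "real n \<le> t" and x: "x \<in> S" for t x
  proof -
    have t0: "0 \<le> t" using t by simp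
    obtain d where d: "0 < d" "x0 + d *\<^sub>R (x - x0) \<in> F n" using x0(3)[OF x] by blast
    have "T t x0 + inverse d *\<^sub>R (T t (x0 + d *\<^sub>R (x - x0)) - T t x0) \<in> E"
      using FE[OF d(2) t] FE[OF x0(2) t] by (intro subspace_add subspace_scale subspace_diff subE)
    then show ?thesis using d(1) t0 by (simp add: T_plus T_diff T_scaleR)
  qed
  have invE: "T t x \<in> E" if t: "real n \<le> t" and x: "x \<in> E" for t x
  proof -
    have t0: "0 \<le> t" using t by simp
    obtain c where c: "c > 0" "\<bar>x\<bar> \<le> c *\<^sub>R u" using x by (auto simp: E_def)
    \<comment> \<open>The uniform waiting time passes from the order interval to the ideal by
      scaling, applied to the positive and the negative part separately.\<close>
    have part: "T t y \<in> E" if y: "0 \<le> y" "y \<le> c *\<^sub>R u" for y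
    proof -
      have "inverse c *\<^sub>R y \<le> inverse c *\<^sub>R c *\<^sub>R u" using y c by (intro scaleR_left_mono) auto
      then have "inverse c *\<^sub>R y \<in> S" using y c by (simp add: S_def scaleR_nonneg_nonneg)
      then have "T t (inverse c *\<^sub>R y) \<in> E" by (rule invS[OF t])
      then have "c *\<^sub>R T t (inverse c *\<^sub>R y) \<in> E" by (rule subspace_scale[OF subE])
      then show ?thesis using c t0 by (simp add: T_scaleR)
    qed
    have "pprt x \<le> \<bar>x\<bar>" "- nprt x \<le> \<bar>x\<bar>" by (simp_all add: abs_prts)
    then have "T t (pprt x) \<in> E" "T t (- nprt x) \<in> E"
      using c(2) by (auto intro!: part)
    then have "T t (pprt x) - T t (- nprt x) \<in> E" by (rule subspace_diff[OF subE])
    also have "T t (pprt x) - T t (- nprt x) = T t (pprt x - - nprt x)"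
      using t0 by (simp only: T_diff)
    also have "pprt x - - nprt x = x" using prts[of x] by simp
    finally show ?thesis .
  qed
  have "closure E = {0} \<or> closure E = UNIV"
  proof (rule irreducible[of _ "real n"])
    show "subspace (closure E)" unfolding subspace_def
    proof (intro conjI ballI allI)
      show "0 \<in> closure E" using subspace_0[OF subE] closure_subset by blast
    next
      fix x y assume "x \<in> closure E" "y \<in> closure E"
      then obtain X Y where XY: "\<And>n::nat. X n \<in> E" "X \<longlonglongrightarrow> x" "\<And>n. Y n \<in> E" "Y \<longlonglongrightarrow> y"
        unfolding closure_sequential by blast
      then have "(\<lambda>n. X n + Y n) \<longlonglongrightarrow> x + y" "\<And>n. X n + Y n \<in> E"
        by (auto intro: tendsto_add subspace_add[OF subE])
      then show "x + y \<in> closure E" unfolding closure_sequential by (intro exI[of _ "\<lambda>n. X n + Y n"]) auto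
    next
      fix x and c :: real assume "x \<in> closure E"
      then obtain X where X: "\<And>n::nat. X n \<in> E" "X \<longlonglongrightarrow> x" unfolding closure_sequential by blast
      then have "(\<lambda>n. c *\<^sub>R X n) \<longlonglongrightarrow> c *\<^sub>R x" "\<And>n. c *\<^sub>R X n \<in> E"
        by (auto intro: tendsto_intros subspace_scale[OF subE])
      then show "c *\<^sub>R x \<in> closure E" unfolding closure_sequential by (intro exI[of _ "\<lambda>n. c *\<^sub>R X n"]) auto
    qed
    show "solid (closure E)" unfolding solid_def
    proof (intro allI impI)
      fix f g assume "g \<in> closure E" and fg: "\<bar>f\<bar> \<le> \<bar>g\<bar>"
      then obtain X where X: "\<And>n::nat. X n \<in> E" "X \<longlonglongrightarrow> g" unfolding closure_sequential by blast
      \<comment> \<open>This is \<open>f\<close> truncated between the negative and the positive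
        modulus of \<open>X n\<close>. The truncations stay in the solid set \<open>E\<close> and
        converge to the truncation of \<open>f\<close> by the modulus of \<open>g\<close>, which is
        \<open>f\<close> itself.\<close>
      define Y where "Y n = sup (- \<bar>X n\<bar>) (inf f \<bar>X n\<bar>)" for n
      have "Y \<longlonglongrightarrow> sup (- \<bar>g\<bar>) (inf f \<bar>g\<bar>)"
        unfolding Y_def by (intro tendsto_sup_lattice tendsto_inf_lattice tendsto_minus
            tendsto_abs_lattice X tendsto_const)
      also have "sup (- \<bar>g\<bar>) (inf f \<bar>g\<bar>) = f"
        using fg by (simp add: inf_absorb1 sup_absorb2 abs_le_iff minus_le_iff)
      finally have "Y \<longlonglongrightarrow> f" .
      moreover have "Y n \<in> E" for n
      proof -
        have "\<bar>Y n\<bar> \<le> \<bar>X n\<bar>"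
        proof (rule abs_leI)
          show "Y n \<le> \<bar>X n\<bar>" unfolding Y_def
            by (intro le_supI) (auto intro: order_trans[of _ 0])
          have "- \<bar>X n\<bar> \<le> Y n" unfolding Y_def by (rule sup_ge1)
          then show "- Y n \<le> \<bar>X n\<bar>" by (simp add: minus_le_iff)
        qed
        then show ?thesis using solE X(1)[of n] unfolding solid_def by blast
      qed
      ultimately show "f \<in> closure E" unfolding closure_sequential by blast
    qed
    fix t x assume t: "real n \<le> t" and "x \<in> closure E"
    then obtain X where X: "\<And>n::nat. X n \<in> E" "X \<longlonglongrightarrow> x" unfolding closure_sequential by blast
    have "(\<lambda>n. T t (X n)) \<longlonglongrightarrow> T t x" using t X by (intro T_tendsto) auto
    then show "T t x \<in> closure E"
      unfolding closure_sequential using invE[OF t X(1)] by (intro exI[of _ "\<lambda>n. T t (X n)"]) auto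
  qed simp_all
  moreover have "u \<in> closure E" using EI[of u 1] u closure_subset by auto
  ultimately show ?thesis using u(2) unfolding E_def by auto
qed

text \<open>The eigenspace is totally ordered since the positive and the negative part of an eigenvector
  are disjoint eigenvectors, which cannot both be quasi-interior.\<close>

theorem eigenspace_one_dimensional:
  assumes \<phi>: "bounded_linear \<phi>" "\<And>x. 0 \<le> x \<Longrightarrow> 0 \<le> \<phi> x" "\<phi> y \<noteq> (0::real)"
    and eig: "\<And>t x. 0 \<le> t \<Longrightarrow> \<phi> (T t x) = exp (s * t) * \<phi> x"
    and w: "w \<noteq> 0" "\<And>t. 0 \<le> t \<Longrightarrow> T t w = exp (s * t) *\<^sub>R w"
  obtains u where "0 \<le> u" "\<phi> u = 1" "\<And>t. 0 \<le> t \<Longrightarrow> T t u = exp (s * t) *\<^sub>R u"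
    "closure {x. \<exists>c>0. \<bar>x\<bar> \<le> c *\<^sub>R u} = UNIV"
    "\<And>v. (\<And>t. 0 \<le> t \<Longrightarrow> T t v = exp (s * t) *\<^sub>R v) \<Longrightarrow> v = \<phi> v *\<^sub>R u"
proof -
  interpret \<phi>: bounded_linear \<phi> by (rule \<phi>(1))
  note strict = eigenfunctional_strictly_positive[OF \<phi> eig]
  define V where "V = {v. \<forall>t\<ge>0. T t v = exp (s * t) *\<^sub>R v}"
  have V_diff: "v - v' \<in> V" if "v \<in> V" "v' \<in> V" for v v'
    using that by (simp add: V_def T_diff scaleR_diff_right)
  have V_plus: "v + v' \<in> V" if "v \<in> V" "v' \<in> V" for v v'
    using that by (simp add: V_def T_plus scaleR_add_right)
  have V_scaleR: "c *\<^sub>R v \<in> V" if "v \<in> V" for v c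
    using that by (simp add: V_def T_scaleR)
  have V_abs: "\<bar>v\<bar> \<in> V" if v: "v \<in> V" for v
  proof -
    obtain t\<^sub>0 where t: "0 \<le> t\<^sub>0" "\<And>t. t\<^sub>0 \<le> t \<Longrightarrow> \<bar>T t v\<bar> \<le> T t \<bar>v\<bar>" by (rule eventually_abs_le) blast
    have ev: "T t \<bar>v\<bar> = exp (s * t) *\<^sub>R \<bar>v\<bar>" if "t\<^sub>0 \<le> t" for t
    proof -
      have "0 \<le> t" using t that by simp
      then have "0 \<le> T t \<bar>v\<bar> - exp (s * t) *\<^sub>R \<bar>v\<bar>"
        using t(2)[OF that] v by (simp add: V_def abs_scaleR_lattice)
      moreover have "\<phi> (T t \<bar>v\<bar> - exp (s * t) *\<^sub>R \<bar>v\<bar>) = 0"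
        using \<open>0 \<le> t\<close> by (simp add: \<phi>.diff \<phi>.scaleR eig)
      ultimately show ?thesis using strict by fastforce
    qed
    have "T t \<bar>v\<bar> = exp (s * t) *\<^sub>R \<bar>v\<bar>" if "0 \<le> t" for t
    proof -
      \<comment> \<open>The equation is known only after \<open>t\<^sub>0\<close>. Evaluating the
        orbit at \<open>t + t\<^sub>0\<close> in two ways and cancelling the factor for
        \<open>t\<^sub>0\<close> gives it at every earlier time.\<close>
      have "exp (s * t\<^sub>0) *\<^sub>R T t \<bar>v\<bar> = T (t + t\<^sub>0) \<bar>v\<bar>"
        using ev[of t\<^sub>0] that t(1) by (simp add: T_add T_scaleR[symmetric])
      also have "\<dots> = exp (s * t\<^sub>0) *\<^sub>R exp (s * t) *\<^sub>R \<bar>v\<bar>"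
        using ev[of "t + t\<^sub>0"] that by (simp add: distrib_left exp_add mult.commute)
      finally show ?thesis by (simp del: scaleR_scaleR)
    qed
    then show ?thesis by (simp add: V_def)
  qed
  have V_prts: "pprt v \<in> V" "- nprt v \<in> V" if "v \<in> V" for v
    unfolding pprt_eq_abs nprt_eq_abs using that by (auto intro!: V_scaleR V_plus V_diff V_abs)
  have qi: "closure {x. \<exists>c>0. \<bar>x\<bar> \<le> c *\<^sub>R v} = UNIV" if "v \<in> V" "0 \<le> v" "v \<noteq> 0" for v
    using that by (intro eigenvector_quasi_interior[of v s]) (auto simp: V_def)
  have ordered: "0 \<le> v \<or> v \<le> 0" if v: "v \<in> V" for v
  proof (cases "pprt v = 0")
    case True
    then show ?thesis by (simp add: le_zero_iff_zero_pprt)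
  next
    case False
    define n where "n = - nprt v"
    have n: "0 \<le> n" "inf (pprt v) n = 0" by (simp_all add: n_def inf_pprt_nprt)
    have "n \<in> closure {x. \<exists>c>0. \<bar>x\<bar> \<le> c *\<^sub>R pprt v}"
      using qi[OF V_prts(1)[OF v]] False by simp
    then obtain X where X: "\<And>k::nat. X k \<in> {x. \<exists>c>0. \<bar>x\<bar> \<le> c *\<^sub>R pprt v}" "X \<longlonglongrightarrow> n"
      unfolding closure_sequential by blast
    \<comment> \<open>Every element of the ideal generated by the positive part is disjoint from
      \<open>n\<close>. In the limit \<open>n\<close> is disjoint from itself, hence zero.\<close>
    have "inf \<bar>X k\<bar> n = 0" for k
    proof -
      obtain c where c: "c > 0" "\<bar>X k\<bar> \<le> c *\<^sub>R pprt v" using X(1)[of k] by blast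
      have "inf \<bar>X k\<bar> n \<le> inf (c *\<^sub>R pprt v) n" using c(2) by (intro inf_mono order_refl)
      also have "\<dots> = 0" by (rule inf_scaleR_eq_0[OF n(2) c(1)])
      finally show ?thesis using n(1) by (intro antisym) auto
    qed
    moreover have "(\<lambda>k. inf \<bar>X k\<bar> n) \<longlonglongrightarrow> inf \<bar>n\<bar> n"
      by (intro tendsto_inf_lattice tendsto_abs_lattice X tendsto_const)
    ultimately have "n = 0" using n(1) by (simp add: LIMSEQ_const_iff)
    then show ?thesis by (simp add: n_def zero_le_iff_zero_nprt)
  qed
  define u where "u = inverse (\<phi> \<bar>w\<bar>) *\<^sub>R \<bar>w\<bar>"
  have "w \<in> V" using w by (simp add: V_def)
  have "\<phi> \<bar>w\<bar> \<noteq> 0" using strict[of "\<bar>w\<bar>"] w(1) by auto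
  then have pos: "\<phi> \<bar>w\<bar> > 0" using \<phi>(2)[of "\<bar>w\<bar>"] by simp
  have u: "0 \<le> u" "\<phi> u = 1" using pos by (simp_all add: u_def \<phi>.scaleR scaleR_nonneg_nonneg)
  then have "u \<noteq> 0" by (auto simp: \<phi>.zero)
  have uV: "u \<in> V" unfolding u_def using \<open>w \<in> V\<close> by (intro V_scaleR V_abs)
  show thesis
  proof (rule that[OF u])
    show "T t u = exp (s * t) *\<^sub>R u" if "0 \<le> t" for t using uV that by (simp add: V_def)
    show "closure {x. \<exists>c>0. \<bar>x\<bar> \<le> c *\<^sub>R u} = UNIV" by (rule qi[OF uV u(1) \<open>u \<noteq> 0\<close>])
    fix v assume "\<And>t. 0 \<le> t \<Longrightarrow> T t v = exp (s * t) *\<^sub>R v"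
    then have "v \<in> V" by (simp add: V_def)
    \<comment> \<open>An eigenvector in the kernel of \<open>\<phi>\<close>: being ordered with
      respect to 0, it vanishes by strict positivity applied to \<open>z\<close> or
      \<open>- z\<close>.\<close>
    define z where "z = v - \<phi> v *\<^sub>R u"
    have "z \<in> V" unfolding z_def by (intro V_diff V_scaleR \<open>v \<in> V\<close> uV)
    moreover have "\<phi> z = 0" using u(2) by (simp add: z_def \<phi>.diff \<phi>.scaleR)
    ultimately have "z = 0" using strict[of z] strict[of "- z"] ordered[of z] by (auto simp: \<phi>.neg)
    then show "v = \<phi> v *\<^sub>R u" by (simp add: z_def)
  qed
qed

end

section \<open>The resolvent near the spectral bound\<close>

locale real_ev_pos_resolvent = real_ev_pos_semigroup +
  fixes s :: real and R :: "real \<Rightarrow> 'a \<Rightarrow> 'a"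
  assumes res_R: "s < l \<Longrightarrow> res l (R l)"
begin

lemma bounded_linear_R: "s < l \<Longrightarrow> bounded_linear (R l)"
  using res_R by (rule res_bounded_linear)

lemma R_linear:
  assumes "s < l"
  shows R_plus: "R l (x + y) = R l x + R l y" and R_diff: "R l (x - y) = R l x - R l y"
    and R_scaleR: "R l (c *\<^sub>R x) = c *\<^sub>R R l x" and R_minus: "R l (- x) = - R l x"
proof -
  interpret bounded_linear "R l" by (rule bounded_linear_R[OF assms])
  show "R l (x + y) = R l x + R l y" "R l (x - y) = R l x - R l y"
    "R l (c *\<^sub>R x) = c *\<^sub>R R l x" "R l (- x) = - R l x"
    by (simp_all add: add diff scaleR neg)
qed

text \<open>Eventual positivity moves each positive vector into this cone after some time. Unlike
  the positive cone, it is mapped into itself by every \<open>T t\<close>, which makes it suitable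
  for an induction over resolvent points.\<close>

definition pos_orbits :: "'a set" where
  "pos_orbits = {x. \<forall>t\<ge>0. 0 \<le> T t x}"

lemma closed_pos_orbits: "closed pos_orbits"
proof -
  have "closed (T t -` {x. 0 \<le> x})" if "0 \<le> t" for t
    by (intro continuous_closed_vimage[OF closed_nonneg] linear_continuous_at bounded_linear_T that)
  then have "closed (\<Inter>t\<in>{0..}. T t -` {x. 0 \<le> x})" by (intro closed_INT) auto
  also have "(\<Inter>t\<in>{0..}. T t -` {x. 0 \<le> x}) = pos_orbits" by (auto simp: pos_orbits_def)
  finally show ?thesis .
qed

lemma pos_orbits_add: "x \<in> pos_orbits \<Longrightarrow> y \<in> pos_orbits \<Longrightarrow> x + y \<in> pos_orbits"
  and pos_orbits_scaleR: "x \<in> pos_orbits \<Longrightarrow> 0 \<le> c \<Longrightarrow> c *\<^sub>R x \<in> pos_orbits"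
  by (auto simp: pos_orbits_def T_plus T_scaleR scaleR_nonneg_nonneg)

text \<open>Beyond the exponential growth rate the remainder in the finite-time identity vanishes as
  time grows, so \<open>R l x\<close> is a limit of positive integrals. Commuting \<open>R l\<close>
  with \<open>T t\<close> extends positivity to the whole orbit.\<close>

lemma res_pos_orbits_large:
  obtains b where "s < b" "\<And>l x. b < l \<Longrightarrow> x \<in> pos_orbits \<Longrightarrow> R l x \<in> pos_orbits"
proof -
  obtain M \<omega> where M: "0 < M" "0 \<le> \<omega>"
    "\<And>t x. 0 \<le> t \<Longrightarrow> norm (T t x) \<le> M * exp (\<omega> * t) * norm x"
    by (rule exponentially_bounded) blast
  have nn: "0 \<le> R l x" if l: "max \<omega> (s + 1) < l" and x: "x \<in> pos_orbits" for l x
  proof -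
    have sl: "s < l" using l by simp
    define I where "I t = integral {0..t} (\<lambda>r. exp (- l * r) *\<^sub>R T r x)" for t
    have I: "0 \<le> I t" if "0 \<le> t" for t
      unfolding I_def
      using x by (intro integral_nonneg_lattice integrable_exp_T scaleR_nonneg_nonneg)
        (auto simp: pos_orbits_def)
    have "((\<lambda>t. M * norm (R l x) * exp ((\<omega> - l) * t)) \<longlongrightarrow> 0) at_top"
    proof -
      have "filterlim (\<lambda>t. (\<omega> - l) * t) at_bot at_top"
        using l by (intro filterlim_tendsto_neg_mult_at_bot[OF tendsto_const _ filterlim_ident]) auto
      then have "((\<lambda>t. exp ((\<omega> - l) * t)) \<longlongrightarrow> 0) at_top"
        by (rule filterlim_compose[OF exp_at_bot])
      then show ?thesis by (rule tendsto_mult_right_zero)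
    qed
    then have "((\<lambda>t. exp (- l * t) *\<^sub>R T t (R l x)) \<longlongrightarrow> 0) at_top"
    proof (rule Lim_null_comparison[rotated])
      show "\<forall>\<^sub>F t in at_top. norm (exp (- l * t) *\<^sub>R T t (R l x)) \<le> M * norm (R l x) * exp ((\<omega> - l) * t)"
        using eventually_ge_at_top[of 0]
      proof eventually_elim
        case (elim t)
        have "exp (- l * t) * norm (T t (R l x)) \<le> exp (- l * t) * (M * exp (\<omega> * t) * norm (R l x))"
          using M(3)[OF elim] by (intro mult_left_mono) auto
        also have "\<dots> = M * norm (R l x) * (exp (- l * t) * exp (\<omega> * t))" by simp
        also have "exp (- l * t) * exp (\<omega> * t) = exp ((\<omega> - l) * t)"
          by (simp add: exp_add[symmetric] algebra_simps)
        finally show ?case by simp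
      qed
    qed
    from tendsto_diff[OF tendsto_const this, of "R l x"]
    have "((\<lambda>t. R l x - exp (- l * t) *\<^sub>R T t (R l x)) \<longlongrightarrow> R l x) at_top" by simp
    moreover have "\<forall>\<^sub>F t in at_top. 0 \<le> R l x - exp (- l * t) *\<^sub>R T t (R l x)"
      using eventually_ge_at_top[of 0]
    proof eventually_elim
      case (elim t)
      have "R l x - exp (- l * t) *\<^sub>R T t (R l x) = I t"
        using res_integral[OF res_R[OF sl] elim, of x] res_T[OF res_R[OF sl] elim, of x]
        by (simp add: I_def diff_eq_eq)
      then show ?case using I[OF elim] by simp
    qed
    ultimately show ?thesis by (rule tendsto_nonneg) simp
  qed
  show thesis
  proof (rule that[of "max \<omega> (s + 1)"])
    fix l x assume l: "max \<omega> (s + 1) < l" and x: "x \<in> pos_orbits"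
    have "0 \<le> T t (R l x)" if t: "0 \<le> t" for t
    proof -
      have "T t x \<in> pos_orbits" using x t by (auto simp: pos_orbits_def T_add[symmetric])
      then have "0 \<le> R l (T t x)" by (rule nn[OF l])
      then show ?thesis using l by (simp add: res_T[OF res_R t])
    qed
    then show "R l x \<in> pos_orbits" by (simp add: pos_orbits_def)
  qed simp
qed

text \<open>A step of the descent towards \<open>s\<close>: \<open>R m x\<close> is the fixed point of the contraction
  \<open>y \<mapsto> R l x + (l - m) R l y\<close>, which preserves the cone.\<close>

lemma res_pos_orbits_step:
  assumes l: "s < m" "m \<le> l" and K: "\<And>y. norm (R l y) \<le> K * norm y" "(l - m) * K \<le> 1 / 2"
    and cone: "\<And>x. x \<in> pos_orbits \<Longrightarrow> R l x \<in> pos_orbits" and x: "x \<in> pos_orbits"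
  shows "R m x \<in> pos_orbits"
proof -
  have sl: "s < l" using l by simp
  define f where "f y = R l x + (l - m) *\<^sub>R R l y" for y
  define Y where "Y n = (f ^^ n) 0" for n
  have fix_eq: "R m x = f (R m x)"
    unfolding f_def by (rule res_identity[OF res_R[OF sl] res_R[OF l(1)]])
  have YC: "Y n \<in> pos_orbits" for n
  proof (induction n)
    case (Suc n)
    have "f (Y n) \<in> pos_orbits"
      unfolding f_def using l by (intro pos_orbits_add pos_orbits_scaleR cone x Suc) auto
    then show ?case by (simp add: Y_def)
  qed (simp add: Y_def pos_orbits_def T_zero)
  have est: "norm (Y n - R m x) \<le> (1 / 2) ^ n * norm (R m x)" for n
  proof (induction n)
    case (Suc n)
    have "Y (Suc n) - R m x = f (Y n) - f (R m x)" using fix_eq by (simp add: Y_def)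
    also have "\<dots> = (l - m) *\<^sub>R R l (Y n - R m x)" by (simp add: f_def R_diff[OF sl] algebra_simps)
    finally have "norm (Y (Suc n) - R m x) = (l - m) * norm (R l (Y n - R m x))" using l by simp
    also have "\<dots> \<le> (l - m) * (K * norm (Y n - R m x))" using l by (intro mult_left_mono K) auto
    also have "\<dots> = (l - m) * K * norm (Y n - R m x)" by simp
    also have "\<dots> \<le> 1 / 2 * norm (Y n - R m x)" by (intro mult_right_mono K) auto
    also have "\<dots> \<le> 1 / 2 * ((1 / 2) ^ n * norm (R m x))" by (intro mult_left_mono Suc) auto
    finally show ?case by simp
  qed (simp add: Y_def)
  have "(\<lambda>n. (1 / 2) ^ n * norm (R m x)) \<longlonglongrightarrow> 0"
    by (intro tendsto_mult_left_zero LIMSEQ_power_zero) simp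
  then have "(\<lambda>n. Y n - R m x) \<longlonglongrightarrow> 0"
    by (rule Lim_null_comparison[rotated]) (use est in auto)
  then have "Y \<longlonglongrightarrow> R m x" by (rule LIM_zero_cancel)
  then show ?thesis using closed_pos_orbits YC unfolding closed_sequential_limits by blast
qed

text \<open>The norm of \<open>R l\<close> may grow as \<open>l\<close> decreases, so no step length
  works everywhere. It suffices to step once past the supremum \<open>a\<close> of the points where
  the cone is not preserved; \<open>a\<close> still exceeds \<open>s\<close>, so \<open>R a\<close>
  is bounded.\<close>

lemma res_pos_orbits:
  assumes "s < l" "x \<in> pos_orbits"
  shows "R l x \<in> pos_orbits"
proof (rule ccontr)
  assume no: "R l x \<notin> pos_orbits"
  define B where "B = {m. s < m \<and> \<not> (\<forall>x\<in>pos_orbits. R m x \<in> pos_orbits)}"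
  obtain b where b: "s < b" "\<And>l x. b < l \<Longrightarrow> x \<in> pos_orbits \<Longrightarrow> R l x \<in> pos_orbits"
    by (rule res_pos_orbits_large) blast
  have "m \<le> b" if "m \<in> B" for m
    using that b(2)[of m] by (auto simp: B_def not_less[symmetric])
  then have bdd: "bdd_above B" by (auto simp: bdd_above_def)
  have lB: "l \<in> B" using assms no by (auto simp: B_def)
  define a where "a = Sup B"
  have a: "l \<le> a" unfolding a_def by (intro cSup_upper lB bdd)
  then have sa: "s < a" using assms by simp
  interpret Ra: bounded_linear "R a" by (rule bounded_linear_R[OF sa])
  obtain K where K: "K > 0" "\<And>y. norm (R a y) \<le> norm y * K" using Ra.pos_bounded by blast
  \<comment> \<open>With \<open>(c - a) * K = 1 / 8\<close> the resolvent identity bounds the norm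
    of \<open>R c\<close> by \<open>2 * K\<close>. From \<open>c\<close>, where the cone is
    preserved, a point \<open>m\<close> above \<open>a - 1 / (8 * K)\<close> is less than
    \<open>2 / (8 * K)\<close> away, which gives the contraction factor
    \<open>1 / 2\<close>.\<close>
  define c where "c = a + 1 / (8 * K)"
  have ca: "a < c" "(c - a) * K = 1 / 8" using K(1) by (simp_all add: c_def)
  have sc: "s < c" using sa ca by simp
  have Kc: "norm (R c y) \<le> 2 * K * norm y" for y
  proof -
    have "R c y = R a y + (a - c) *\<^sub>R R a (R c y)" by (rule res_identity[OF res_R[OF sa] res_R[OF sc]])
    then have "norm (R c y) \<le> norm (R a y) + norm ((a - c) *\<^sub>R R a (R c y))"
      by (metis norm_triangle_ineq)
    also have "norm ((a - c) *\<^sub>R R a (R c y)) = (c - a) * norm (R a (R c y))" using ca by simp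
    also have "\<dots> \<le> (c - a) * (norm (R c y) * K)" using ca by (intro mult_left_mono K) auto
    also have "\<dots> = (c - a) * K * norm (R c y)" by simp
    also have "\<dots> = norm (R c y) / 8" by (simp add: ca)
    finally have "norm (R c y) \<le> norm y * K + norm (R c y) / 8" using K(2)[of y] by simp
    moreover have "0 \<le> norm y * K" using K(1) by simp
    ultimately have "norm (R c y) \<le> 2 * (norm y * K)" by linarith
    then show ?thesis by (simp add: ac_simps)
  qed
  have "c \<notin> B" using cSup_upper[OF _ bdd, of c] ca(1) by (auto simp: a_def)
  then have cone: "R c x \<in> pos_orbits" if "x \<in> pos_orbits" for x using that sc by (auto simp: B_def)
  have "m \<le> a - 1 / (8 * K)" if m: "m \<in> B" for m
  proof (rule ccontr)
    assume "\<not> ?thesis"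
    then have "(c - m) * (2 * K) \<le> (2 / (8 * K)) * (2 * K)"
      using K(1) by (intro mult_right_mono) (auto simp: c_def)
    also have "\<dots> = 1 / 2" using K(1) by simp
    finally have "(c - m) * (2 * K) \<le> 1 / 2" .
    moreover have "m \<le> c" using cSup_upper[OF m bdd] ca(1) by (simp add: a_def)
    moreover have "s < m" using m by (simp add: B_def)
    ultimately have "\<forall>x\<in>pos_orbits. R m x \<in> pos_orbits"
      using res_pos_orbits_step[OF _ _ Kc _ cone] by blast
    then show False using m by (simp add: B_def)
  qed
  then have "a \<le> a - 1 / (8 * K)" unfolding a_def using lB by (intro cSup_least) auto
  then show False using K(1) by simp
qed

text \<open>After the waiting time \<open>t\<close> of \<open>x\<close>, the vector
  \<open>T t x\<close> has a positive orbit, so the resolvent term of the finite-time identity is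
  positive. The error \<open>e l\<close> is the remaining truncated integral.\<close>

lemma res_lower_bound:
  assumes "0 \<le> x"
  obtains K e where "0 \<le> K" "\<And>l. s < l \<Longrightarrow> l < s + 1 \<Longrightarrow> norm (e l) \<le> K"
    "\<And>l. s < l \<Longrightarrow> l < s + 1 \<Longrightarrow> e l \<le> R l x"
proof -
  obtain t where t: "0 \<le> t" "\<forall>r\<ge>t. 0 \<le> T r x" using eventually_pos[OF assms] by blast
  have "T t x \<in> pos_orbits" using t by (auto simp: pos_orbits_def T_add[symmetric])
  then have pos: "0 \<le> R l (T t x)" if "s < l" for l
    using res_pos_orbits[OF that] T_0 by (force simp: pos_orbits_def)
  obtain K where K: "0 \<le> K"
    "\<And>l Q. \<bar>l\<bar> \<le> \<bar>s\<bar> + 1 \<Longrightarrow> res l Q \<Longrightarrow> norm (Q x - exp (- l * t) *\<^sub>R Q (T t x)) \<le> K"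
    by (rule res_bounded_error[OF t(1), of "\<bar>s\<bar> + 1" x]) blast
  show thesis
  proof (rule that[OF K(1), of "\<lambda>l. R l x - exp (- l * t) *\<^sub>R R l (T t x)"])
    fix l assume l: "s < l" "l < s + 1"
    show "norm (R l x - exp (- l * t) *\<^sub>R R l (T t x)) \<le> K"
      using l by (intro K(2) res_R) auto
    show "R l x - exp (- l * t) *\<^sub>R R l (T t x) \<le> R l x"
      using pos[OF l(1)] by (simp add: scaleR_nonneg_nonneg)
  qed
qed

section \<open>Asymptotics of the scaled resolvent as l decreases to s\<close>

lemma eventually_near_s: "0 < d \<Longrightarrow> \<forall>\<^sub>F l in at_right s. s < l \<and> l < s + d"
  by (auto simp: eventually_at_right_field intro!: exI[of _ "s + d"])

lemma tendsto_power_s: "0 < m \<Longrightarrow> ((\<lambda>l. (l - s) ^ m) \<longlongrightarrow> 0) (at_right s)"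
  by (rule tendsto_eq_intros refl | simp)+

text \<open>The lower bound of \<open>R l x\<close> is bounded in norm, so a positive power of
  \<open>l - s\<close> makes it vanish: scaled resolvents are positive in the limit.\<close>

lemma scaled_res_negative_part:
  assumes "0 \<le> x" "0 < m"
  shows "((\<lambda>l. pprt (- ((l - s) ^ m *\<^sub>R R l x))) \<longlongrightarrow> 0) (at_right s)"
proof -
  obtain K e where K: "0 \<le> K" "\<And>l. s < l \<Longrightarrow> l < s + 1 \<Longrightarrow> norm (e l) \<le> K"
    "\<And>l. s < l \<Longrightarrow> l < s + 1 \<Longrightarrow> e l \<le> R l x"
    by (rule res_lower_bound[OF assms(1)]) blast
  show ?thesis
  proof (rule Lim_null_comparison)
    show "((\<lambda>l. (l - s) ^ m * K) \<longlongrightarrow> 0) (at_right s)"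
      using tendsto_power_s[OF assms(2)] by (rule tendsto_mult_left_zero)
    show "\<forall>\<^sub>F l in at_right s. norm (pprt (- ((l - s) ^ m *\<^sub>R R l x))) \<le> (l - s) ^ m * K"
      using eventually_near_s[OF zero_less_one]
    proof eventually_elim
      case (elim l)
      have p: "0 \<le> (l - s) ^ m" using elim by simp
      have "(l - s) ^ m *\<^sub>R e l \<le> (l - s) ^ m *\<^sub>R R l x"
        using elim K(3) by (intro scaleR_left_mono p) auto
      then have "pprt (- ((l - s) ^ m *\<^sub>R R l x)) \<le> pprt (- ((l - s) ^ m *\<^sub>R e l))"
        by (intro pprt_mono) simp
      then have "norm (pprt (- ((l - s) ^ m *\<^sub>R R l x))) \<le> norm (pprt (- ((l - s) ^ m *\<^sub>R e l)))"
        by (intro norm_mono_nonneg) auto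
      also have "\<dots> \<le> norm (- ((l - s) ^ m *\<^sub>R e l))" by (rule norm_pprt_le)
      also have "\<dots> = (l - s) ^ m * norm (e l)" using p by simp
      also have "\<dots> \<le> (l - s) ^ m * K" using elim K(2) by (intro mult_left_mono p) auto
      finally show ?case .
    qed
  qed
qed

text \<open>The two resolvent terms differ by a bounded truncated integral. Consequently every limit
  of scaled resolvents turns the semigroup into multiplication by
  \<open>exp (s * t)\<close>.\<close>

lemma scaled_res_T:
  assumes "0 \<le> t" "0 < m"
  shows "((\<lambda>l. (l - s) ^ m *\<^sub>R (R l (T t x) - exp (l * t) *\<^sub>R R l x)) \<longlongrightarrow> 0) (at_right s)"
proof -
  obtain K where K: "0 \<le> K"
    "\<And>l Q. \<bar>l\<bar> \<le> \<bar>s\<bar> + 1 \<Longrightarrow> res l Q \<Longrightarrow> norm (Q x - exp (- l * t) *\<^sub>R Q (T t x)) \<le> K"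
    by (rule res_bounded_error[OF assms(1), of "\<bar>s\<bar> + 1" x]) blast
  show ?thesis
  proof (rule Lim_null_comparison)
    have "((\<lambda>l. (l - s) ^ m * (exp (l * t) * K)) \<longlongrightarrow> 0 * (exp (s * t) * K)) (at_right s)"
      by (intro tendsto_mult tendsto_power_s assms(2) tendsto_exp tendsto_const tendsto_ident_at)
    then show "((\<lambda>l. (l - s) ^ m * (exp (l * t) * K)) \<longlongrightarrow> 0) (at_right s)" by simp
    show "\<forall>\<^sub>F l in at_right s. norm ((l - s) ^ m *\<^sub>R (R l (T t x) - exp (l * t) *\<^sub>R R l x))
        \<le> (l - s) ^ m * (exp (l * t) * K)"
      using eventually_near_s[OF zero_less_one]
    proof eventually_elim
      case (elim l)
      have "exp (l * t) *\<^sub>R (R l x - exp (- l * t) *\<^sub>R R l (T t x)) = - (R l (T t x) - exp (l * t) *\<^sub>R R l x)"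
        by (simp add: scaleR_diff_right exp_add[symmetric])
      then have "norm (R l (T t x) - exp (l * t) *\<^sub>R R l x)
          = exp (l * t) * norm (R l x - exp (- l * t) *\<^sub>R R l (T t x))"
        by (metis norm_minus_cancel norm_scaleR abs_exp_cancel)
      also have "\<dots> \<le> exp (l * t) * K" using elim by (intro mult_left_mono K(2) res_R) auto
      finally show ?case using elim by (auto intro: mult_left_mono)
    qed
  qed
qed

text \<open>Applied to a pole of order \<open>m\<close>, where the limit \<open>U\<close> is the
  leading Laurent coefficient.\<close>

lemma scaled_res_limit:
  assumes m: "0 < m" and lim: "\<And>x. ((\<lambda>l. (l - s) ^ m *\<^sub>R R l x) \<longlongrightarrow> U x) (at_right s)"
  shows "0 \<le> x \<Longrightarrow> 0 \<le> U x"
    and "0 \<le> t \<Longrightarrow> U (T t x) = exp (s * t) *\<^sub>R U x"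
    and "0 \<le> t \<Longrightarrow> T t (U x) = exp (s * t) *\<^sub>R U x"
proof -
  have nontriv: "at_right s \<noteq> bot" by simp
  show "0 \<le> U x" if "0 \<le> x"
  proof -
    have "((\<lambda>l. pprt (- ((l - s) ^ m *\<^sub>R R l x))) \<longlongrightarrow> pprt (- U x)) (at_right s)"
      by (intro tendsto_pprt tendsto_minus lim)
    then have "pprt (- U x) = 0"
      using scaled_res_negative_part[OF that m] by (rule tendsto_unique[OF nontriv])
    then show ?thesis by (simp add: le_zero_iff_zero_pprt[symmetric])
  qed
  show UT: "U (T t x) = exp (s * t) *\<^sub>R U x" if "0 \<le> t"
  proof -
    have "((\<lambda>l. (l - s) ^ m *\<^sub>R R l (T t x) - exp (l * t) *\<^sub>R ((l - s) ^ m *\<^sub>R R l x))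
        \<longlongrightarrow> U (T t x) - exp (s * t) *\<^sub>R U x) (at_right s)"
      by (intro tendsto_diff lim tendsto_scaleR tendsto_exp tendsto_mult tendsto_const tendsto_ident_at)
    moreover have "((\<lambda>l. (l - s) ^ m *\<^sub>R R l (T t x) - exp (l * t) *\<^sub>R ((l - s) ^ m *\<^sub>R R l x)) \<longlongrightarrow> 0) (at_right s)"
      using scaled_res_T[OF that m, of x] by (simp add: scaleR_diff_right mult.commute)
    ultimately have "U (T t x) - exp (s * t) *\<^sub>R U x = 0" by (rule tendsto_unique[OF nontriv])
    then show ?thesis by simp
  qed
  show "T t (U x) = exp (s * t) *\<^sub>R U x" if "0 \<le> t"
  proof -
    have "((\<lambda>l. T t ((l - s) ^ m *\<^sub>R R l x)) \<longlongrightarrow> T t (U x)) (at_right s)"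
      by (intro T_tendsto that lim)
    moreover have "\<forall>\<^sub>F l in at_right s. T t ((l - s) ^ m *\<^sub>R R l x) = (l - s) ^ m *\<^sub>R R l (T t x)"
      using eventually_near_s[OF zero_less_one]
      by eventually_elim (use that in \<open>simp add: T_scaleR res_T[OF res_R]\<close>)
    ultimately have "((\<lambda>l. (l - s) ^ m *\<^sub>R R l (T t x)) \<longlongrightarrow> T t (U x)) (at_right s)"
      by (rule Lim_transform_eventually)
    then have "T t (U x) = U (T t x)" using lim[of "T t x"] by (rule tendsto_unique[OF nontriv])
    then show ?thesis using UT[OF that] by simp
  qed
qed

lemma R_eigenvector:
  assumes "s < l" "\<And>t. 0 \<le> t \<Longrightarrow> T t v = exp (s * t) *\<^sub>R v"
  shows "(l - s) *\<^sub>R R l v = v"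
  using res_eigenvector[OF res_R[OF assms(1)]] eigenvector_iff[OF res_R[OF assms(1)], of s v] assms
  by simp

text \<open>If \<open>v\<close> is an eigenvector and \<open>w = |v|\<close>, then \<open>w - v\<close> and \<open>w + v\<close> are positive, so
  \<open>(l - s) R l w\<close> dominates \<open>v\<close> and \<open>-v\<close>, hence \<open>w\<close>, up to an error that vanishes as \<open>l \<rightarrow> s\<close>.\<close>

lemma scaled_res_abs_eigenvector:
  assumes v: "\<And>t. 0 \<le> t \<Longrightarrow> T t v = exp (s * t) *\<^sub>R v"
  obtains K where "\<And>l. s < l \<Longrightarrow> l < s + 1 \<Longrightarrow>
    norm v \<le> norm (pprt ((l - s) *\<^sub>R R l \<bar>v\<bar>)) + (l - s) * K"
proof -
  have "0 \<le> \<bar>v\<bar> - v" "0 \<le> \<bar>v\<bar> + v"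
    using abs_ge_self[of v] abs_ge_minus_self[of v] by (simp, metis add.commute neg_le_iff_le diff_ge_0_iff_ge diff_minus_eq_add)
  note nonneg = this
  obtain K e where
    e: "\<And>l. s < l \<Longrightarrow> l < s + 1 \<Longrightarrow> norm (e l) \<le> K" "\<And>l. s < l \<Longrightarrow> l < s + 1 \<Longrightarrow> e l \<le> R l (\<bar>v\<bar> - v)"
    by (rule res_lower_bound[OF nonneg(1)]) blast
  obtain K' e' where
    e': "\<And>l. s < l \<Longrightarrow> l < s + 1 \<Longrightarrow> norm (e' l) \<le> K'" "\<And>l. s < l \<Longrightarrow> l < s + 1 \<Longrightarrow> e' l \<le> R l (\<bar>v\<bar> + v)"
    by (rule res_lower_bound[OF nonneg(2)]) blast
  show thesis
  proof (rule that[of "K + K'"])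
    fix l assume l: "s < l" "l < s + 1"
    define d where "d = \<bar>e l\<bar> + \<bar>e' l\<bar>"
    define z where "z = (l - s) *\<^sub>R R l \<bar>v\<bar>"
    have Rv: "(l - s) *\<^sub>R R l v = v" by (rule R_eigenvector[OF l(1) v])
    have "\<bar>e l\<bar> \<le> d" "\<bar>e' l\<bar> \<le> d" by (simp_all add: d_def)
    then have "- e l \<le> d" "- e' l \<le> d"
      using order_trans[OF abs_ge_minus_self] by blast+
    then have d: "- d \<le> e l" "- d \<le> e' l" by (simp_all add: minus_le_iff)
    have "(l - s) *\<^sub>R (- d) \<le> (l - s) *\<^sub>R R l (\<bar>v\<bar> - v)" "(l - s) *\<^sub>R (- d) \<le> (l - s) *\<^sub>R R l (\<bar>v\<bar> + v)"
      using order_trans[OF d(1) e(2)[OF l]] order_trans[OF d(2) e'(2)[OF l]] l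
      by (intro scaleR_left_mono; simp)+
    then have "- ((l - s) *\<^sub>R d) \<le> z - v" "- ((l - s) *\<^sub>R d) \<le> z + v"
      using Rv l by (simp_all add: R_diff R_plus scaleR_diff_right scaleR_add_right z_def)
    then have "v \<le> z + (l - s) *\<^sub>R d" "- v \<le> z + (l - s) *\<^sub>R d"
      by (simp_all add: algebra_simps)
    then have "\<bar>v\<bar> \<le> z + (l - s) *\<^sub>R d" by (rule abs_leI)
    also have "\<dots> \<le> pprt z + (l - s) *\<^sub>R d" by (simp add: pprt_def)
    finally have "norm \<bar>v\<bar> \<le> norm (pprt z + (l - s) *\<^sub>R d)" by (intro norm_mono_nonneg) auto
    also have "\<dots> \<le> norm (pprt z) + (l - s) * norm d"
      using norm_triangle_ineq[of "pprt z" "(l - s) *\<^sub>R d"] l by simp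
    also have "norm d \<le> K + K'"
      unfolding d_def using norm_triangle_ineq[of "\<bar>e l\<bar>" "\<bar>e' l\<bar>"] e(1)[OF l] e'(1)[OF l] by simp
    finally show "norm v \<le> norm (pprt ((l - s) *\<^sub>R R l \<bar>v\<bar>)) + (l - s) * (K + K')"
      using l by (simp add: z_def mult_left_mono)
  qed
qed

text \<open>Domination by \<open>p\<close> carries all the information: \<open>p\<close> is at most
  0 at the negatives of positive vectors and at both signs of
  \<open>T t x - exp (s * t) *\<^sub>R x\<close>, which gives positivity and the eigenvalue
  equation, while its value at the modulus of \<open>v\<close> is at least the norm of
  \<open>v\<close>.\<close>

theorem dual_eigenvector_exists:
  assumes v: "v \<noteq> 0" "\<And>t. 0 \<le> t \<Longrightarrow> T t v = exp (s * t) *\<^sub>R v"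
    and bd: "0 < \<delta>" "\<And>l x. s < l \<Longrightarrow> l < s + \<delta> \<Longrightarrow> norm ((l - s) *\<^sub>R R l x) \<le> M * norm x"
  obtains \<phi> :: "'a \<Rightarrow> real" where "bounded_linear \<phi>" "\<And>x. 0 \<le> x \<Longrightarrow> 0 \<le> \<phi> x" "\<phi> \<bar>v\<bar> \<noteq> 0"
    "\<And>t x. 0 \<le> t \<Longrightarrow> \<phi> (T t x) = exp (s * t) * \<phi> x"
proof -
  define q where "q l x = norm (pprt ((l - s) *\<^sub>R R l x))" for l x
  \<comment> \<open>The infimum of these eventual upper bounds is the limit superior of
    \<open>q l x\<close>; admitting only nonnegative bounds makes the set bounded below, and
    boundedness of the scaled resolvents makes it nonempty.\<close>
  define Q where "Q x = {r. 0 \<le> r \<and> (\<forall>\<^sub>F l in at_right s. q l x \<le> r)}" for x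
  define p where "p x = Inf (Q x)" for x
  define M' where "M' = max M 0"
  have QM: "M' * norm x \<in> Q x" for x
  proof -
    have "\<forall>\<^sub>F l in at_right s. q l x \<le> M' * norm x"
      using eventually_near_s[OF bd(1)]
    proof eventually_elim
      case (elim l)
      have "q l x \<le> norm ((l - s) *\<^sub>R R l x)" unfolding q_def by (rule norm_pprt_le)
      also have "\<dots> \<le> M * norm x" using elim by (intro bd(2)) auto
      also have "\<dots> \<le> M' * norm x" by (intro mult_right_mono) (auto simp: M'_def)
      finally show ?case .
    qed
    then show ?thesis by (simp add: Q_def M'_def)
  qed
  have bddQ: "bdd_below (Q x)" for x by (rule bdd_belowI[of _ 0]) (simp add: Q_def)
  have p_le: "p x \<le> r" if "r \<in> Q x" for x r unfolding p_def by (rule cInf_lower[OF that bddQ])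
  have p_ge: "c \<le> p x" if "\<And>r. r \<in> Q x \<Longrightarrow> c \<le> r" for x c
    unfolding p_def using QM[of x] that by (intro cInf_greatest) auto
  have sub: "sublinear p" unfolding sublinear_def
  proof (intro conjI allI impI)
    fix x y
    have *: "p (x + y) \<le> a + b" if "a \<in> Q x" "b \<in> Q y" for a b
    proof (rule p_le)
      have "\<forall>\<^sub>F l in at_right s. q l x \<le> a" "\<forall>\<^sub>F l in at_right s. q l y \<le> b"
        using that by (auto simp: Q_def)
      with eventually_near_s[OF zero_less_one] have "\<forall>\<^sub>F l in at_right s. q l (x + y) \<le> a + b"
      proof eventually_elim
        case (elim l)
        have "q l (x + y) \<le> norm (pprt ((l - s) *\<^sub>R R l x) + pprt ((l - s) *\<^sub>R R l y))"
          unfolding q_def using elim(1)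
          by (intro norm_mono_nonneg) (simp_all add: R_plus scaleR_add_right pprt_add_le)
        also have "\<dots> \<le> q l x + q l y" unfolding q_def by (rule norm_triangle_ineq)
        finally show ?case using elim by simp
      qed
      then show "a + b \<in> Q (x + y)" using that by (simp add: Q_def)
    qed
    have "p (x + y) - a \<le> p y" if "a \<in> Q x" for a
      using *[OF that] by (intro p_ge) (simp add: diff_le_eq add.commute)
    then have "p (x + y) - p y \<le> p x" by (intro p_ge) (simp add: diff_le_eq add.commute)
    then show "p (x + y) \<le> p x + p y" by simp
  next
    fix a :: real and x assume a: "0 \<le> a"
    have *: "p (b *\<^sub>R y) \<le> b * p y" if b: "0 < b" for b y
    proof -
      have "p (b *\<^sub>R y) / b \<le> p y"
      proof (rule p_ge)
        fix r assume r: "r \<in> Q y"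
        then have "\<forall>\<^sub>F l in at_right s. q l y \<le> r" by (simp add: Q_def)
        with eventually_near_s[OF zero_less_one] have "\<forall>\<^sub>F l in at_right s. q l (b *\<^sub>R y) \<le> b * r"
        proof eventually_elim
          case (elim l)
          have "(l - s) *\<^sub>R R l (b *\<^sub>R y) = b *\<^sub>R (l - s) *\<^sub>R R l y"
            using elim by (simp add: R_scaleR mult.commute)
          then have "q l (b *\<^sub>R y) = b * q l y"
            using b pprt_scaleR[of b "(l - s) *\<^sub>R R l y"] by (simp add: q_def del: scaleR_scaleR)
          then show ?case using b elim by simp
        qed
        then have "b * r \<in> Q (b *\<^sub>R y)" using r b by (simp add: Q_def)
        then have "p (b *\<^sub>R y) \<le> b * r" by (rule p_le)
        then show "p (b *\<^sub>R y) / b \<le> r" using b by (simp add: divide_le_eq mult.commute)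
      qed
      then show ?thesis using b by (simp add: divide_le_eq mult.commute)
    qed
    show "p (a *\<^sub>R x) = a * p x"
    proof (cases "a = 0")
      case True
      have "p 0 \<le> 0" using p_le[OF QM[of 0]] by simp
      moreover have "0 \<le> p 0" by (rule p_ge) (simp add: Q_def)
      ultimately show ?thesis using True by simp
    next
      case False
      then have a: "0 < a" using a by simp
      have "p (inverse a *\<^sub>R a *\<^sub>R x) \<le> inverse a * p (a *\<^sub>R x)" using a by (intro *) simp
      then have "a * p x \<le> p (a *\<^sub>R x)" using a by (simp add: field_simps)
      then show ?thesis using *[OF a, of x] by simp
    qed
  qed
  have p_null: "p x \<le> 0" if "((\<lambda>l. pprt ((l - s) *\<^sub>R R l x)) \<longlongrightarrow> 0) (at_right s)" for x
  proof (rule field_le_epsilon)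
    fix e :: real assume e: "0 < e"
    have "\<forall>\<^sub>F l in at_right s. q l x < e"
      using tendsto_norm[OF that] e unfolding q_def by (intro order_tendstoD) simp_all
    then have "e \<in> Q x" using e by (auto simp: Q_def elim: eventually_mono)
    then show "p x \<le> 0 + e" using p_le by simp
  qed
  obtain \<phi> where \<phi>: "linear \<phi>" "\<And>x. \<phi> x \<le> p x" "\<phi> \<bar>v\<bar> = p \<bar>v\<bar>"
    using Hahn_Banach_sublinear[OF sub] by blast
  have le: "\<phi> x \<le> M' * norm x" for x using order_trans[OF \<phi>(2) p_le[OF QM]] .
  have "\<bar>\<phi> x\<bar> \<le> norm x * M'" for x
    using le[of x] le[of "- x"] linear_neg[OF \<phi>(1), of x] by (simp add: mult.commute abs_le_iff)
  then have bl: "bounded_linear \<phi>"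
    using \<phi>(1) by (intro bounded_linear.intro bounded_linear_axioms.intro exI[of _ M']) auto
  have pos: "0 \<le> \<phi> x" if "0 \<le> x" for x
  proof -
    have "((\<lambda>l. pprt ((l - s) *\<^sub>R R l (- x))) \<longlongrightarrow> 0) (at_right s)"
    proof (rule Lim_transform_eventually)
      show "((\<lambda>l. pprt (- ((l - s) ^ 1 *\<^sub>R R l x))) \<longlongrightarrow> 0) (at_right s)"
        by (rule scaled_res_negative_part[OF that]) simp
      show "\<forall>\<^sub>F l in at_right s. pprt (- ((l - s) ^ 1 *\<^sub>R R l x)) = pprt ((l - s) *\<^sub>R R l (- x))"
        using eventually_near_s[OF zero_less_one] by eventually_elim (simp add: R_minus)
    qed
    then have "\<phi> (- x) \<le> 0" using p_null \<phi>(2) order_trans by blast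
    then show ?thesis using linear_neg[OF \<phi>(1), of x] by simp
  qed
  have nz: "\<phi> \<bar>v\<bar> \<noteq> 0"
  proof -
    obtain K where K: "\<And>l. s < l \<Longrightarrow> l < s + 1 \<Longrightarrow>
        norm v \<le> norm (pprt ((l - s) *\<^sub>R R l \<bar>v\<bar>)) + (l - s) * K"
      using scaled_res_abs_eigenvector[OF v(2)] by blast
    have "norm v \<le> p \<bar>v\<bar>"
    proof (rule p_ge)
      fix r assume "r \<in> Q \<bar>v\<bar>"
      then have "\<forall>\<^sub>F l in at_right s. q l \<bar>v\<bar> \<le> r" by (simp add: Q_def)
      with eventually_near_s[OF zero_less_one] have "\<forall>\<^sub>F l in at_right s. norm v \<le> r + (l - s) * K"
      proof eventually_elim
        case (elim l)
        then show ?case using K[of l] by (simp add: q_def)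
      qed
      moreover have "((\<lambda>l. r + (l - s) * K) \<longlongrightarrow> r + (s - s) * K) (at_right s)"
        by (intro tendsto_intros)
      ultimately show "norm v \<le> r"
        using tendsto_lowerbound[of "\<lambda>l. r + (l - s) * K" "r + (s - s) * K" "at_right s" "norm v"] by simp
    qed
    then show ?thesis using v(1) \<phi>(3) by auto
  qed
  have eig: "\<phi> (T t x) = exp (s * t) * \<phi> x" if t: "0 \<le> t" for t x
  proof -
    \<comment> \<open>\<open>(l - s) *\<^sub>R R l z\<close> splits into the scaled finite-time
      error and \<open>exp (l * t) - exp (s * t)\<close> times the scaled resolvent of
      \<open>x\<close>; the latter tends to 0 because the scaled resolvents are bounded near
      \<open>s\<close>.\<close>
    define z where "z = T t x - exp (s * t) *\<^sub>R x"
    have lim: "((\<lambda>l. (l - s) *\<^sub>R R l z) \<longlongrightarrow> 0) (at_right s)"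
    proof (rule Lim_transform_eventually)
      have "((\<lambda>l. (exp (l * t) - exp (s * t)) * (M * norm x)) \<longlongrightarrow> (exp (s * t) - exp (s * t)) * (M * norm x)) (at_right s)"
        by (intro tendsto_intros)
      then have "((\<lambda>l. (exp (l * t) - exp (s * t)) * (M * norm x)) \<longlongrightarrow> 0) (at_right s)" by simp
      then have "((\<lambda>l. (exp (l * t) - exp (s * t)) *\<^sub>R (l - s) *\<^sub>R R l x) \<longlongrightarrow> 0) (at_right s)"
      proof (rule Lim_null_comparison[rotated])
        show "\<forall>\<^sub>F l in at_right s. norm ((exp (l * t) - exp (s * t)) *\<^sub>R (l - s) *\<^sub>R R l x)
            \<le> (exp (l * t) - exp (s * t)) * (M * norm x)"
          using eventually_near_s[OF bd(1)]
        proof eventually_elim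
          case (elim l)
          have "s * t \<le> l * t" using elim t by (intro mult_right_mono) auto
          then have nn: "0 \<le> exp (l * t) - exp (s * t)" by simp
          have "norm ((exp (l * t) - exp (s * t)) *\<^sub>R (l - s) *\<^sub>R R l x)
              = (exp (l * t) - exp (s * t)) * norm ((l - s) *\<^sub>R R l x)"
            using nn by (simp only: norm_scaleR[of "exp (l * t) - exp (s * t)"] abs_of_nonneg)
          also have "\<dots> \<le> (exp (l * t) - exp (s * t)) * (M * norm x)"
            using elim by (intro mult_left_mono nn bd(2)) auto
          finally show ?case .
        qed
      qed
      from tendsto_add[OF scaled_res_T[OF t, of 1 x] this]
      show "((\<lambda>l. (l - s) ^ 1 *\<^sub>R (R l (T t x) - exp (l * t) *\<^sub>R R l x)
        + (exp (l * t) - exp (s * t)) *\<^sub>R (l - s) *\<^sub>R R l x) \<longlongrightarrow> 0) (at_right s)" by simp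
      show "\<forall>\<^sub>F l in at_right s. (l - s) ^ 1 *\<^sub>R (R l (T t x) - exp (l * t) *\<^sub>R R l x)
        + (exp (l * t) - exp (s * t)) *\<^sub>R (l - s) *\<^sub>R R l x = (l - s) *\<^sub>R R l z"
        using eventually_near_s[OF zero_less_one]
        by eventually_elim (simp add: z_def R_diff R_scaleR algebra_simps)
    qed
    have "p z \<le> 0" using tendsto_pprt[OF lim] by (intro p_null) simp
    moreover have "p (- z) \<le> 0"
    proof (rule p_null)
      have "((\<lambda>l. pprt (- ((l - s) *\<^sub>R R l z))) \<longlongrightarrow> 0) (at_right s)"
        using tendsto_pprt[OF tendsto_minus[OF lim]] by simp
      moreover have "\<forall>\<^sub>F l in at_right s. pprt (- ((l - s) *\<^sub>R R l z)) = pprt ((l - s) *\<^sub>R R l (- z))"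
        using eventually_near_s[OF zero_less_one] by eventually_elim (simp add: R_minus)
      ultimately show "((\<lambda>l. pprt ((l - s) *\<^sub>R R l (- z))) \<longlongrightarrow> 0) (at_right s)"
        by (rule Lim_transform_eventually)
    qed
    ultimately have "\<phi> z \<le> 0" "\<phi> (- z) \<le> 0" using \<phi>(2) order_trans by blast+
    then have "\<phi> z = 0" using linear_neg[OF \<phi>(1), of z] by simp
    then show ?thesis
      using linear_diff[OF \<phi>(1)] linear_scale[OF \<phi>(1)] by (simp add: z_def)
  qed
  show thesis by (rule that[OF bl pos nz eig])
qed

end

section \<open>Positive operators intertwined with the semigroup\<close>

context real_ev_pos_semigroup
begin

text \<open>The range of \<open>U\<close> consists of eigenvectors, and composing \<open>U\<close>
  with a positive functional \<open>\<psi>\<close> gives the eigenfunctional that makes the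
  eigenspace one-dimensional.\<close>

theorem invariant_operator_rank_one:
  assumes U: "bounded_linear U" "\<And>x. 0 \<le> x \<Longrightarrow> 0 \<le> U x" "U y \<noteq> 0"
    and UT: "\<And>t x. 0 \<le> t \<Longrightarrow> U (T t x) = exp (s * t) *\<^sub>R U x"
    and TU: "\<And>t x. 0 \<le> t \<Longrightarrow> T t (U x) = exp (s * t) *\<^sub>R U x"
    and eig: "\<And>v. (\<And>t. 0 \<le> t \<Longrightarrow> T t v = exp (s * t) *\<^sub>R v) \<Longrightarrow> U v = a *\<^sub>R v"
  obtains u \<phi> where "a \<noteq> 0" "0 \<le> u" "closure {x. \<exists>c>0. \<bar>x\<bar> \<le> c *\<^sub>R u} = UNIV"
    "bounded_linear \<phi>" "\<And>x. 0 \<le> x \<Longrightarrow> 0 \<le> \<phi> x" "\<And>x. 0 \<le> x \<Longrightarrow> \<phi> x = 0 \<Longrightarrow> x = 0"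
    "\<And>x. U x = (a * \<phi> x) *\<^sub>R u"
proof -
  interpret U: bounded_linear U by (rule U(1))
  have "U (pprt y) \<noteq> 0 \<or> U (- nprt y) \<noteq> 0"
  proof (rule ccontr)
    assume "\<not> ?thesis"
    then have "U (pprt y + nprt y) = 0" by (simp add: U.add U.neg)
    then show False using U(3) prts[of y] by simp
  qed
  then obtain x0 where x0: "0 \<le> x0" "U x0 \<noteq> 0"
    using zero_le_pprt[of y] nprt_le_zero[of y] by (metis neg_0_le_iff_le)
  obtain \<psi> :: "'a \<Rightarrow> real" where \<psi>: "bounded_linear \<psi>" "\<And>x. 0 \<le> x \<Longrightarrow> 0 \<le> \<psi> x" "0 < \<psi> (U x0)"
    using positive_functional_exists[OF U(2)[OF x0(1)] x0(2)] by blast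
  interpret \<psi>: bounded_linear \<psi> by (rule \<psi>(1))
  define \<phi> where "\<phi> x = \<psi> (U x)" for x
  have bl: "bounded_linear \<phi>" unfolding \<phi>_def by (rule bounded_linear_compose[OF \<psi>(1) U(1)])
  have pos: "0 \<le> \<phi> x" if "0 \<le> x" for x unfolding \<phi>_def using that by (intro \<psi>(2) U(2))
  have nz: "\<phi> x0 \<noteq> 0" using \<psi>(3) by (simp add: \<phi>_def)
  have \<phi>T: "\<phi> (T t x) = exp (s * t) * \<phi> x" if "0 \<le> t" for t x
    using that by (simp add: \<phi>_def UT \<psi>.scaleR)
  obtain u where u: "0 \<le> u" "\<phi> u = 1" "\<And>t. 0 \<le> t \<Longrightarrow> T t u = exp (s * t) *\<^sub>R u"
    "closure {x. \<exists>c>0. \<bar>x\<bar> \<le> c *\<^sub>R u} = UNIV"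
    "\<And>v. (\<And>t. 0 \<le> t \<Longrightarrow> T t v = exp (s * t) *\<^sub>R v) \<Longrightarrow> v = \<phi> v *\<^sub>R u"
    by (rule eigenspace_one_dimensional[OF bl pos nz \<phi>T x0(2) TU]) blast+
  \<comment> \<open>The normalisation \<open>\<phi> u = 1\<close> reads
    \<open>\<psi> (U u) = 1\<close>, and \<open>U u = a *\<^sub>R u\<close>; this is what excludes
    \<open>a = 0\<close>.\<close>
  have "a * \<psi> u = 1" using u(2) eig[OF u(3)] by (simp add: \<phi>_def \<psi>.scaleR)
  then have a: "a \<noteq> 0" by auto
  have eq: "U x = (a * \<phi> x) *\<^sub>R u" for x
  proof -
    have "\<phi> (U x) = a * \<phi> x" using eig[OF TU, of x] by (simp add: \<phi>_def \<psi>.scaleR)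
    then show ?thesis using u(5)[OF TU, of x] by simp
  qed
  show thesis
    by (rule that[OF a u(1,4) bl pos eigenfunctional_strictly_positive[OF bl pos nz \<phi>T] eq])
qed

end

section \<open>Eigenfunctionals of the generator and Cesaro means\<close>

context real_c0_semigroup
begin

lemma eigenfunctional_gen:
  assumes \<phi>: "bounded_linear \<phi>" and eig: "\<And>t x. 0 \<le> t \<Longrightarrow> \<phi> (T t x) = exp (s * t) * (\<phi> x :: real)"
    and xy: "(x, y) \<in> gen"
  shows "\<phi> y = s * \<phi> x"
proof -
  interpret bounded_linear \<phi> by (rule \<phi>)
  have "((\<lambda>h. exp (s * h)) has_real_derivative s) (at 0)"
    by (auto intro!: derivative_eq_intros)
  then have "((\<lambda>h. (exp (s * h) - 1) / h) \<longlongrightarrow> s) (at 0)"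
    by (simp add: has_field_derivative_iff)
  then have "((\<lambda>h. (exp (s * h) - 1) / h) \<longlongrightarrow> s) (at_right 0)"
    by (rule tendsto_mono[rotated]) (rule at_le, simp)
  then have "((\<lambda>h. (exp (s * h) - 1) / h * \<phi> x) \<longlongrightarrow> s * \<phi> x) (at_right 0)"
    by (intro tendsto_intros)
  moreover have "\<forall>\<^sub>F h in at_right (0::real). (exp (s * h) - 1) / h * \<phi> x = \<phi> ((T h x - x) /\<^sub>R h)"
    using eventually_at_right_less[of 0]
    by eventually_elim (simp add: diff scaleR eig field_simps)
  ultimately have "((\<lambda>h. \<phi> ((T h x - x) /\<^sub>R h)) \<longlongrightarrow> s * \<phi> x) (at_right 0)"
    by (rule Lim_transform_eventually)
  moreover have "((\<lambda>h. \<phi> ((T h x - x) /\<^sub>R h)) \<longlongrightarrow> \<phi> y) (at_right 0)"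
    using xy by (intro tendsto) (simp add: gen_def)
  ultimately show ?thesis using tendsto_unique[of "at_right (0::real)"] by fastforce
qed

definition cesaro :: "real \<Rightarrow> 'a \<Rightarrow> 'a" where
  "cesaro t x = (1 / t) *\<^sub>R integral {0..t} (\<lambda>r. T r x)"

lemma integrable_T: "0 \<le> a \<Longrightarrow> (\<lambda>r. T r x) integrable_on {a..b}"
  using integrable_exp_T[of a 0 x b] by simp

lemma bounded_linear_cesaro:
  assumes "0 < t"
  shows "bounded_linear (cesaro t)"
proof -
  obtain M \<omega> where M: "0 < M" "0 \<le> \<omega>"
    "\<And>t x. 0 \<le> t \<Longrightarrow> norm (T t x) \<le> M * exp (\<omega> * t) * norm x"
    by (rule exponentially_bounded) blast
  show ?thesis
  proof (rule bounded_linear_intro)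
    fix x y :: 'a and c :: real
    have "integral {0..t} (\<lambda>r. T r (x + y)) = integral {0..t} (\<lambda>r. T r x + T r y)"
      by (intro integral_cong) (simp add: T_plus)
    then show "cesaro t (x + y) = cesaro t x + cesaro t y"
      by (simp add: cesaro_def integral_add integrable_T scaleR_add_right)
    have "integral {0..t} (\<lambda>r. T r (c *\<^sub>R x)) = integral {0..t} (\<lambda>r. c *\<^sub>R T r x)"
      by (intro integral_cong) (simp add: T_scaleR)
    then show "cesaro t (c *\<^sub>R x) = c *\<^sub>R cesaro t x"
      by (simp add: cesaro_def)
    have "norm (integral {0..t} (\<lambda>r. T r x)) \<le> (M * exp (\<omega> * t) * norm x) * (t - 0)"
    proof (rule integral_bound)
      show "continuous_on {0..t} (\<lambda>r. T r x)" by (rule continuous_on_subset[OF continuous_on_T]) auto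
      fix r assume r: "r \<in> {0..t}"
      then have "norm (T r x) \<le> M * exp (\<omega> * r) * norm x" by (intro M) simp
      also have "\<dots> \<le> M * exp (\<omega> * t) * norm x"
        using M r by (intro mult_right_mono mult_left_mono) (auto intro: mult_left_mono)
      finally show "norm (T r x) \<le> M * exp (\<omega> * t) * norm x" .
    qed (use assms in simp)
    then show "norm (cesaro t x) \<le> norm x * (M * exp (\<omega> * t))"
      using assms by (simp add: cesaro_def field_simps)
  qed
qed

text \<open>Applying \<open>T r\<close> shifts the window of integration. The second formula
  compares the shifted window with the one of length \<open>t + r\<close>; the part that is cut off
  is divided by \<open>t\<close> and disappears in the limit.\<close>

lemma cesaro_T:
  assumes "0 < t" "0 \<le> r"
  shows "T r (cesaro t x) = cesaro t (T r x)"
    and "cesaro t (T r x) = ((t + r) / t) *\<^sub>R cesaro (t + r) x - (1 / t) *\<^sub>R integral {0..r} (\<lambda>q. T q x)"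
proof -
  have "T r (integral {0..t} (\<lambda>q. T q x)) = integral {0..t} (T r \<circ> (\<lambda>q. T q x))"
    by (rule integral_linear[OF integrable_T bounded_linear_T, symmetric]) (use assms in auto)
  also have "\<dots> = integral {0..t} (\<lambda>q. T q (T r x))"
    by (intro integral_cong) (use assms in \<open>simp add: T_commute[of r]\<close>)
  finally show "T r (cesaro t x) = cesaro t (T r x)"
    using assms by (simp add: cesaro_def T_scaleR)
  have "integral {0..t} (\<lambda>q. T q (T r x)) = integral {0..t} (\<lambda>q. T (q + r) x)"
    by (intro integral_cong) (use assms in \<open>simp add: T_add\<close>)
  also have "\<dots> = integral {r..t + r} (\<lambda>q. T q x)"
    using integral_shift_banach[of "\<lambda>q. T q x" 0 r t] integrable_T[OF assms(2)] by simp
  also have "\<dots> = integral {0..t + r} (\<lambda>q. T q x) - integral {0..r} (\<lambda>q. T q x)"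
    using Henstock_Kurzweil_Integration.integral_combine[of 0 r "t + r" "\<lambda>q. T q x"]
      integrable_T[of 0] assms by (simp add: algebra_simps)
  finally show "cesaro t (T r x) = ((t + r) / t) *\<^sub>R cesaro (t + r) x - (1 / t) *\<^sub>R integral {0..r} (\<lambda>q. T q x)"
    using assms by (simp add: cesaro_def scaleR_diff_right)
qed

lemma tendsto_inverse_scaleR_at_top: "((\<lambda>t. (1 / t) *\<^sub>R (x::'a)) \<longlongrightarrow> 0) at_top"
proof -
  have "((\<lambda>t. inverse t *\<^sub>R x) \<longlongrightarrow> 0 *\<^sub>R x) at_top"
    by (intro tendsto_scaleR tendsto_const tendsto_inverse_0_at_top filterlim_ident)
  then show ?thesis by (simp add: inverse_eq_divide)
qed

text \<open>Convergence bounds the means of each vector only from some time on that depends on the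
  vector; the uniform boundedness principle supplies a common tail, hence a bounded limit. The other
  claims compare limits along shifted windows.\<close>

lemma cesaro_limit:
  assumes lim: "\<And>x. ((\<lambda>t. cesaro t x) \<longlongrightarrow> P x) at_top"
  shows "bounded_linear P" and "0 \<le> r \<Longrightarrow> P (T r x) = P x" and "0 \<le> r \<Longrightarrow> T r (P x) = P x"
    and "(\<And>t. 0 \<le> t \<Longrightarrow> T t v = v) \<Longrightarrow> P v = v"
proof -
  have nontriv: "(at_top :: real filter) \<noteq> bot" by simp
  \<comment> \<open>Starting at \<open>Suc n\<close> instead of \<open>n\<close> keeps all times
    positive, where the means are bounded linear operators.\<close>
  define J where "J n = {real (Suc n)..}" for n
  have bl: "bounded_linear (cesaro t)" if "t \<in> J n" for t n
    using that by (intro bounded_linear_cesaro) (simp add: J_def)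
  have bdd: "\<exists>n. \<forall>t\<in>J n. norm (cesaro t x) \<le> real n" for x
  proof -
    have "\<forall>\<^sub>F t in at_top. norm (cesaro t x) < norm (P x) + 1"
      using tendsto_norm[OF lim[of x]] by (rule order_tendstoD) simp
    then obtain b where b: "\<And>t. b \<le> t \<Longrightarrow> norm (cesaro t x) < norm (P x) + 1"
      by (auto simp: eventually_at_top_linorder)
    obtain n where n: "max b (norm (P x) + 1) \<le> real n" using real_arch_simple by blast
    have "norm (cesaro t x) \<le> real n" if "t \<in> J n" for t
      using b[of t] that n by (auto simp: J_def)
    then show ?thesis by blast
  qed
  obtain n K where K: "\<And>t x. t \<in> J n \<Longrightarrow> norm (cesaro t x) \<le> K * norm x"
  proof (rule Banach_Steinhaus_eventually[of J cesaro])
    show "bounded_linear (cesaro t)" if "t \<in> J n" for t n by (rule bl[OF that])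
  qed (use bdd in blast)+
  have ev: "\<forall>\<^sub>F t in at_top. t \<in> J n \<and> 0 < t"
    using eventually_ge_at_top[of "real (Suc n)"] by eventually_elim (auto simp: J_def)
  show "bounded_linear P"
  proof (rule bounded_linear_intro)
    fix x y :: 'a and c :: real
    show "norm (P x) \<le> norm x * K"
    proof (rule tendsto_upperbound[OF tendsto_norm[OF lim] _ nontriv])
      show "\<forall>\<^sub>F t in at_top. norm (cesaro t x) \<le> norm x * K"
        using ev by eventually_elim (use K in \<open>simp add: mult.commute\<close>)
    qed
    have "((\<lambda>t. cesaro t (x + y)) \<longlongrightarrow> P x + P y) at_top"
    proof (rule Lim_transform_eventually[OF tendsto_add[OF lim lim]])
      show "\<forall>\<^sub>F t in at_top. cesaro t x + cesaro t y = cesaro t (x + y)"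
        using ev by eventually_elim (simp add: linear_add[OF bounded_linear.linear[OF bounded_linear_cesaro]])
    qed
    then show "P (x + y) = P x + P y" by (rule tendsto_unique[OF nontriv lim])
    have "((\<lambda>t. cesaro t (c *\<^sub>R x)) \<longlongrightarrow> c *\<^sub>R P x) at_top"
    proof (rule Lim_transform_eventually[OF tendsto_scaleR[OF tendsto_const lim]])
      show "\<forall>\<^sub>F t in at_top. c *\<^sub>R cesaro t x = cesaro t (c *\<^sub>R x)"
        using ev by eventually_elim (simp add: linear_scale[OF bounded_linear.linear[OF bounded_linear_cesaro]])
    qed
    then show "P (c *\<^sub>R x) = c *\<^sub>R P x" by (rule tendsto_unique[OF nontriv lim])
  qed
  show PT: "P (T r x) = P x" if r: "0 \<le> r" for r x
  proof -
    have "((\<lambda>t. cesaro (t + r) x) \<longlongrightarrow> P x) at_top"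
      by (rule filterlim_compose[OF lim]) (rule filterlim_tendsto_add_at_top[OF tendsto_const filterlim_ident, of r, simplified add.commute])
    moreover have "((\<lambda>t. 1 + r * inverse t) \<longlongrightarrow> 1 + r * 0) at_top"
      by (intro tendsto_intros tendsto_inverse_0_at_top filterlim_ident)
    ultimately have "((\<lambda>t. (1 + r * inverse t) *\<^sub>R cesaro (t + r) x - (1 / t) *\<^sub>R integral {0..r} (\<lambda>q. T q x))
        \<longlongrightarrow> (1 + r * 0) *\<^sub>R P x - 0) at_top"
      by (intro tendsto_diff tendsto_scaleR tendsto_inverse_scaleR_at_top)
    moreover have "\<forall>\<^sub>F t in at_top. (1 + r * inverse t) *\<^sub>R cesaro (t + r) x - (1 / t) *\<^sub>R integral {0..r} (\<lambda>q. T q x)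
        = cesaro t (T r x)"
      using ev
    proof eventually_elim
      case (elim t)
      then have "(t + r) / t = 1 + r * inverse t" by (simp add: field_simps)
      then show ?case using cesaro_T(2)[of t r x] elim r by simp
    qed
    ultimately have "((\<lambda>t. cesaro t (T r x)) \<longlongrightarrow> (1 + r * 0) *\<^sub>R P x - 0) at_top"
      by (rule Lim_transform_eventually)
    from tendsto_unique[OF nontriv lim this] show ?thesis by simp
  qed
  show "T r (P x) = P x" if r: "0 \<le> r"
  proof -
    have "((\<lambda>t. cesaro t (T r x)) \<longlongrightarrow> T r (P x)) at_top"
    proof (rule Lim_transform_eventually[OF T_tendsto[OF r lim]])
      show "\<forall>\<^sub>F t in at_top. T r (cesaro t x) = cesaro t (T r x)"
        using ev by eventually_elim (use r in \<open>simp add: cesaro_T(1)\<close>)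
    qed
    from tendsto_unique[OF nontriv this lim] show ?thesis using PT[OF r] by simp
  qed
  show "P v = v" if v: "\<And>t. 0 \<le> t \<Longrightarrow> T t v = v"
  proof -
    have "((\<lambda>t. cesaro t v) \<longlongrightarrow> v) at_top"
    proof (rule Lim_transform_eventually[OF tendsto_const])
      show "\<forall>\<^sub>F t in at_top. v = cesaro t v"
        using ev
      proof eventually_elim
        case (elim t)
        have "integral {0..t} (\<lambda>r. T r v) = integral {0..t} (\<lambda>r. v)"
          by (intro integral_cong v) simp
        then show ?case using elim by (simp add: cesaro_def)
      qed
    qed
    from tendsto_unique[OF nontriv lim this] show ?thesis .
  qed
qed

end

context real_ev_pos_semigroup
begin

text \<open>The initial piece of the orbit, which may fail to be positive, has a fixed integral
  \<open>I\<close>; divided by \<open>t\<close> it tends to zero.\<close>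

lemma cesaro_limit_nonneg:
  assumes lim: "((\<lambda>t. cesaro t x) \<longlongrightarrow> y) at_top" and "0 \<le> x"
  shows "0 \<le> y"
proof -
  obtain a where a: "0 \<le> a" "\<forall>t\<ge>a. 0 \<le> T t x" using eventually_pos[OF assms(2)] by blast
  define I where "I = integral {0..a} (\<lambda>q. T q x)"
  have "((\<lambda>t. cesaro t x - (1 / t) *\<^sub>R I) \<longlongrightarrow> y - 0) at_top"
    by (intro tendsto_diff lim tendsto_inverse_scaleR_at_top)
  moreover have "\<forall>\<^sub>F t in at_top. 0 \<le> cesaro t x - (1 / t) *\<^sub>R I"
    using eventually_ge_at_top[of "a + 1"]
  proof eventually_elim
    case (elim t)
    have "I + integral {a..t} (\<lambda>q. T q x) = integral {0..t} (\<lambda>q. T q x)"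
      unfolding I_def using a elim
      by (intro Henstock_Kurzweil_Integration.integral_combine integrable_T) auto
    then have "cesaro t x - (1 / t) *\<^sub>R I = (1 / t) *\<^sub>R integral {a..t} (\<lambda>q. T q x)"
      unfolding cesaro_def scaleR_diff_right[symmetric] by (metis add_diff_cancel_left')
    moreover have "0 \<le> integral {a..t} (\<lambda>q. T q x)"
      using a by (intro integral_nonneg_lattice integrable_T) auto
    ultimately show ?case using a elim by (simp add: scaleR_nonneg_nonneg)
  qed
  ultimately have "0 \<le> y - 0" by (rule tendsto_nonneg) simp
  then show ?thesis by simp
qed

end

section \<open>Complexification\<close>

lemma bounded_linear_cre: "bounded_linear (cre :: 'a::banach_lattice complexification \<Rightarrow> 'a)"
  by (rule bounded_linear_intro[of _ 1]) (simp_all add: norm_cre_le)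

lemma bounded_linear_cim: "bounded_linear (cim :: 'a::banach_lattice complexification \<Rightarrow> 'a)"
  by (rule bounded_linear_intro[of _ 1]) (simp_all add: norm_cim_le)

lemma norm_Cplx_0: "norm (Cplx x 0) \<le> norm x" for x :: "'a::banach_lattice"
  using norm_le_add[of "Cplx x 0"] by simp

lemma tendsto_complexification_iff:
  "(f \<longlongrightarrow> z) F \<longleftrightarrow> ((\<lambda>t. cre (f t)) \<longlongrightarrow> cre z) F \<and> ((\<lambda>t. cim (f t)) \<longlongrightarrow> cim z) F"
  for f :: "'b \<Rightarrow> 'a::banach_lattice complexification"
proof safe
  assume *: "((\<lambda>t. cre (f t)) \<longlongrightarrow> cre z) F" "((\<lambda>t. cim (f t)) \<longlongrightarrow> cim z) F"
  have "((\<lambda>t. norm (cre (f t) - cre z) + norm (cim (f t) - cim z)) \<longlongrightarrow> 0 + 0) F"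
    using * by (intro tendsto_add tendsto_norm_zero LIM_zero)
  then have "((\<lambda>t. f t - z) \<longlongrightarrow> 0) F"
    by (intro Lim_null_comparison[of "\<lambda>t. f t - z"])
      (use norm_le_add[of "f t - z" for t] in auto)
  then show "(f \<longlongrightarrow> z) F" by (rule LIM_zero_cancel)
qed (auto intro: bounded_linear.tendsto[OF bounded_linear_cre] bounded_linear.tendsto[OF bounded_linear_cim])

text \<open>Splitting \<open>c\<close> into real and imaginary part reduces the claim to
  multiplication by \<open>\<i>\<close>, which only rotates the angle in the supremum defining the
  modulus. The splitting costs the factor 2 compared with the exact norm.\<close>

lemma norm_scaleC_le: "norm (c *\<^sub>C z) \<le> 2 * norm c * norm z" for z :: "'a::banach_lattice complexification"
proof -
  have "c *\<^sub>C z = Re c *\<^sub>R z + Im c *\<^sub>R (\<i> *\<^sub>C z)"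
    by (simp add: scaleC_def complexification_eq_iff)
  moreover have "norm (\<i> *\<^sub>C z) \<le> norm z"
  proof -
    have "modulus (\<i> *\<^sub>C z) \<le> modulus z"
    proof (rule modulus_least)
      fix t
      have "cos t *\<^sub>R cre (\<i> *\<^sub>C z) - sin t *\<^sub>R cim (\<i> *\<^sub>C z)
          = cos (t + pi / 2) *\<^sub>R cre z - sin (t + pi / 2) *\<^sub>R cim z"
        by (simp add: scaleC_def cos_add sin_add)
      then show "cos t *\<^sub>R cre (\<i> *\<^sub>C z) - sin t *\<^sub>R cim (\<i> *\<^sub>C z) \<le> modulus z"
        using modulus_ge by metis
    qed
    then show ?thesis unfolding norm_complexification_def by (intro norm_mono_nonneg) simp_all
  qed
  ultimately have "norm (c *\<^sub>C z) \<le> \<bar>Re c\<bar> * norm z + \<bar>Im c\<bar> * norm z"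
    using norm_triangle_ineq[of "Re c *\<^sub>R z" "Im c *\<^sub>R (\<i> *\<^sub>C z)"]
      mult_left_mono[of "norm (\<i> *\<^sub>C z)" "norm z" "\<bar>Im c\<bar>"] by simp
  also have "\<dots> \<le> norm c * norm z + norm c * norm z"
    by (intro add_mono mult_right_mono abs_Re_le_cmod abs_Im_le_cmod) auto
  finally show ?thesis by simp
qed

lemma bounded_linear_scaleC_left: "bounded_linear (\<lambda>c. c *\<^sub>C z)" for z :: "'a::banach_lattice complexification"
proof (rule bounded_linear_intro)
  show "norm (c *\<^sub>C z) \<le> norm c * (2 * norm z)" for c using norm_scaleC_le[of c z] by simp
qed (simp_all add: scaleC_def complexification_eq_iff algebra_simps)

lemma bounded_linear_scaleC_right: "bounded_linear (\<lambda>z. c *\<^sub>C z)"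
proof (rule bounded_linear_intro)
  show "norm (c *\<^sub>C z) \<le> norm z * (2 * norm c)" for z :: "'a::banach_lattice complexification"
    using norm_scaleC_le[of c z] by (simp add: ac_simps)
qed (simp_all add: scaleC_def complexification_eq_iff algebra_simps)

definition restrict_real :: "('a::banach_lattice complexification \<Rightarrow> 'a complexification) \<Rightarrow> 'a \<Rightarrow> 'a" where
  "restrict_real S x = cre (S (Cplx x 0))"

definition real_operator :: "('a::banach_lattice complexification \<Rightarrow> 'a complexification) \<Rightarrow> bool" where
  "real_operator S \<longleftrightarrow> bounded_clinear S \<and> (\<forall>x. cim (S (Cplx x 0)) = 0)"

lemma real_operator_eq:
  assumes "real_operator S"
  shows "S z = Cplx (restrict_real S (cre z)) (restrict_real S (cim z))"
proof -
  interpret bounded_linear S using assms by (simp add: real_operator_def bounded_clinear_def)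
  have S: "S (Cplx x 0) = Cplx (restrict_real S x) 0" for x
    using assms by (simp add: real_operator_def restrict_real_def complexification_eq_iff)
  have "z = Cplx (cre z) 0 + \<i> *\<^sub>C Cplx (cim z) 0" by (simp add: complexification_eq_iff scaleC_def)
  then have "S z = S (Cplx (cre z) 0 + \<i> *\<^sub>C Cplx (cim z) 0)" by simp
  also have "\<dots> = S (Cplx (cre z) 0) + \<i> *\<^sub>C S (Cplx (cim z) 0)"
    using assms by (simp add: add real_operator_def bounded_clinear_def)
  also have "\<dots> = Cplx (restrict_real S (cre z)) (restrict_real S (cim z))"
    by (simp add: S complexification_eq_iff scaleC_def)
  finally show ?thesis .
qed

lemma bounded_linear_restrict_real:
  assumes "real_operator S"
  shows "bounded_linear (restrict_real S)"
proof -
  interpret S: bounded_linear S using assms by (simp add: real_operator_def bounded_clinear_def)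
  obtain K where K: "\<And>z. norm (S z) \<le> norm z * K" "K > 0" using S.pos_bounded by blast
  show ?thesis
  proof (rule bounded_linear_intro)
    fix x y :: 'a and c :: real
    have "Cplx (x + y) 0 = Cplx x 0 + Cplx y 0" "Cplx (c *\<^sub>R x) 0 = c *\<^sub>R Cplx x 0"
      by (simp_all add: complexification_eq_iff)
    then show "restrict_real S (x + y) = restrict_real S x + restrict_real S y"
      "restrict_real S (c *\<^sub>R x) = c *\<^sub>R restrict_real S x"
      by (simp_all add: restrict_real_def S.add S.scaleR)
    have "norm (restrict_real S x) \<le> norm (S (Cplx x 0))"
      unfolding restrict_real_def by (rule norm_cre_le)
    also have "\<dots> \<le> norm (Cplx x 0) * K" by (rule K)
    also have "\<dots> \<le> norm x * K" using K(2) by (intro mult_right_mono norm_Cplx_0) simp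
    finally show "norm (restrict_real S x) \<le> norm x * K" .
  qed
qed

definition complexify :: "('a::banach_lattice \<Rightarrow> real) \<Rightarrow> 'a complexification \<Rightarrow> complex" where
  "complexify \<phi> z = Complex (\<phi> (cre z)) (\<phi> (cim z))"

lemma complexify_dual_space:
  assumes "bounded_linear \<phi>"
  shows "complexify \<phi> \<in> dual_space"
proof -
  interpret \<phi>: bounded_linear \<phi> by (rule assms)
  have eq: "complexify \<phi> = (\<lambda>z. of_real (\<phi> (cre z)) + \<i> * of_real (\<phi> (cim z)))"
    by (auto simp: complexify_def complex_eq_iff)
  have "bounded_linear (complexify \<phi>)"
    unfolding eq
    by (intro bounded_linear_add bounded_linear_const_mult
        bounded_linear_compose[OF bounded_linear_of_real] bounded_linear_compose[OF assms]
        bounded_linear_cre bounded_linear_cim)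
  moreover have "complexify \<phi> (c *\<^sub>C f) = c * complexify \<phi> f" for c f
    by (simp add: complexify_def scaleC_def complex_eq_iff \<phi>.add \<phi>.diff \<phi>.scaleR)
  ultimately show ?thesis by (simp add: dual_space_def)
qed

lemma complexify_strictly_positive:
  fixes \<phi> :: "'a::banach_lattice \<Rightarrow> real"
  assumes "bounded_linear \<phi>" "\<And>x. 0 \<le> x \<Longrightarrow> 0 \<le> \<phi> x" "\<And>x. 0 \<le> x \<Longrightarrow> \<phi> x = 0 \<Longrightarrow> x = 0"
  shows "strictly_positive (complexify \<phi>)"
  unfolding strictly_positive_def
proof (intro conjI ballI impI complexify_dual_space assms(1))
  interpret \<phi>: bounded_linear \<phi> by (rule assms(1))
  fix f :: "'a complexification" assume "f \<in> pos_cone"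
  then have f: "cim f = 0" "0 \<le> cre f" by (auto simp: pos_cone_def real_part_def)
  show "complexify \<phi> f \<in> \<real>" using f by (simp add: complexify_def \<phi>.zero complex_is_Real_iff)
  show "0 \<le> Re (complexify \<phi> f)" using f assms(2) by (simp add: complexify_def)
  show "f = 0" if "complexify \<phi> f = 0"
    using that f assms(3) by (simp add: complexify_def complex_eq_iff complexification_eq_iff)
qed

text \<open>Real and imaginary parts are approximated separately; the sum of their moduli bounds the
  complex modulus, so the two constants add.\<close>

lemma quasi_interior_Cplx:
  assumes "0 \<le> u" "closure {x. \<exists>c>0. \<bar>x\<bar> \<le> c *\<^sub>R u} = UNIV"
  shows "quasi_interior (Cplx u 0)"
proof -
  have "z \<in> closure (principal_ideal (Cplx u 0))" for z
  proof -
    have "cre z \<in> closure {x. \<exists>c>0. \<bar>x\<bar> \<le> c *\<^sub>R u}" "cim z \<in> closure {x. \<exists>c>0. \<bar>x\<bar> \<le> c *\<^sub>R u}"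
      by (simp_all add: assms(2))
    then obtain X Y where XY: "\<And>n::nat. \<exists>c>0. \<bar>X n\<bar> \<le> c *\<^sub>R u" "X \<longlonglongrightarrow> cre z"
      "\<And>n. \<exists>c>0. \<bar>Y n\<bar> \<le> c *\<^sub>R u" "Y \<longlonglongrightarrow> cim z"
      unfolding closure_sequential by blast
    have "(\<lambda>n. Cplx (X n) (Y n)) \<longlonglongrightarrow> z" using XY by (simp add: tendsto_complexification_iff)
    moreover have "Cplx (X n) (Y n) \<in> principal_ideal (Cplx u 0)" for n
    proof -
      obtain c d where "c > 0" "d > 0" "\<bar>X n\<bar> \<le> c *\<^sub>R u" "\<bar>Y n\<bar> \<le> d *\<^sub>R u" using XY(1,3) by metis
      then have "modulus (Cplx (X n) (Y n)) \<le> (c + d) *\<^sub>R u" "c + d > 0"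
        using order_trans[OF modulus_le_add[of "Cplx (X n) (Y n)"], of "(c + d) *\<^sub>R u"]
        by (simp_all add: scaleR_add_left add_mono)
      then show ?thesis unfolding principal_ideal_def by (auto intro!: exI[of _ "c + d"])
    qed
    ultimately show ?thesis unfolding closure_sequential by (intro exI[of _ "\<lambda>n. Cplx (X n) (Y n)"]) auto
  qed
  then show ?thesis using assms(1) by (auto simp: quasi_interior_def pos_cone_def real_part_def)
qed

lemma rank_one_Cplx: "Cplx u 0 \<otimes>\<^sub>R complexify \<phi> = (\<lambda>f. Cplx (\<phi> (cre f) *\<^sub>R u) (\<phi> (cim f) *\<^sub>R u))"
  by (auto simp: rank_one_def complexify_def scaleC_def fun_eq_iff)

section \<open>Resolvents of unbounded operators\<close>

lemma is_resolvent_at_unique: "is_resolvent_at A l R \<Longrightarrow> is_resolvent_at A l R' \<Longrightarrow> R = R'"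
  unfolding is_resolvent_at_def by (auto simp: fun_eq_iff set_eq_iff)

lemma is_resolvent_at_resolvent: "l \<in> resolvent_set A \<Longrightarrow> is_resolvent_at A l (resolvent l A)"
  unfolding resolvent_def resolvent_set_def
  by (auto intro: theI[of "is_resolvent_at A l"] dest: is_resolvent_at_unique)

lemma resolvent_bounded_clinear: "l \<in> resolvent_set A \<Longrightarrow> bounded_clinear (resolvent l A)"
  using is_resolvent_at_resolvent[of l A] by (simp add: is_resolvent_at_def)

lemma resolvent_in_operator:
  assumes "l \<in> resolvent_set A"
  shows "(resolvent l A f, l *\<^sub>C resolvent l A f - f) \<in> A"
proof -
  have "(f, resolvent l A f) \<in> (shifted l A)\<inverse>"
    using is_resolvent_at_resolvent[OF assms] by (simp add: is_resolvent_at_def)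
  then obtain g where "(resolvent l A f, g) \<in> A" "f = l *\<^sub>C resolvent l A f - g"
    by (auto simp: shifted_def)
  moreover from this(2) have "g = l *\<^sub>C resolvent l A f - f" by (simp add: algebra_simps)
  ultimately show ?thesis by simp
qed

lemma resolvent_left_inverse:
  assumes "l \<in> resolvent_set A" "(f, g) \<in> A"
  shows "resolvent l A (l *\<^sub>C f - g) = f"
proof -
  have "(l *\<^sub>C f - g, f) \<in> (shifted l A)\<inverse>" using assms(2) by (auto simp: shifted_def)
  then have "(l *\<^sub>C f - g, f) \<in> {(f, resolvent l A f) | f. True}"
    using is_resolvent_at_resolvent[OF assms(1)] unfolding is_resolvent_at_def by metis
  then show ?thesis by auto
qed

lemma spectral_bound_resolvent_set:
  assumes "spectral_bound A = ereal s" "s < Re l"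
  shows "l \<in> resolvent_set A"
proof (rule ccontr)
  assume "l \<notin> resolvent_set A"
  then have "ereal (Re l) \<le> spectral_bound A"
    unfolding spectral_bound_def spectrum_def by (intro SUP_upper) auto
  then show False using assms by simp
qed

lemma kernel_shifted: "kernel (shifted l A) = {f. (f, l *\<^sub>C f) \<in> A}"
  by (auto simp: kernel_def shifted_def)

text \<open>The expansion at a pole converges in operator norm at one point, so its terms are bounded
  there, which gives a geometric bound on the coefficients.\<close>

lemma resolvent_pole_expansion:
  assumes "resolvent_pole_of_order A \<mu> m"
  obtains U \<rho> B where "m \<ge> 1" "\<And>n::nat. bounded_clinear (U n)" "U 0 \<noteq> (\<lambda>f. 0)" "0 < \<rho>" "0 \<le> B"
    "\<And>l. l \<noteq> \<mu> \<Longrightarrow> norm (l - \<mu>) \<le> \<rho> \<Longrightarrow> l \<in> resolvent_set A"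
    "\<And>l f. l \<noteq> \<mu> \<Longrightarrow> norm (l - \<mu>) \<le> \<rho> \<Longrightarrow>
      (\<lambda>n. (l - \<mu>) ^ n *\<^sub>C U n f) sums ((l - \<mu>) ^ m *\<^sub>C resolvent l A f)"
    "\<And>n f. norm (U n f) \<le> B / \<rho> ^ n * norm f"
proof -
  obtain U r where m: "m \<ge> 1" and r: "r > 0" and U: "\<And>n. bounded_clinear (U n)" "U 0 \<noteq> (\<lambda>f. 0)"
    and L: "\<And>l. l \<in> ball \<mu> r - {\<mu>} \<Longrightarrow> l \<in> resolvent_set A"
      "\<And>l. l \<in> ball \<mu> r - {\<mu>} \<Longrightarrow> (\<lambda>N. onorm (\<lambda>f. resolvent l A f
              - (\<Sum>n<N. ((l - \<mu>) powi (int n - int m)) *\<^sub>C U n f))) \<longlonglongrightarrow> 0"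
    using assms unfolding resolvent_pole_of_order_def by blast
  define D where "D l N f = resolvent l A f - (\<Sum>n<N. ((l - \<mu>) powi (int n - int m)) *\<^sub>C U n f)" for l N f
  have bl: "bounded_linear (U n)" for n using U(1) by (simp add: bounded_clinear_def)
  have D: "norm (D l N f) \<le> onorm (D l N) * norm f" if "l \<in> resolvent_set A" for l N f
  proof (rule onorm)
    show "bounded_linear (D l N)"
      unfolding D_def using resolvent_bounded_clinear[OF that] bl
      by (intro bounded_linear_sub bounded_linear_sum bounded_linear_compose[OF bounded_linear_scaleC_right])
        (auto simp: bounded_clinear_def)
  qed
  have powi: "(l - \<mu>) ^ m * (l - \<mu>) powi (int n - int m) = (l - \<mu>) ^ n" if "l \<noteq> \<mu>" for l n
    using that by (simp add: power_int_diff)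
  define \<rho> where "\<rho> = r / 2"
  have \<rho>: "0 < \<rho>" using r by (simp add: \<rho>_def)
  have ball: "l \<in> ball \<mu> r - {\<mu>}" if "l \<noteq> \<mu>" "norm (l - \<mu>) \<le> \<rho>" for l
    using that r by (auto simp: \<rho>_def dist_norm norm_minus_commute)
  \<comment> \<open>A point to the right of \<open>\<mu>\<close> makes all powers of
    \<open>l0 - \<mu>\<close> positive reals, so the terms of the expansion are real multiples with
    exactly known norm.\<close>
  define l0 where "l0 = \<mu> + of_real \<rho>"
  have l0: "l0 \<noteq> \<mu>" "norm (l0 - \<mu>) \<le> \<rho>" "l0 - \<mu> = of_real \<rho>" using \<rho> by (auto simp: l0_def)
  have l0r: "l0 \<in> resolvent_set A" by (rule L(1)[OF ball[OF l0(1,2)]])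
  have "(\<lambda>N. onorm (D l0 N)) \<longlonglongrightarrow> 0" using L(2)[OF ball[OF l0(1,2)]] by (simp add: D_def[abs_def])
  then have "Bseq (\<lambda>N. onorm (D l0 N))" by (intro convergent_imp_Bseq convergentI)
  then obtain C where C: "C > 0" "\<And>N. norm (onorm (D l0 N)) \<le> C" by (auto elim: BseqE)
  have DC: "norm (D l0 N f) \<le> C * norm f" for N f
    using order_trans[OF D[OF l0r] mult_right_mono[of _ C "norm f"]] C(2)[of N] by simp
  \<comment> \<open>Each term is the difference of two consecutive remainders, each bounded by
    \<open>C\<close>; the factor \<open>\<rho> ^ m\<close> compensates the shift of the exponents by
    the pole order.\<close>
  define B where "B = 2 * C * \<rho> ^ m"
  have B: "0 \<le> B" using C \<rho> by (simp add: B_def)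
  have UB: "norm (U n f) \<le> B / \<rho> ^ n * norm f" for n f
  proof -
    define p where "p = \<rho> powi (int n - int m)"
    have p: "p > 0" using \<rho> by (simp add: p_def)
    have "(l0 - \<mu>) powi (int n - int m) = of_real p" by (simp add: l0(3) p_def)
    then have "D l0 n f - D l0 (Suc n) f = p *\<^sub>R U n f"
      by (simp add: D_def scaleC_of_real)
    then have "p * norm (U n f) \<le> norm (D l0 n f) + norm (D l0 (Suc n) f)"
      using p norm_triangle_ineq4[of "D l0 n f" "D l0 (Suc n) f"] by simp
    also have "\<dots> \<le> 2 * C * norm f" using DC[of n f] DC[of "Suc n" f] by simp
    finally have "norm (U n f) \<le> 2 * C * norm f / p" using p by (simp add: field_simps)
    also have "\<dots> = B / \<rho> ^ n * norm f" using \<rho> by (simp add: p_def B_def power_int_diff)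
    finally show ?thesis .
  qed
  have sums: "(\<lambda>n. (l - \<mu>) ^ n *\<^sub>C U n f) sums ((l - \<mu>) ^ m *\<^sub>C resolvent l A f)"
    if l: "l \<noteq> \<mu>" "norm (l - \<mu>) \<le> \<rho>" for l f
  proof -
    have "(\<lambda>N. onorm (D l N) * norm f) \<longlonglongrightarrow> 0 * norm f"
      using L(2)[OF ball[OF l]] by (intro tendsto_intros) (simp add: D_def[abs_def])
    then have "(\<lambda>N. onorm (D l N) * norm f) \<longlonglongrightarrow> 0" by simp
    then have "(\<lambda>N. D l N f) \<longlonglongrightarrow> 0"
      by (rule Lim_null_comparison[rotated]) (simp add: D[OF L(1)[OF ball[OF l]]])
    then have "(\<lambda>N. resolvent l A f - D l N f) \<longlonglongrightarrow> resolvent l A f - 0" by (intro tendsto_intros)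
    then have "(\<lambda>N. (l - \<mu>) ^ m *\<^sub>C (resolvent l A f - D l N f)) \<longlonglongrightarrow> (l - \<mu>) ^ m *\<^sub>C (resolvent l A f - 0)"
      by (rule bounded_linear.tendsto[OF bounded_linear_scaleC_right])
    moreover have "(l - \<mu>) ^ m *\<^sub>C (resolvent l A f - D l N f) = (\<Sum>n<N. (l - \<mu>) ^ n *\<^sub>C U n f)" for N
      using powi[OF l(1)] by (simp add: D_def cplx.scale_sum_right)
    ultimately show ?thesis by (simp add: sums_def)
  qed
  show thesis
    by (rule that[of U \<rho> B]) (use m U \<rho> B L(1)[OF ball] sums UB in auto)
qed

text \<open>Within half the radius, the series without its constant term is majorised by a geometric
  series of ratio \<open>1 / 2\<close> whose leading factor is proportional to the distance from
  \<open>\<mu>\<close>.\<close>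

lemma resolvent_pole_limit:
  assumes "0 < \<rho>" "0 \<le> B" and UB: "\<And>n f. norm (U n f) \<le> B / \<rho> ^ n * norm f"
    and sums: "\<And>l. l \<noteq> \<mu> \<Longrightarrow> norm (l - \<mu>) \<le> \<rho> \<Longrightarrow>
      (\<lambda>n. (l - \<mu>) ^ n *\<^sub>C U n f) sums ((l - \<mu>) ^ m *\<^sub>C resolvent l A f)"
  shows "((\<lambda>l. (l - \<mu>) ^ m *\<^sub>C resolvent l A f) \<longlongrightarrow> U 0 f) (at \<mu>)"
proof (rule LIM_zero_cancel, rule Lim_null_comparison)
  have "((\<lambda>l. 4 * B * norm f / \<rho> * norm (l - \<mu>)) \<longlongrightarrow> 4 * B * norm f / \<rho> * norm (\<mu> - \<mu>)) (at \<mu>)"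
    by (intro tendsto_intros)
  then show "((\<lambda>l. 4 * B * norm f / \<rho> * norm (l - \<mu>)) \<longlongrightarrow> 0) (at \<mu>)" by simp
  have "\<forall>\<^sub>F l in at \<mu>. l \<noteq> \<mu> \<and> norm (l - \<mu>) < \<rho> / 2"
    unfolding eventually_at dist_norm using assms(1) by (intro exI[of _ "\<rho> / 2"]) auto
  then show "\<forall>\<^sub>F l in at \<mu>. norm ((l - \<mu>) ^ m *\<^sub>C resolvent l A f - U 0 f) \<le> 4 * B * norm f / \<rho> * norm (l - \<mu>)"
  proof eventually_elim
    case (elim l)
    define d where "d = norm (l - \<mu>)"
    have d: "0 \<le> d" "d / \<rho> < 1 / 2" "0 \<le> d / \<rho>" using elim assms(1) by (auto simp: d_def field_simps)
    have "(\<lambda>n. (l - \<mu>) ^ n *\<^sub>C U n f) sums ((l - \<mu>) ^ m *\<^sub>C resolvent l A f)"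
      using elim assms(1) by (intro sums) auto
    then have "(\<lambda>n. (l - \<mu>) ^ Suc n *\<^sub>C U (Suc n) f) sums ((l - \<mu>) ^ m *\<^sub>C resolvent l A f - U 0 f)"
      by (subst sums_Suc_iff) simp
    then have eq: "(l - \<mu>) ^ m *\<^sub>C resolvent l A f - U 0 f = (\<Sum>n. (l - \<mu>) ^ Suc n *\<^sub>C U (Suc n) f)"
      by (simp add: sums_iff)
    \<comment> \<open>The 2 stems from \<open>norm_scaleC_le\<close>, and \<open>d / \<rho>\<close>
      is the one power by which the shifted series starts later. Summing the ratio
      \<open>1 / 2\<close> doubles \<open>c\<close>, whence the constant 4.\<close>
    define c where "c = 2 * B * norm f * (d / \<rho>)"
    have le: "norm ((l - \<mu>) ^ Suc n *\<^sub>C U (Suc n) f) \<le> c * (1 / 2) ^ n" for n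
    proof -
      have "norm ((l - \<mu>) ^ Suc n *\<^sub>C U (Suc n) f) \<le> 2 * d ^ Suc n * norm (U (Suc n) f)"
        using norm_scaleC_le[of "(l - \<mu>) ^ Suc n" "U (Suc n) f"] by (simp add: norm_power norm_mult d_def)
      also have "\<dots> \<le> 2 * d ^ Suc n * (B / \<rho> ^ Suc n * norm f)"
        using d(1) by (intro mult_left_mono UB) auto
      also have "\<dots> = 2 * B * norm f * (d / \<rho>) * (d / \<rho>) ^ n" by (simp add: power_divide)
      also have "\<dots> \<le> 2 * B * norm f * (d / \<rho>) * (1 / 2) ^ n"
        using d assms(1,2) by (intro mult_left_mono power_mono) auto
      finally show ?thesis by (simp add: c_def)
    qed
    have s: "(\<lambda>n. c * (1 / 2) ^ n) sums (c * (1 / (1 - 1 / 2)))"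
      by (intro sums_mult geometric_sums) simp
    have "norm (\<Sum>n. (l - \<mu>) ^ Suc n *\<^sub>C U (Suc n) f) \<le> (\<Sum>n. c * (1 / 2) ^ n)"
      by (rule norm_suminf_le) (use s le in \<open>auto simp: sums_iff\<close>)
    also have "\<dots> = 4 * B * norm f / \<rho> * norm (l - \<mu>)" using s by (simp add: sums_iff c_def d_def)
    finally show ?case using eq by simp
  qed
qed

text \<open>On the circle the derivative of the path is \<open>2 \<pi> i (\<gamma> t - \<mu>)\<close>, so for a simple pole the
  integrand is the power series of \<open>(l - \<mu>) R(l, A)\<close>, all of whose terms but the constant one have
  mean value zero.\<close>

lemma spectral_projection_simple_pole:
  fixes A :: "'a::banach_lattice operator"
  assumes "0 < \<rho>" "0 \<le> B" and UB: "\<And>n f. norm (U n f) \<le> B / \<rho> ^ n * norm f"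
    and sums: "\<And>l f. l \<noteq> \<mu> \<Longrightarrow> norm (l - \<mu>) \<le> \<rho> \<Longrightarrow>
      (\<lambda>n. (l - \<mu>) ^ n *\<^sub>C U n f) sums ((l - \<mu>) *\<^sub>C resolvent l A f)"
  shows "spectral_projection A \<mu> = U 0"
proof -
  have int: "vec_contour_integral (circlepath \<mu> r) (\<lambda>l. resolvent l A f) = (2 * of_real pi * \<i>) *\<^sub>C U 0 f"
    if r: "0 < r" "r < \<rho> / 2" for r f
  proof -
    define e where "e t = exp (2 * of_real pi * \<i> * of_real t)" for t :: real
    define g where "g n t = (of_real r * e t) ^ n *\<^sub>C U n f" for n t
    have e1: "norm (e t) = 1" for t unfolding e_def by (simp add: norm_exp_eq_Re)
    have path: "circlepath \<mu> r t = \<mu> + of_real r * e t" for t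
      by (simp add: circlepath e_def)
    have ne: "circlepath \<mu> r t \<noteq> \<mu>" for t using r by (simp add: path e_def)
    have nrm: "norm (circlepath \<mu> r t - \<mu>) \<le> \<rho>" for t using r assms(1) by (simp add: path norm_mult e1)
    have g_sums: "(\<lambda>n. g n t) sums ((of_real r * e t) *\<^sub>C resolvent (circlepath \<mu> r t) A f)" for t
      using sums[OF ne nrm, of t f] by (simp add: path g_def)
    \<comment> \<open>Since \<open>r / \<rho>\<close> is below 1, the series converges uniformly in
      \<open>t\<close> and may be integrated term by term.\<close>
    have unif: "uniform_limit {0..1} (\<lambda>N t. \<Sum>n<N. g n t) (\<lambda>t. \<Sum>n. g n t) sequentially"
    proof (rule Weierstrass_m_test)
      fix n and t :: real
      have "norm (g n t) \<le> 2 * r ^ n * norm (U n f)"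
        using norm_scaleC_le[of "(of_real r * e t) ^ n" "U n f"] r
        by (simp add: g_def norm_power norm_mult e1)
      also have "\<dots> \<le> 2 * r ^ n * (B / \<rho> ^ n * norm f)" using r by (intro mult_left_mono UB) auto
      also have "\<dots> = 2 * B * norm f * (r / \<rho>) ^ n" by (simp add: power_divide)
      finally show "norm (g n t) \<le> 2 * B * norm f * (r / \<rho>) ^ n" .
      show "summable (\<lambda>n. 2 * B * norm f * (r / \<rho>) ^ n)"
        using r assms(1) by (intro summable_mult summable_geometric) auto
    qed
    have g_int: "(g n has_integral (if n = 0 then U 0 f else 0)) {0..1}" for n
    proof (cases "n = 0")
      case True
      have "((\<lambda>t::real. U 0 f) has_integral (1 - 0) *\<^sub>R U 0 f) {0..1}"
        using has_integral_const_real[of "U 0 f" 0 1] by simp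
      then show ?thesis using True by (simp add: g_def[abs_def])
    next
      case False
      define k where "k = 2 * of_real pi * \<i> * of_nat n"
      have k: "k \<noteq> 0" using False by (simp add: k_def)
      have en: "e t ^ n = exp (k * of_real t)" for t
        by (simp add: e_def k_def exp_of_nat_mult[symmetric] mult_ac)
      have "((\<lambda>t. of_real r ^ n * exp (k * of_real t)) has_integral
          of_real r ^ n * exp (k * of_real 1) / k - of_real r ^ n * exp (k * of_real 0) / k) {0..1}"
      proof (rule fundamental_theorem_of_calculus)
        fix t :: real
        have "((\<lambda>z. of_real r ^ n * exp (k * z) / k) has_field_derivative of_real r ^ n * exp (k * of_real t))
            (at (of_real t))"
          using k by (auto intro!: derivative_eq_intros)
        then have "((\<lambda>t. of_real r ^ n * exp (k * of_real t) / k) has_vector_derivative of_real r ^ n * exp (k * of_real t)) (at t)"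
          by (rule has_vector_derivative_real_field)
        then show "((\<lambda>t. of_real r ^ n * exp (k * of_real t) / k) has_vector_derivative
            of_real r ^ n * exp (k * of_real t)) (at t within {0..1})"
          by (rule has_vector_derivative_at_within)
      qed simp
      moreover have "exp k = 1" unfolding k_def
        using exp_integer_2pi[of "of_nat n"] by (simp add: mult_ac)
      ultimately have "((\<lambda>t. (of_real r * e t) ^ n) has_integral 0) {0..1}"
        by (simp add: power_mult_distrib en)
      from has_integral_linear[OF this bounded_linear_scaleC_left[of "U n f"]]
      show ?thesis using False by (simp add: g_def[abs_def] comp_def)
    qed
    have cont: "continuous_on {0..1} (\<lambda>t. \<Sum>n<N. g n t)" for N
      unfolding g_def e_def
      by (intro continuous_on_sum bounded_linear.continuous_on[OF bounded_linear_scaleC_left] continuous_intros)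
    obtain I J where IJ: "\<And>N. ((\<lambda>t. \<Sum>n<N. g n t) has_integral I N) {0..1}"
      "((\<lambda>t. \<Sum>n. g n t) has_integral J) {0..1}" "I \<longlonglongrightarrow> J"
      using uniform_limit_integral[OF unif cont] by auto
    have "I N = (\<Sum>n<N. if n = 0 then U 0 f else 0)" for N
      by (rule has_integral_unique[OF IJ(1)]) (intro has_integral_sum g_int finite_lessThan)
    then have "I N = U 0 f" if "N \<ge> 1" for N using that by (simp add: sum.delta)
    then have "\<forall>\<^sub>F N in sequentially. I N = U 0 f" by (auto simp: eventually_sequentially)
    then have "I \<longlonglongrightarrow> U 0 f" by (rule tendsto_eventually)
    then have J: "J = U 0 f" using IJ(3) LIMSEQ_unique by blast
    have "((\<lambda>t. (2 * of_real pi * \<i>) *\<^sub>C (\<Sum>n. g n t)) has_integral (2 * of_real pi * \<i>) *\<^sub>C J) {0..1}"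
      using has_integral_linear[OF IJ(2) bounded_linear_scaleC_right] by (simp add: comp_def)
    moreover have "(2 * of_real pi * \<i>) *\<^sub>C (\<Sum>n. g n t) =
        vector_derivative (circlepath \<mu> r) (at t within {0..1}) *\<^sub>C resolvent (circlepath \<mu> r t) A f"
      if "t \<in> {0..1}" for t
    proof -
      have "(\<Sum>n. g n t) = (of_real r * e t) *\<^sub>C resolvent (circlepath \<mu> r t) A f"
        using g_sums by (simp add: sums_iff)
      moreover have "vector_derivative (circlepath \<mu> r) (at t within {0..1}) = (2 * of_real pi * \<i>) * (of_real r * e t)"
        using vector_derivative_circlepath01[of t \<mu> r] that by (simp add: e_def mult_ac)
      ultimately show ?thesis by simp
    qed
    ultimately have "((\<lambda>t. vector_derivative (circlepath \<mu> r) (at t within {0..1}) *\<^sub>C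
        resolvent (circlepath \<mu> r t) A f) has_integral (2 * of_real pi * \<i>) *\<^sub>C J) {0..1}"
      by (rule has_integral_eq[rotated])
    then show ?thesis
      unfolding vec_contour_integral_def J by (rule integral_unique)
  qed
  have ev: "\<forall>\<^sub>F r in at_right 0. U 0 = (\<lambda>f. (1 / (2 * of_real pi * \<i>)) *\<^sub>C
      vec_contour_integral (circlepath \<mu> r) (\<lambda>l. resolvent l A f))"
    unfolding eventually_at_right_field
    by (rule exI[of _ "\<rho> / 2"]) (use assms(1) int in \<open>simp add: fun_eq_iff\<close>)
  show ?thesis
    unfolding spectral_projection_def
  proof (rule the_equality)
    show "\<forall>\<^sub>F r in at_right 0. U 0 = (\<lambda>f. (1 / (2 * of_real pi * \<i>)) *\<^sub>C
        vec_contour_integral (circlepath \<mu> r) (\<lambda>l. resolvent l A f))" by (rule ev)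
    fix P assume "\<forall>\<^sub>F r in at_right 0. P = (\<lambda>f. (1 / (2 * of_real pi * \<i>)) *\<^sub>C
        vec_contour_integral (circlepath \<mu> r) (\<lambda>l. resolvent l A f))"
    \<comment> \<open>Both candidates are given by the same integral at some common small radius; an
      equation free of the radius that holds eventually holds outright.\<close>
    with ev have "\<forall>\<^sub>F r in at_right (0::real). P = U 0" by eventually_elim simp
    then show "P = U 0" by (simp add: eventually_const_iff)
  qed
qed

section \<open>Transfer to the complex semigroup\<close>

locale ev_pos_semigroup =
  fixes T :: "real \<Rightarrow> 'a::banach_lattice complexification \<Rightarrow> 'a complexification"
  assumes c0: "C0_semigroup T"
    and real: "real_semigroup T"
    and ev_pos: "individually_eventually_positive T"
    and irred: "persistently_irreducible T"
begin

lemma real_operator_T: "0 \<le> t \<Longrightarrow> real_operator (T t)"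
  using c0 real
  by (force simp: real_operator_def C0_semigroup_def real_semigroup_def real_part_def)

abbreviation "Tr \<equiv> \<lambda>t. restrict_real (T t)"

lemma T_eq: "0 \<le> t \<Longrightarrow> T t z = Cplx (Tr t (cre z)) (Tr t (cim z))"
  by (rule real_operator_eq[OF real_operator_T])

text \<open>For solidity, the sum of the moduli of the two parts of \<open>g\<close> lies in
  \<open>J\<close> and dominates the modulus of \<open>f\<close>, hence both parts of
  \<open>f\<close>.\<close>

lemma ideal_of_real_ideal:
  fixes J :: "'a set"
  assumes "closed J" "subspace J" "solid J"
  shows "closed_ideal {z. cre z \<in> J \<and> cim z \<in> J}"
  unfolding closed_ideal_def
proof (intro conjI allI impI)
  have "closed (cre -` J \<inter> cim -` J)"
    by (intro closed_Int continuous_closed_vimage[OF assms(1)] linear_continuous_at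
        bounded_linear_cre bounded_linear_cim)
  then show "closed {z. cre z \<in> J \<and> cim z \<in> J}" by (simp add: vimage_def Collect_conj_eq)
  note sub = subspace_0[OF assms(2)] subspace_add[OF assms(2)] subspace_scale[OF assms(2)]
    subspace_diff[OF assms(2)]
  show "cplx.subspace {z. cre z \<in> J \<and> cim z \<in> J}"
    unfolding cplx.subspace_def by (auto simp: scaleC_def intro: sub)
  fix f g :: "'a complexification"
  assume g: "g \<in> {z. cre z \<in> J \<and> cim z \<in> J}" and fg: "modulus f \<le> modulus g"
  have solid: "x \<in> J" if "y \<in> J" "\<bar>x\<bar> \<le> \<bar>y\<bar>" for x y
    using assms(3) that unfolding solid_def by blast
  have "\<bar>cre g\<bar> + \<bar>cim g\<bar> \<in> J"
    using g solid[of _ "\<bar>cre g\<bar>"] solid[of _ "\<bar>cim g\<bar>"] by (intro sub) auto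
  moreover have "modulus f \<le> \<bar>cre g\<bar> + \<bar>cim g\<bar>" using fg modulus_le_add by (rule order_trans)
  then have "\<bar>cre f\<bar> \<le> \<bar>\<bar>cre g\<bar> + \<bar>cim g\<bar>\<bar>" "\<bar>cim f\<bar> \<le> \<bar>\<bar>cre g\<bar> + \<bar>cim g\<bar>\<bar>"
    using order_trans[OF abs_cre_le[of f]] order_trans[OF abs_cim_le[of f]] abs_ge_self order_trans
    by blast+
  ultimately show "f \<in> {z. cre z \<in> J \<and> cim z \<in> J}" using solid by blast
qed

sublocale R: real_ev_pos_semigroup Tr
proof (intro real_ev_pos_semigroup.intro real_c0_semigroup.intro real_ev_pos_semigroup_axioms.intro)
  show "bounded_linear (Tr t)" if "0 \<le> t" for t
    by (rule bounded_linear_restrict_real[OF real_operator_T[OF that]])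
  show "Tr 0 x = x" for x
    using c0 by (simp add: restrict_real_def C0_semigroup_def)
  show "Tr (s + t) x = Tr s (Tr t x)" if "0 \<le> s" "0 \<le> t" for s t x
  proof -
    have "T (s + t) (Cplx x 0) = T s (T t (Cplx x 0))" using c0 that by (simp add: C0_semigroup_def)
    then show ?thesis using that by (simp add: T_eq)
  qed
  show "((\<lambda>t. Tr t x) \<longlongrightarrow> x) (at_right 0)" for x
    using c0 bounded_linear.tendsto[OF bounded_linear_cre, of "\<lambda>t. T t (Cplx x 0)" "Cplx x 0" "at_right 0"]
    by (simp add: C0_semigroup_def restrict_real_def)
  show "\<exists>t\<^sub>0\<ge>0. \<forall>t\<ge>t\<^sub>0. 0 \<le> Tr t x" if "0 \<le> x" for x
  proof -
    have "Cplx x 0 \<in> pos_cone" using that by (simp add: pos_cone_def real_part_def)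
    then obtain t\<^sub>0 where "t\<^sub>0 \<ge> 0" "\<forall>t\<ge>t\<^sub>0. T t (Cplx x 0) \<in> pos_cone"
      using ev_pos unfolding individually_eventually_positive_def by blast
    then show ?thesis by (auto simp: pos_cone_def restrict_real_def)
  qed
  fix J :: "'a set" and t\<^sub>0 :: real
  assume J: "closed J" "subspace J" "solid J" and t\<^sub>0: "0 \<le> t\<^sub>0"
    and inv: "\<And>t x. t\<^sub>0 \<le> t \<Longrightarrow> x \<in> J \<Longrightarrow> Tr t x \<in> J"
  \<comment> \<open>Irreducibility of the complex semigroup is tested on \<open>J + iJ\<close>,
    invariant because \<open>T t\<close> acts on real and imaginary parts separately;
    \<open>J\<close> is recovered as the set of its real vectors.\<close>
  define I where "I = {z. cre z \<in> J \<and> cim z \<in> J}"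
  have "T t ` I \<subseteq> I" if "t \<ge> t\<^sub>0" for t
    using that t\<^sub>0 inv by (auto simp: I_def T_eq)
  then have I: "I = {0} \<or> I = UNIV"
    using irred ideal_of_real_ideal[OF J] t\<^sub>0 unfolding persistently_irreducible_def I_def by blast
  have JI: "x \<in> J \<longleftrightarrow> Cplx x 0 \<in> I" for x using subspace_0[OF J(2)] by (simp add: I_def)
  from I show "J = {0} \<or> J = UNIV"
  proof
    assume "I = {0}"
    then have "x \<in> J \<longleftrightarrow> x = 0" for x using JI[of x] by (simp add: complexification_eq_iff)
    then show ?thesis by blast
  next
    assume "I = UNIV"
    then show ?thesis using JI by auto
  qed
qed

lemma generator_iff: "(f, g) \<in> generator T \<longleftrightarrow> (cre f, cre g) \<in> R.gen \<and> (cim f, cim g) \<in> R.gen"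
proof -
  have "(f, g) \<in> generator T \<longleftrightarrow> ((\<lambda>t. cre ((T t f - f) /\<^sub>R t)) \<longlongrightarrow> cre g) (at_right 0) \<and>
      ((\<lambda>t. cim ((T t f - f) /\<^sub>R t)) \<longlongrightarrow> cim g) (at_right 0)"
    by (simp only: generator_def mem_Collect_eq case_prod_conv tendsto_complexification_iff[of _ g])
  also have "((\<lambda>t. cre ((T t f - f) /\<^sub>R t)) \<longlongrightarrow> cre g) (at_right 0) \<longleftrightarrow> (cre f, cre g) \<in> R.gen"
    unfolding R.gen_def mem_Collect_eq case_prod_conv
    by (rule tendsto_cong) (use eventually_at_right_less[of 0] in \<open>eventually_elim, simp add: T_eq\<close>)
  also have "((\<lambda>t. cim ((T t f - f) /\<^sub>R t)) \<longlongrightarrow> cim g) (at_right 0) \<longleftrightarrow> (cim f, cim g) \<in> R.gen"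
    unfolding R.gen_def mem_Collect_eq case_prod_conv
    by (rule tendsto_cong) (use eventually_at_right_less[of 0] in \<open>eventually_elim, simp add: T_eq\<close>)
  finally show ?thesis .
qed

lemma gen_zero: "(0, 0) \<in> R.gen"
  by (auto simp: R.gen_def R.T_zero intro!: tendsto_eventually eventually_mono[OF eventually_at_right_less[of 0]])

abbreviation "A \<equiv> generator T"

text \<open>The imaginary part \<open>y\<close> of the resolvent applied to a real vector satisfies
  \<open>(y, l *\<^sub>R y) \<in> R.gen\<close>, and the left inverse property then gives
  \<open>y = 0\<close>.\<close>

lemma resolvent_real:
  assumes "complex_of_real l \<in> resolvent_set A"
  shows "real_operator (resolvent l A)" and "R.res l (restrict_real (resolvent l A))"
proof -
  define S where "S = resolvent l A"
  have S: "bounded_clinear S" "\<And>f. (S f, l *\<^sub>R S f - f) \<in> A" "\<And>f g. (f, g) \<in> A \<Longrightarrow> S (l *\<^sub>R f - g) = f"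
    using resolvent_bounded_clinear[OF assms] resolvent_in_operator[OF assms]
      resolvent_left_inverse[OF assms] by (auto simp: S_def scaleC_of_real)
  interpret S: bounded_linear S using S(1) by (simp add: bounded_clinear_def)
  have "cim (S (Cplx x 0)) = 0" for x
  proof -
    define y where "y = cim (S (Cplx x 0))"
    have "(y, l *\<^sub>R y) \<in> R.gen" using S(2)[of "Cplx x 0"] by (simp add: generator_iff y_def)
    then have "(Cplx y 0, l *\<^sub>R Cplx y 0) \<in> A" using gen_zero by (simp add: generator_iff)
    from S(3)[OF this] show ?thesis by (simp add: S.zero y_def complexification_eq_iff)
  qed
  then show real: "real_operator (resolvent l A)" using S(1) by (simp add: real_operator_def S_def)
  have Sx: "S (Cplx x 0) = Cplx (restrict_real S x) 0" for x
    using real by (simp add: real_operator_def restrict_real_def complexification_eq_iff S_def)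
  show "R.res l (restrict_real (resolvent l A))"
    unfolding R.res_def S_def[symmetric]
  proof (intro conjI allI ballI)
    show "bounded_linear (restrict_real S)"
      unfolding S_def by (rule bounded_linear_restrict_real[OF real])
    show "(restrict_real S x, l *\<^sub>R restrict_real S x - x) \<in> R.gen" for x
      using S(2)[of "Cplx x 0"] by (simp add: generator_iff Sx)
    fix p assume "p \<in> R.gen"
    then obtain x y where p: "p = (x, y)" "(x, y) \<in> R.gen" by (cases p) auto
    then have "(Cplx x 0, Cplx y 0) \<in> A" using gen_zero by (simp add: generator_iff)
    from S(3)[OF this] have "S (Cplx (l *\<^sub>R x - y) 0) = Cplx x 0"
      by (simp add: minus_complexification_def)
    then show "case p of (x, y) \<Rightarrow> restrict_real S (l *\<^sub>R x - y) = x"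
      using p by (simp add: Sx)
  qed
qed

section \<open>A dominant eigenvalue with bounded scaled resolvent\<close>

lemma real_resolvent_locale:
  assumes "spectral_bound A = ereal s"
  shows "real_ev_pos_resolvent Tr s (\<lambda>l. restrict_real (resolvent (of_real l) A))"
proof (intro real_ev_pos_resolvent.intro real_ev_pos_resolvent_axioms.intro R.real_ev_pos_semigroup_axioms)
  fix l assume "s < l"
  then show "R.res l (restrict_real (resolvent l A))"
    by (intro resolvent_real spectral_bound_resolvent_set[OF assms]) simp
qed

theorem dominant_eigenvalue:
  assumes s: "spectral_bound A = ereal s" and ev: "eigenvalue A (of_real s)"
    and bd: "0 < \<delta>" "\<And>l::real. s < l \<Longrightarrow> l < s + \<delta> \<Longrightarrow>
      onorm (\<lambda>f. (l - s) *\<^sub>R resolvent (of_real l) A f) \<le> M"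
  shows "algebraically_simple_eigenvalue A (of_real s)"
    and "\<exists>u. quasi_interior u \<and> kernel (shifted (of_real s) A) = cplx.span {u}"
    and "\<exists>\<phi>\<in>dual_eigenspace A (of_real s). strictly_positive \<phi>"
proof -
  define Rs where "Rs l = restrict_real (resolvent (complex_of_real l) A)" for l
  interpret S: real_ev_pos_resolvent Tr s Rs
    unfolding Rs_def[abs_def] by (rule real_resolvent_locale[OF s])
  have eig_iff: "(x, s *\<^sub>R x) \<in> R.gen \<longleftrightarrow> (\<forall>t\<ge>0. Tr t x = exp (s * t) *\<^sub>R x)" for x
    by (rule R.eigenvector_iff[OF S.res_R[of "s + 1"]]) auto
  have ker_iff: "f \<in> kernel (shifted (of_real s) A) \<longleftrightarrow>
      (cre f, s *\<^sub>R cre f) \<in> R.gen \<and> (cim f, s *\<^sub>R cim f) \<in> R.gen" for f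
    by (simp add: kernel_shifted generator_iff scaleC_of_real)
  obtain f where f: "f \<in> kernel (shifted (of_real s) A)" "f \<noteq> 0" using ev by (auto simp: eigenvalue_def)
  \<comment> \<open>The eigenvalue is real and the generator acts on the two parts separately, so
    the real or the imaginary part of \<open>f\<close> is a nonzero real eigenvector.\<close>
  obtain v where v: "v \<noteq> 0" "\<And>t. 0 \<le> t \<Longrightarrow> Tr t v = exp (s * t) *\<^sub>R v"
  proof (cases "cre f = 0")
    case True
    then have "cim f \<noteq> 0" using f(2) by (simp add: complexification_eq_iff)
    then show thesis using that f(1) by (auto simp: ker_iff eig_iff)
  next
    case False
    then show thesis using that f(1) by (auto simp: ker_iff eig_iff)
  qed
  have bound: "norm ((l - s) *\<^sub>R Rs l x) \<le> M * norm x" if l: "s < l" "l < s + \<delta>" for l x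
  proof -
    have "complex_of_real l \<in> resolvent_set A" using l by (intro spectral_bound_resolvent_set[OF s]) simp
    then have "bounded_linear (\<lambda>f. (l - s) *\<^sub>R resolvent l A f)"
      using resolvent_bounded_clinear unfolding bounded_clinear_def by (intro bounded_linear_const_scaleR) blast
    from onorm[OF this, of "Cplx x 0"] onorm_pos_le[OF this]
    have "norm ((l - s) *\<^sub>R resolvent l A (Cplx x 0)) \<le> M * norm x" "0 \<le> M"
      using bd(2)[OF l] norm_Cplx_0[of x]
      by (auto intro!: order_trans[OF _ mult_mono[of _ M "norm (Cplx x 0)" "norm x"]] elim: order_trans)
    moreover have "(l - s) *\<^sub>R Rs l x = cre ((l - s) *\<^sub>R resolvent l A (Cplx x 0))"
      by (simp add: Rs_def restrict_real_def)
    ultimately show ?thesis using norm_cre_le order_trans by metis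
  qed
  obtain \<phi> :: "'a \<Rightarrow> real" where \<phi>: "bounded_linear \<phi>" "\<And>x. 0 \<le> x \<Longrightarrow> 0 \<le> \<phi> x" "\<phi> \<bar>v\<bar> \<noteq> 0"
    "\<And>t x. 0 \<le> t \<Longrightarrow> \<phi> (Tr t x) = exp (s * t) * \<phi> x"
    by (rule S.dual_eigenvector_exists[OF v bd(1) bound]) blast+
  obtain u where u: "0 \<le> u" "\<phi> u = 1" "\<And>t. 0 \<le> t \<Longrightarrow> Tr t u = exp (s * t) *\<^sub>R u"
    "closure {x. \<exists>c>0. \<bar>x\<bar> \<le> c *\<^sub>R u} = UNIV"
    "\<And>v. (\<And>t. 0 \<le> t \<Longrightarrow> Tr t v = exp (s * t) *\<^sub>R v) \<Longrightarrow> v = \<phi> v *\<^sub>R u"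
    by (rule R.eigenspace_one_dimensional[OF \<phi> v]) blast+
  interpret \<phi>: bounded_linear \<phi> by (rule \<phi>(1))
  define K where "K = kernel (shifted (of_real s) A)"
  have uK: "Cplx u 0 \<in> K" using u(3) eig_iff gen_zero by (simp add: K_def ker_iff)
  have K_eq: "g = complexify \<phi> g *\<^sub>C Cplx u 0" if "g \<in> K" for g
  proof -
    have "cre g = \<phi> (cre g) *\<^sub>R u" "cim g = \<phi> (cim g) *\<^sub>R u"
      using that unfolding K_def ker_iff eig_iff by (intro u(5); simp)+
    then show ?thesis by (simp add: complexification_eq_iff scaleC_def complexify_def)
  qed
  have gen_scaleR: "(c *\<^sub>R u, s *\<^sub>R c *\<^sub>R u) \<in> R.gen" for c
    unfolding eig_iff using u(3) by (simp add: R.T_scaleR mult.commute)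
  have K_span: "K = cplx.span {Cplx u 0}"
  proof (intro subset_antisym subsetI)
    show "g \<in> cplx.span {Cplx u 0}" if "g \<in> K" for g
      using K_eq[OF that] by (auto simp: cplx.span_singleton)
    fix g assume "g \<in> cplx.span {Cplx u 0}"
    then obtain c where "g = c *\<^sub>C Cplx u 0" by (auto simp: cplx.span_singleton)
    then show "g \<in> K" using gen_scaleR[of "Re c"] gen_scaleR[of "Im c"]
      by (simp add: K_def ker_iff scaleC_def)
  qed
  have "u \<noteq> 0" using u(2) by (auto simp: \<phi>.zero)
  have qi: "quasi_interior (Cplx u 0)" by (rule quasi_interior_Cplx[OF u(1,4)])
  then show "\<exists>u. quasi_interior u \<and> kernel (shifted (of_real s) A) = cplx.span {u}"
    using K_span K_def by blast
  have sp: "strictly_positive (complexify \<phi>)"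
    by (rule complexify_strictly_positive[OF \<phi>(1,2) R.eigenfunctional_strictly_positive[OF \<phi>]])
  have gen_\<phi>: "complexify \<phi> h = of_real s * complexify \<phi> g" if "(g, h) \<in> A" for g h
    using that R.eigenfunctional_gen[OF \<phi>(1,4)]
    by (auto simp: generator_iff complexify_def complex_eq_iff)
  have "complexify \<phi> \<in> dual_space" by (rule complexify_dual_space[OF \<phi>(1)])
  moreover from this have "(\<lambda>f. of_real s * complexify \<phi> f) \<in> dual_space"
    by (auto simp: dual_space_def intro: bounded_linear_const_mult)
  ultimately have "complexify \<phi> \<in> dual_eigenspace A (of_real s)"
    using gen_\<phi> by (auto simp: dual_eigenspace_def dual_operator_def)
  then show "\<exists>\<phi>\<in>dual_eigenspace A (of_real s). strictly_positive \<phi>" using sp by blast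
  \<comment> \<open>\<open>complexify \<phi>\<close> annihilates the range of \<open>s - A\<close>,
    yet is injective on the one-dimensional \<open>K\<close>. A vector of \<open>K\<close> in that
    range is therefore zero, and chains of generalized eigenvectors have length one. The zeroth
    power is the identity relation, with kernel \<open>{0}\<close>.\<close>
  have gen_ker: "kernel (shifted (of_real s) A ^^ n) \<subseteq> K" for n
  proof (induction n)
    case 0
    then show ?case using K_span cplx.span_zero by (auto simp: kernel_def)
  next
    case (Suc n)
    show ?case
    proof
      fix g assume "g \<in> kernel (shifted (of_real s) A ^^ Suc n)"
      then have "(g, 0) \<in> shifted (of_real s) A ^^ Suc n" by (simp only: kernel_def mem_Collect_eq)
      then obtain h where h: "(g, h) \<in> shifted (of_real s) A" "(h, 0) \<in> shifted (of_real s) A ^^ n"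
        by (elim relpow_Suc_E2) blast
      have hK: "h \<in> K" using h(2) Suc.IH by (auto simp: kernel_def)
      obtain k where k: "(g, k) \<in> A" "h = of_real s *\<^sub>C g - k" using h(1) by (auto simp: shifted_def)
      have "complexify \<phi> h = 0"
        using gen_\<phi>[OF k(1)] k(2)
        by (simp add: complexify_def \<phi>.diff \<phi>.scaleR complex_eq_iff scaleC_of_real)
      then have "h = 0" using K_eq[OF hK] by simp
      then show "g \<in> K" using h(1) by (simp add: K_def kernel_def)
    qed
  qed
  have "(\<Union>n. kernel (shifted (of_real s) A ^^ n)) = K"
  proof
    have "K = kernel (shifted (of_real s) A ^^ 1)" by (simp add: K_def)
    then show "K \<subseteq> (\<Union>n. kernel (shifted (of_real s) A ^^ n))" by blast
  qed (use gen_ker in blast)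
  moreover have "cplx.dim K = 1"
  proof -
    have "cplx.independent {Cplx u 0}"
      using \<open>u \<noteq> 0\<close> by (simp add: cplx.dependent_single complexification_eq_iff)
    then show ?thesis by (simp add: K_span cplx.dim_span cplx.dim_eq_card_independent)
  qed
  ultimately show "algebraically_simple_eigenvalue A (of_real s)"
    using ev by (simp add: algebraically_simple_eigenvalue_def)
qed

section \<open>Mean ergodic semigroups\<close>

lemma cesaro_mean_eq:
  assumes "0 \<le> t"
  shows "cesaro_mean T t f = Cplx (R.cesaro t (cre f)) (R.cesaro t (cim f))"
proof -
  have emb: "bounded_linear (\<lambda>x::'a. Cplx x 0)"
    by (rule bounded_linear_intro[of _ 1])
      (simp_all add: complexification_eq_iff norm_Cplx_0)
  have int: "((\<lambda>r. Tr r x) has_integral integral {0..t} (\<lambda>r. Tr r x)) {0..t}" for x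
    using R.integrable_T[of 0 x t] by (simp add: has_integral_integral)
  have "((\<lambda>r. Cplx (Tr r (cre f)) 0 + \<i> *\<^sub>C Cplx (Tr r (cim f)) 0) has_integral
      Cplx (integral {0..t} (\<lambda>r. Tr r (cre f))) 0 + \<i> *\<^sub>C Cplx (integral {0..t} (\<lambda>r. Tr r (cim f))) 0) {0..t}"
    using has_integral_add[OF has_integral_linear[OF int[of "cre f"] emb]
        has_integral_linear[OF has_integral_linear[OF int[of "cim f"] emb] bounded_linear_scaleC_right[of \<i>]]]
    by (simp add: comp_def)
  then have "((\<lambda>r. T r f) has_integral
      Cplx (integral {0..t} (\<lambda>r. Tr r (cre f))) 0 + \<i> *\<^sub>C Cplx (integral {0..t} (\<lambda>r. Tr r (cim f))) 0) {0..t}"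
    by (rule has_integral_eq[rotated]) (simp add: T_eq scaleC_def complexification_eq_iff)
  from integral_unique[OF this] show ?thesis
    by (simp add: cesaro_mean_def R.cesaro_def scaleC_def complexification_eq_iff)
qed

theorem mean_ergodic_rank_one:
  assumes me: "mean_ergodic T" and nz: "mean_ergodic_projection T \<noteq> (\<lambda>f. 0)"
  obtains u \<phi> where "quasi_interior u" "strictly_positive \<phi>" "mean_ergodic_projection T = u \<otimes>\<^sub>R \<phi>"
proof -
  define P where "P = mean_ergodic_projection T"
  have lim: "((\<lambda>t. cesaro_mean T t f) \<longlongrightarrow> P f) at_top" for f
  proof -
    obtain g where "((\<lambda>t. cesaro_mean T t f) \<longlongrightarrow> g) at_top" using me unfolding mean_ergodic_def by blast
    moreover from this have "P f = g"
      unfolding P_def mean_ergodic_projection_def by (intro tendsto_Lim) simp_all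
    ultimately show ?thesis by simp
  qed
  have "((\<lambda>t. Cplx (R.cesaro t (cre f)) (R.cesaro t (cim f))) \<longlongrightarrow> P f) at_top" for f
    by (rule Lim_transform_eventually[OF lim])
      (use eventually_ge_at_top[of 0] in \<open>eventually_elim, simp add: cesaro_mean_eq\<close>)
  then have lim': "((\<lambda>t. R.cesaro t (cre f)) \<longlongrightarrow> cre (P f)) at_top"
    "((\<lambda>t. R.cesaro t (cim f)) \<longlongrightarrow> cim (P f)) at_top" for f
    by (simp_all add: tendsto_complexification_iff)
  define Q where "Q = restrict_real P"
  have limQ: "((\<lambda>t. R.cesaro t x) \<longlongrightarrow> Q x) at_top" for x
    using lim'(1)[of "Cplx x 0"] by (simp add: Q_def restrict_real_def)
  have P_eq: "P f = Cplx (Q (cre f)) (Q (cim f))" for f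
    using tendsto_unique[OF _ lim'(1) limQ, of f] tendsto_unique[OF _ lim'(2) limQ, of f]
    by (simp add: complexification_eq_iff)
  note Q = R.cesaro_limit[where P = Q, OF limQ]
  interpret Q: bounded_linear Q by (rule Q(1))
  obtain f where "P f \<noteq> 0" using nz by (auto simp: P_def)
  then obtain y where y: "Q y \<noteq> 0" by (auto simp: P_eq complexification_eq_iff)
  obtain u \<phi> where u: "0 \<le> u" "closure {x. \<exists>c>0. \<bar>x\<bar> \<le> c *\<^sub>R u} = UNIV"
    "bounded_linear \<phi>" "\<And>x. 0 \<le> x \<Longrightarrow> 0 \<le> \<phi> x" "\<And>x. 0 \<le> x \<Longrightarrow> \<phi> x = 0 \<Longrightarrow> x = 0"
    "\<And>x. Q x = (1 * \<phi> x) *\<^sub>R u"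
  \<comment> \<open>Exponent 0, since the range of \<open>Q\<close> consists of fixed vectors of the
    semigroup, and scalar 1, since \<open>Q\<close> leaves fixed vectors unchanged.\<close>
  proof (rule R.invariant_operator_rank_one[of Q y 0 1])
    show "0 \<le> Q x" if "0 \<le> x" for x by (rule R.cesaro_limit_nonneg[OF limQ that])
  qed (use y Q in auto)
  show thesis
  proof (rule that[OF quasi_interior_Cplx[OF u(1,2)] complexify_strictly_positive[OF u(3-5)]])
    show "mean_ergodic_projection T = Cplx u 0 \<otimes>\<^sub>R complexify \<phi>"
      unfolding P_def[symmetric] rank_one_Cplx by (simp add: fun_eq_iff P_eq u(6))
  qed
qed

text \<open>Along the real axis \<open>(l - s) ^ m\<close> times the resolvent tends to the leading
  coefficient, which is therefore real, positive and intertwined with the semigroup. Its rank-one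
  form comes with \<open>a \<noteq> 0\<close>, hence order one, and then the leading coefficient is
  the spectral projection.\<close>

theorem dominant_pole:
  assumes s: "spectral_bound A = ereal s" and pole: "resolvent_pole_of_order A (of_real s) m"
  shows "m = 1" and "\<exists>u \<phi>. quasi_interior u \<and> strictly_positive \<phi> \<and>
      spectral_projection A (of_real s) = u \<otimes>\<^sub>R \<phi>"
proof -
  define Rs where "Rs l = restrict_real (resolvent (complex_of_real l) A)" for l
  interpret S: real_ev_pos_resolvent Tr s Rs
    unfolding Rs_def[abs_def] by (rule real_resolvent_locale[OF s])
  obtain U \<rho> B where m: "m \<ge> 1" and U: "\<And>n::nat. bounded_clinear (U n)" "U 0 \<noteq> (\<lambda>f. 0)"
    and B: "0 < \<rho>" "0 \<le> B"
    and sums: "\<And>l f. l \<noteq> of_real s \<Longrightarrow> norm (l - of_real s) \<le> \<rho> \<Longrightarrow>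
      (\<lambda>n. (l - of_real s) ^ n *\<^sub>C U n f) sums ((l - of_real s) ^ m *\<^sub>C resolvent l A f)"
    and UB: "\<And>n f. norm (U n f) \<le> B / \<rho> ^ n * norm f"
    by (rule resolvent_pole_expansion[OF pole]) blast
  have "((\<lambda>l. (l - of_real s) ^ m *\<^sub>C resolvent l A f) \<longlongrightarrow> U 0 f) (at (complex_of_real s))" for f
    by (rule resolvent_pole_limit[OF B UB sums])
  moreover have "filterlim complex_of_real (at (complex_of_real s)) (at_right s)"
    unfolding filterlim_at by (auto intro!: tendsto_intros simp: eventually_at_filter)
  ultimately have lim: "((\<lambda>l. (complex_of_real l - of_real s) ^ m *\<^sub>C resolvent l A f) \<longlongrightarrow> U 0 f) (at_right s)" for f
    by (rule filterlim_compose)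
  have rs: "(complex_of_real l - of_real s) ^ m *\<^sub>C resolvent l A (Cplx x 0) = Cplx ((l - s) ^ m *\<^sub>R Rs l x) 0"
    if "s < l" for l x
  proof -
    have "real_operator (resolvent l A)"
      using that by (intro resolvent_real spectral_bound_resolvent_set[OF s]) simp
    then have "resolvent l A (Cplx x 0) = Cplx (Rs l x) 0"
      by (simp add: real_operator_def Rs_def restrict_real_def complexification_eq_iff)
    moreover have "(complex_of_real l - of_real s) ^ m = of_real ((l - s) ^ m)" by simp
    ultimately show ?thesis by (simp only: scaleC_of_real) (simp add: complexification_eq_iff)
  qed
  have lim_real: "((\<lambda>l. Cplx ((l - s) ^ m *\<^sub>R Rs l x) 0) \<longlongrightarrow> U 0 (Cplx x 0)) (at_right s)" for x
    by (rule Lim_transform_eventually[OF lim])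
      (use eventually_at_right_less[of s] in \<open>eventually_elim, simp add: rs\<close>)
  define V where "V = restrict_real (U 0)"
  have limV: "((\<lambda>l. (l - s) ^ m *\<^sub>R Rs l x) \<longlongrightarrow> V x) (at_right s)"
    and "((\<lambda>l. 0) \<longlongrightarrow> cim (U 0 (Cplx x 0))) (at_right s)" for x
    using lim_real[of x] by (simp_all add: tendsto_complexification_iff V_def restrict_real_def)
  then have "cim (U 0 (Cplx x 0)) = 0" for x
    using tendsto_unique[OF _ tendsto_const] trivial_limit_at_right_real by metis
  then have real: "real_operator (U 0)" using U(1) by (simp add: real_operator_def)
  have U_eq: "U 0 f = Cplx (V (cre f)) (V (cim f))" for f
    unfolding V_def by (rule real_operator_eq[OF real])
  have blV: "bounded_linear V" unfolding V_def by (rule bounded_linear_restrict_real[OF real])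
  interpret V: bounded_linear V by (rule blV)
  obtain f where "U 0 f \<noteq> 0" using U(2) by auto
  then obtain y where y: "V y \<noteq> 0" by (auto simp: U_eq complexification_eq_iff)
  have mpos: "0 < m" using m by simp
  note V = S.scaled_res_limit[where U = V, OF mpos limV]
  \<comment> \<open>On an eigenvector \<open>v\<close> the resolvent acts as division by
    \<open>l - s\<close>, so
    \<open>(l - s) ^ m *\<^sub>R Rs l v = (l - s) ^ (m - 1) *\<^sub>R v\<close>; \<open>a\<close> is
    the limit of the remaining power.\<close>
  define a :: real where "a = (if m = 1 then 1 else 0)"
  have Vv: "V v = a *\<^sub>R v" if v: "\<And>t. 0 \<le> t \<Longrightarrow> Tr t v = exp (s * t) *\<^sub>R v" for v
  proof -
    have "((\<lambda>l. (l - s) ^ (m - 1)) \<longlongrightarrow> a) (at_right s)"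
    proof (cases "m = 1")
      case False
      then show ?thesis using S.tendsto_power_s[of "m - 1"] m by (simp add: a_def)
    qed (simp add: a_def)
    then have "((\<lambda>l. (l - s) ^ (m - 1) *\<^sub>R v) \<longlongrightarrow> a *\<^sub>R v) (at_right s)"
      by (intro tendsto_intros)
    moreover have "\<forall>\<^sub>F l in at_right s. (l - s) ^ (m - 1) *\<^sub>R v = (l - s) ^ m *\<^sub>R Rs l v"
      using eventually_at_right_less[of s]
    proof eventually_elim
      case (elim l)
      have "(l - s) ^ m *\<^sub>R Rs l v = (l - s) ^ (m - 1) *\<^sub>R (l - s) *\<^sub>R Rs l v"
        using m by (cases m) (simp_all add: mult.commute)
      then show ?case using S.R_eigenvector[OF elim v] by simp
    qed
    ultimately have "((\<lambda>l. (l - s) ^ m *\<^sub>R Rs l v) \<longlongrightarrow> a *\<^sub>R v) (at_right s)"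
      by (rule Lim_transform_eventually)
    then show ?thesis using tendsto_unique[OF _ limV] trivial_limit_at_right_real by blast
  qed
  obtain u \<phi> where u: "a \<noteq> 0" "0 \<le> u" "closure {x. \<exists>c>0. \<bar>x\<bar> \<le> c *\<^sub>R u} = UNIV"
    "bounded_linear \<phi>" "\<And>x. 0 \<le> x \<Longrightarrow> 0 \<le> \<phi> x" "\<And>x. 0 \<le> x \<Longrightarrow> \<phi> x = 0 \<Longrightarrow> x = 0"
    "\<And>x. V x = (a * \<phi> x) *\<^sub>R u"
  proof (rule R.invariant_operator_rank_one[of V y s a])
    show "0 \<le> V x" if "0 \<le> x" for x by (rule V(1)[OF that])
    show "V (Tr t x) = exp (s * t) *\<^sub>R V x" "Tr t (V x) = exp (s * t) *\<^sub>R V x" if "0 \<le> t" for t x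
      by (rule V(2)[OF that], rule V(3)[OF that])
  qed (rule blV, rule y, erule Vv, rule that)
  show m1: "m = 1" using u(1) by (auto simp: a_def split: if_splits)
  have "spectral_projection A (of_real s) = U 0"
    using sums by (intro spectral_projection_simple_pole[OF B UB]) (simp add: m1)
  also have "\<dots> = Cplx u 0 \<otimes>\<^sub>R complexify \<phi>"
    unfolding rank_one_Cplx using u(7) by (simp add: fun_eq_iff U_eq a_def m1)
  finally show "\<exists>u \<phi>. quasi_interior u \<and> strictly_positive \<phi> \<and> spectral_projection A (of_real s) = u \<otimes>\<^sub>R \<phi>"
    using quasi_interior_Cplx[OF u(2,3)] complexify_strictly_positive[OF u(4-6)] by blast
qed

end

theorem corollary4p4:
  fixes T :: "real \<Rightarrow> 'a::banach_lattice complexification \<Rightarrow> 'a complexification"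
    and A :: "'a operator"
  assumes "C0_semigroup T" and "A = generator T"
    and "real_semigroup T"
    and "individually_eventually_positive T"
    and "persistently_irreducible T"
  shows "(\<forall>s::real. spectral_bound A = ereal s \<and> eigenvalue A (of_real s) \<and>
            (\<exists>\<delta>>0. \<exists>M. \<forall>l::real. s < l \<and> l < s + \<delta> \<longrightarrow>
               onorm (\<lambda>f. (l - s) *\<^sub>R resolvent (of_real l) A f) \<le> M)
          \<longrightarrow> algebraically_simple_eigenvalue A (of_real s) \<and>
              (\<exists>u. quasi_interior u \<and> kernel (shifted (of_real s) A) = cplx.span {u}) \<and>
              (\<exists>\<phi>\<in>dual_eigenspace A (of_real s). strictly_positive \<phi>))
       \<and> (mean_ergodic T \<and> mean_ergodic_projection T \<noteq> (\<lambda>f. 0)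
          \<longrightarrow> (\<exists>u \<phi>. quasi_interior u \<and> strictly_positive \<phi> \<and>
                 mean_ergodic_projection T = u \<otimes>\<^sub>R \<phi>))
       \<and> (\<forall>s::real. spectral_bound A = ereal s \<and> resolvent_pole A (of_real s)
          \<longrightarrow> resolvent_pole_of_order A (of_real s) 1 \<and>
              (\<exists>u \<phi>. quasi_interior u \<and> strictly_positive \<phi> \<and>
                 spectral_projection A (of_real s) = u \<otimes>\<^sub>R \<phi>))"
proof -
  interpret ev_pos_semigroup T by unfold_locales (use assms in auto)
  show ?thesis
    unfolding assms(2)
  proof (intro conjI allI impI; elim conjE exE)
    fix s \<delta> M :: real
    assume *: "spectral_bound (generator T) = ereal s" "eigenvalue (generator T) (of_real s)" "0 < \<delta>"
      "\<forall>l. s < l \<and> l < s + \<delta> \<longrightarrow>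
        onorm (\<lambda>f. (l - s) *\<^sub>R resolvent (complex_of_real l) (generator T) f) \<le> M"
    then have bd: "onorm (\<lambda>f. (l - s) *\<^sub>R resolvent (complex_of_real l) (generator T) f) \<le> M"
      if "s < l" "l < s + \<delta>" for l
      using that by blast
    show "algebraically_simple_eigenvalue (generator T) (of_real s)"
      "\<exists>u. quasi_interior u \<and> kernel (shifted (of_real s) (generator T)) = cplx.span {u}"
      "\<exists>\<phi>\<in>dual_eigenspace (generator T) (of_real s). strictly_positive \<phi>"
      by (rule dominant_eigenvalue[OF *(1-3) bd]; assumption)+
  next
    assume "mean_ergodic T" "mean_ergodic_projection T \<noteq> (\<lambda>f. 0)"
    then show "\<exists>u \<phi>. quasi_interior u \<and> strictly_positive \<phi> \<and> mean_ergodic_projection T = u \<otimes>\<^sub>R \<phi>"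
      by (rule mean_ergodic_rank_one) blast
  next
    fix s :: real assume s: "spectral_bound (generator T) = ereal s" "resolvent_pole (generator T) (of_real s)"
    then obtain m where m: "resolvent_pole_of_order (generator T) (of_real s) m"
      by (auto simp: resolvent_pole_def)
    show "resolvent_pole_of_order (generator T) (of_real s) 1"
      using m dominant_pole(1)[OF s(1) m] by simp
    show "\<exists>u \<phi>. quasi_interior u \<and> strictly_positive \<phi> \<and> spectral_projection (generator T) (of_real s) = u \<otimes>\<^sub>R \<phi>"
      by (rule dominant_pole(2)[OF s(1) m])
  qed
qed

end
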